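(* Let $n\ge2$ and let $Z_{MOY}:\mathbf{TD}\to\mathbf{MOY}$ be the unique rigid braided monoidal functor with $Z_{MOY}(\uparrow)=\uparrow^1$. Then $Z_{MOY}$ factors through the quotient $\mathbf{Jones}_n$ of $\mathbf{TD}$.
   Context: Coefficient ring: $\mathbb Q[q,q^{-1},(q-q^{-1})^{-1}]$. Diagrams are read bottom to top, up to plane isotopy; $\circ$ is stacking (left factor on top), $\otimes$ juxtaposition. $[j]_q=\frac{q^j-q^{-j}}{q-q^{-1}}$. **Tangles.** $\mathbf{TD}$: objects are finite sequences of $\uparrow,\downarrow$; morphisms are linear combinations of oriented plane tangle diagrams modulo the tensor ideal generated by all oriented Reidemeister moves; it is rigid braided untwisted. Let $X_+$ (resp. $X_-$) be the crossing of two upward strands with over-strand running from bottom left to top right (resp. bottom right to top left). $\mathbf{Jones}_n$ is the quotient of $\mathbf{TD}$ by the tensor ideal generated by $q^{-n}X_+-q^nX_--(q^{-1}-q)\mathrm{id}_{\uparrow\uparrow}$ and $\bigcirc-[n]_q\emptyset$, with $\bigcirc$ the unknot. **$\mathbf{MOY}$.** $\mathbf{TrPD}$: objects are finite sequences of $\uparrow^1,\downarrow^1$; morphisms are linear combinations of oriented plane trivalent graphs with edges labelled in $\{1,2\}$, boundary edges labelled 1, such that at each vertex the sum of incoming labels equals the sum of outgoing labels. It is rigid monoidal; morphisms are generated by identities, caps $\overrightarrow{ev}:\uparrow^1\downarrow^1\to\emptyset$, $\overleftarrow{ev}:\downarrow^1\uparrow^1\to\emptyset$, cups $\overrightarrow{coev}:\emptyset\to\uparrow^1\downarrow^1$,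 $\overleftarrow{coev}:\emptyset\to\downarrow^1\uparrow^1$, the graph $S:\uparrow^1\uparrow^1\to\uparrow^1\uparrow^1$ (two 1-edges merge into a 2-edge which splits into two 1-edges) and its dual $S^\vee$ (reversed orientations). Write $\mathrm{id}=\mathrm{id}_{\uparrow^1}$, $\mathrm{id}^\vee=\mathrm{id}_{\downarrow^1}$. $\mathbf{MOY}$ is the quotient of $\mathbf{TrPD}$ by the tensor ideal generated by the following relations and their duals (all orientations reversed): (1) the circle labelled 1 equals $[n]_q\,\emptyset$; (2) $S\circ S=(q+q^{-1})S$; (3) $(\overleftarrow{ev}\otimes\mathrm{id})\circ(\mathrm{id}^\vee\otimes S)\circ(\overleftarrow{coev}\otimes\mathrm{id})=[n-1]_q\,\mathrm{id}$; (4) $(\mathrm{id}\otimes\overrightarrow{ev}\otimes\mathrm{id}^\vee)\circ(S\otimes S^\vee)\circ(\mathrm{id}\otimes\overrightarrow{coev}\otimes\mathrm{id}^\vee)=\overrightarrow{coev}\circ\overrightarrow{ev}+[n-2]_q\,\mathrm{id}\otimes\mathrm{id}^\vee$; (5) $(S\otimes\mathrm{id})(\mathrm{id}\otimes S)(S\otimes\mathrm{id})+\mathrm{id}\otimes S=(\mathrm{id}\otimes S)(S\otimes\mathrm{id})(\mathrm{id}\otimes S)+S\otimes\mathrm{id}$. It is rigid braided untwisted with $\sigma^+=q^{n-1}\mathrm{id}_{\uparrow^1\uparrow^1}-q^nS$, $\sigma^-=q^{1-n}\mathrm{id}_{\uparrow^1\uparrow^1}-q^{-n}S$. $Z_{MOY}$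 sends cups and caps to cups and caps and $X_\pm$ to $\sigma^\pm$. *)

theory Defs
  imports
    "HOL-Computational_Algebra.Fraction_Field"
    "HOL-Computational_Algebra.Polynomial"
    "HOL-Library.Poly_Mapping"
    "HOL-Library.FuncSet"
begin

hide_const (open) Rat.Fract

section \<open>The coefficient ring $Q[q, 1/q, 1/(q - 1/q)]$\<close>

abbreviation qX :: "rat poly fract" where
  "qX \<equiv> Fract [:0, 1:] 1"

definition qcarrier :: "rat poly fract set" where
  "qcarrier = {Fract p 1 / (qX ^ i * (qX - inverse qX) ^ j) | p i j. True}"

lemma qX_nonzero: "qX \<noteq> 0"
  by (simp add: Zero_fract_def eq_fract)

lemma qX_diff: "qX - inverse qX = Fract [:-1, 0, 1:] 1 / qX"
  using qX_nonzero by (simp add: eq_fract one_pCons)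

lemma qX_diff_nonzero: "qX - inverse qX \<noteq> 0"
  unfolding qX_diff using qX_nonzero by (simp add: Zero_fract_def eq_fract)

lemma fract_pow: "Fract (p :: rat poly) 1 ^ k = Fract (p ^ k) 1"
  by (induction k) (simp_all add: One_fract_def)

lemma qcarrier_iff:
  "x \<in> qcarrier \<longleftrightarrow> (\<exists>k p. x * Fract ([:0, -1, 0, 1:] ^ k) 1 = Fract p 1)"
proof
  define E where "E = Fract [:-1, 0, 1 :: rat:] 1"
  define D where "D = qX - inverse qX"
  have D: "D = E / qX" unfolding D_def E_def by (rule qX_diff)
  have E0: "E \<noteq> 0" using qX_diff_nonzero D unfolding D_def by auto
  have QE: "Fract ([:0, -1, 0, 1:] ^ k) 1 = (qX * E) ^ k" for k
    unfolding E_def by (simp add: fract_pow)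
  { assume "x \<in> qcarrier"
    then obtain p i j where x: "x = Fract p 1 / (qX ^ i * D ^ j)"
      unfolding qcarrier_def D_def by auto
    have "x * (qX * E) ^ (i + j) = Fract p 1 * qX ^ j * qX ^ j * E ^ i"
      unfolding x D using qX_nonzero E0
      by (simp add: power_mult_distrib power_add power_divide del: mult_fract divide_fract)
    also have "\<dots> = Fract (p * [:0, 1:] ^ j * [:0, 1:] ^ j * [:-1, 0, 1:] ^ i) 1"
      unfolding E_def by (simp add: fract_pow)
    finally show "\<exists>k p. x * Fract ([:0, -1, 0, 1:] ^ k) 1 = Fract p 1"
      unfolding QE by blast }
  { assume "\<exists>k p. x * Fract ([:0, -1, 0, 1:] ^ k) 1 = Fract p 1"
    then obtain k p where *: "x * (qX * E) ^ k = Fract p 1"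
      unfolding QE by blast
    have "x = Fract p 1 / (qX * E) ^ k"
      using * qX_nonzero E0 by (simp add: field_simps del: mult_fract divide_fract)
    moreover have "E = D * qX" using D qX_nonzero by (simp del: mult_fract divide_fract)
    ultimately have "x = Fract p 1 / (qX ^ (k + k) * D ^ k)"
      by (simp add: power_mult_distrib power_add mult_ac del: mult_fract divide_fract)
    then show "x \<in> qcarrier" unfolding qcarrier_def D_def by blast }
qed

lemma qcarrier_Fract [intro]: "Fract p 1 \<in> qcarrier"
proof -
  have "Fract p 1 * Fract ([:0, -1, 0, 1:] ^ 0) 1 = Fract p 1" by simp
  then show ?thesis unfolding qcarrier_iff by blast
qed

lemma qcarrier_diff:
  assumes "x \<in> qcarrier" "y \<in> qcarrier" shows "x - y \<in> qcarrier"
proof -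
  let ?c = "\<lambda>k. Fract ([:0, -1, 0, 1 :: rat:] ^ k) 1"
  obtain k p l r where k: "x * ?c k = Fract p 1" and l: "y * ?c l = Fract r 1"
    using assms unfolding qcarrier_iff by blast
  have c: "?c (k + l) = ?c k * ?c l" by (simp add: power_add)
  have "(x - y) * ?c (k + l) = (x * ?c k) * ?c l - (y * ?c l) * ?c k"
    unfolding c by (simp add: algebra_simps del: mult_fract)
  also have "\<dots> = Fract (p * [:0, -1, 0, 1:] ^ l - r * [:0, -1, 0, 1:] ^ k) 1"
    unfolding k l by simp
  finally show ?thesis unfolding qcarrier_iff by blast
qed

lemma qcarrier_mult:
  assumes "x \<in> qcarrier" "y \<in> qcarrier" shows "x * y \<in> qcarrier"
proof -
  let ?c = "\<lambda>k. Fract ([:0, -1, 0, 1 :: rat:] ^ k) 1"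
  obtain k p l r where k: "x * ?c k = Fract p 1" and l: "y * ?c l = Fract r 1"
    using assms unfolding qcarrier_iff by blast
  have c: "?c (k + l) = ?c k * ?c l" by (simp add: power_add)
  have "x * y * ?c (k + l) = (x * ?c k) * (y * ?c l)"
    unfolding c by (simp only: mult_ac)
  also have "\<dots> = Fract (p * r) 1" unfolding k l by simp
  finally show ?thesis unfolding qcarrier_iff by blast
qed

lemma qcarrier_0 [intro]: "0 \<in> qcarrier" and qcarrier_1 [intro]: "1 \<in> qcarrier"
  by (auto simp: Zero_fract_def One_fract_def)

typedef qring = qcarrier by auto

setup_lifting type_definition_qring

instantiation qring :: comm_ring_1
begin

lift_definition zero_qring :: qring is 0 by auto
lift_definition one_qring :: qring is 1 by auto
lift_definition minus_qring :: "qring \<Rightarrow> qring \<Rightarrow> qring" is "(-)" by (rule qcarrier_diff)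
lift_definition uminus_qring :: "qring \<Rightarrow> qring" is uminus
  using qcarrier_diff[OF qcarrier_0] by simp
lift_definition plus_qring :: "qring \<Rightarrow> qring \<Rightarrow> qring" is "(+)"
proof -
  fix x y :: "rat poly fract" assume "x \<in> qcarrier" "y \<in> qcarrier"
  then have "x - (0 - y) \<in> qcarrier" by (blast intro: qcarrier_diff)
  then show "x + y \<in> qcarrier" by simp
qed
lift_definition times_qring :: "qring \<Rightarrow> qring \<Rightarrow> qring" is "(*)" by (rule qcarrier_mult)

instance
  by standard (transfer; simp add: algebra_simps)+

end

lift_definition q :: qring is qX by auto

lift_definition q_inv :: qring is "inverse qX"
proof -
  have "inverse qX = Fract 1 1 / (qX ^ 1 * (qX - inverse qX) ^ 0)"
    unfolding One_fract_def[symmetric] by (simp add: inverse_eq_divide del: inverse_fract divide_fract)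
  then show "inverse qX \<in> qcarrier" unfolding qcarrier_def by blast
qed

lift_definition qdiff_inv :: qring is "inverse (qX - inverse qX)"
proof -
  have "inverse (qX - inverse qX) = Fract 1 1 / (qX ^ 0 * (qX - inverse qX) ^ 1)"
    unfolding One_fract_def[symmetric]
    by (simp add: inverse_eq_divide del: inverse_fract divide_fract diff_fract)
  then show "inverse (qX - inverse qX) \<in> qcarrier" unfolding qcarrier_def by blast
qed

definition qpow :: "int \<Rightarrow> qring" where
  "qpow k = (if 0 \<le> k then q ^ nat k else q_inv ^ nat (- k))"

definition qint :: "int \<Rightarrow> qring" where
  "qint j = (qpow j - qpow (- j)) * qdiff_inv"


section \<open>Plane diagrams up to plane isotopy\<close>

text \<open>
  A plane diagram, read from bottom to top, is cut into elementary pieces: vertical strands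
  \<open>Strands a\<close>, a cap \<open>Cap x\<close> from \<open>x, dual x\<close> to the empty sequence, a cup \<open>Cup x\<close> from the empty
  sequence to \<open>x, dual x\<close>, and vertices. In \<open>d \<cdot> e\<close> the diagram \<open>d\<close> lies on top of \<open>e\<close>.
\<close>

datatype ('x, 'v) diag =
    Strands "'x list"
  | Cap 'x
  | Cup 'x
  | Vert 'v
  | Stack "('x, 'v) diag" "('x, 'v) diag"  (infixr "\<cdot>" 55)
  | Juxt "('x, 'v) diag" "('x, 'v) diag"  (infixr "\<otimes>" 60)

text \<open>
  A kind of diagrams is given by the dual (the reversed orientation) of a strand label, the
  boundary of each vertex, and a set of rotation moves for the vertices. A vertex name stands for
  a vertex in a fixed position in the plane, so the same vertex turned in the plane has another
  name, and the rotation moves say which one.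
\<close>

record ('x, 'v) kind =
  dual :: "'x \<Rightarrow> 'x"
  vsrc :: "'v \<Rightarrow> 'x list"
  vtgt :: "'v \<Rightarrow> 'x list"
  turns :: "(('x, 'v) diag \<times> ('x, 'v) diag) set"

primrec src :: "('x, 'v, 'z) kind_scheme \<Rightarrow> ('x, 'v) diag \<Rightarrow> 'x list" where
  "src K (Strands a) = a"
| "src K (Cap x) = [x, dual K x]"
| "src K (Cup x) = []"
| "src K (Vert v) = vsrc K v"
| "src K (d \<cdot> e) = src K e"
| "src K (d \<otimes> e) = src K d @ src K e"

primrec tgt :: "('x, 'v, 'z) kind_scheme \<Rightarrow> ('x, 'v) diag \<Rightarrow> 'x list" where
  "tgt K (Strands a) = a"
| "tgt K (Cap x) = []"
| "tgt K (Cup x) = [x, dual K x]"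
| "tgt K (Vert v) = vtgt K v"
| "tgt K (d \<cdot> e) = tgt K d"
| "tgt K (d \<otimes> e) = tgt K d @ tgt K e"

primrec wf_diag :: "('x, 'v, 'z) kind_scheme \<Rightarrow> ('x, 'v) diag \<Rightarrow> bool" where
  "wf_diag K (Strands a) \<longleftrightarrow> True"
| "wf_diag K (Cap x) \<longleftrightarrow> True"
| "wf_diag K (Cup x) \<longleftrightarrow> True"
| "wf_diag K (Vert v) \<longleftrightarrow> True"
| "wf_diag K (d \<cdot> e) \<longleftrightarrow> wf_diag K d \<and> wf_diag K e \<and> src K d = tgt K e"
| "wf_diag K (d \<otimes> e) \<longleftrightarrow> wf_diag K d \<and> wf_diag K e"

text \<open>
  Plane isotopy. The rules up to \<open>interchange\<close> are the isotopies that keep all strands monotone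
  (the axioms of a strict monoidal category); an arbitrary plane isotopy in addition creates and
  cancels pairs of critical points (\<open>zigzag\<close>) and turns vertices (\<open>turn\<close>).
\<close>

inductive isotopic :: "('x, 'v, 'z) kind_scheme \<Rightarrow> ('x, 'v) diag \<Rightarrow> ('x, 'v) diag \<Rightarrow> bool"
  for K where
  refl: "wf_diag K d \<Longrightarrow> isotopic K d d"
| sym: "isotopic K d e \<Longrightarrow> isotopic K e d"
| trans: "isotopic K d e \<Longrightarrow> isotopic K e f \<Longrightarrow> isotopic K d f"
| stack: "isotopic K d d' \<Longrightarrow> isotopic K e e' \<Longrightarrow> src K d = tgt K e \<Longrightarrow>
    isotopic K (d \<cdot> e) (d' \<cdot> e')"
| juxt: "isotopic K d d' \<Longrightarrow> isotopic K e e' \<Longrightarrow> isotopic K (d \<otimes> e) (d' \<otimes> e')"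
| stack_assoc: "wf_diag K (d \<cdot> e \<cdot> f) \<Longrightarrow> isotopic K ((d \<cdot> e) \<cdot> f) (d \<cdot> e \<cdot> f)"
| stack_top: "wf_diag K d \<Longrightarrow> isotopic K (Strands (tgt K d) \<cdot> d) d"
| stack_bottom: "wf_diag K d \<Longrightarrow> isotopic K (d \<cdot> Strands (src K d)) d"
| juxt_assoc: "wf_diag K (d \<otimes> e \<otimes> f) \<Longrightarrow> isotopic K ((d \<otimes> e) \<otimes> f) (d \<otimes> e \<otimes> f)"
| juxt_left: "wf_diag K d \<Longrightarrow> isotopic K (Strands [] \<otimes> d) d"
| juxt_right: "wf_diag K d \<Longrightarrow> isotopic K (d \<otimes> Strands []) d"
| strands: "isotopic K (Strands a \<otimes> Strands b) (Strands (a @ b))"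
| interchange: "wf_diag K (d \<cdot> e) \<Longrightarrow> wf_diag K (d' \<cdot> e') \<Longrightarrow>
    isotopic K ((d \<cdot> e) \<otimes> (d' \<cdot> e')) ((d \<otimes> d') \<cdot> (e \<otimes> e'))"
| zigzag_left: "isotopic K ((Cap x \<otimes> Strands [x]) \<cdot> (Strands [x] \<otimes> Cup (dual K x))) (Strands [x])"
| zigzag_right: "isotopic K ((Strands [x] \<otimes> Cap (dual K x)) \<cdot> (Cup x \<otimes> Strands [x])) (Strands [x])"
| turn: "(d, e) \<in> turns K \<Longrightarrow> isotopic K d e"

definition iclass :: "('x, 'v, 'z) kind_scheme \<Rightarrow> ('x, 'v) diag \<Rightarrow> ('x, 'v) diag set" where
  "iclass K d = {e. isotopic K d e}"

definition dual_obj :: "('x \<Rightarrow> 'x) \<Rightarrow> 'x list \<Rightarrow> 'x list" where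
  "dual_obj dl a = rev (map dl a)"

text \<open>Nested caps from \<open>a\<close>, \<open>a\<^sup>\<or>\<close> to the empty sequence, and nested cups.\<close>

primrec caps :: "('x \<Rightarrow> 'x) \<Rightarrow> 'x list \<Rightarrow> ('x, 'v) diag" where
  "caps dl [] = Strands []"
| "caps dl (x # a) = Cap x \<cdot> (Strands [x] \<otimes> caps dl a \<otimes> Strands [dl x])"

primrec cups :: "('x \<Rightarrow> 'x) \<Rightarrow> 'x list \<Rightarrow> ('x, 'v) diag" where
  "cups dl [] = Strands []"
| "cups dl (x # a) = (Strands [x] \<otimes> cups dl a \<otimes> Strands [dl x]) \<cdot> Cup x"

text \<open>Turning a diagram \<open>d\<close> from \<open>a\<close> to \<open>b\<close> by 180 degrees gives one from \<open>b\<^sup>\<or>\<close> to \<open>a\<^sup>\<or>\<close>.\<close>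

definition half_turn :: "('x \<Rightarrow> 'x) \<Rightarrow> 'x list \<Rightarrow> 'x list \<Rightarrow> ('x, 'v) diag \<Rightarrow> ('x, 'v) diag" where
  "half_turn dl a b d =
     (let a' = dual_obj dl a; b' = dual_obj dl b in
      (Strands a' \<otimes> caps dl b) \<cdot> (Strands a' \<otimes> d \<otimes> Strands b') \<cdot> (cups dl a' \<otimes> Strands b'))"

text \<open>
  Turning a diagram \<open>d\<close> from \<open>x, y\<close> to \<open>y, x\<close> by 90 degrees: the bottom left end is bent up to
  the top left and the top right end down to the bottom right, which gives a diagram from
  \<open>y, dl x\<close> to \<open>dl x, y\<close>.
\<close>

definition quarter_turn :: "('x \<Rightarrow> 'x) \<Rightarrow> 'x \<Rightarrow> 'x \<Rightarrow> ('x, 'v) diag \<Rightarrow> ('x, 'v) diag" where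
  "quarter_turn dl x y d =
     (Strands [dl x, y] \<otimes> Cap x) \<cdot> (Strands [dl x] \<otimes> d \<otimes> Strands [dl x]) \<cdot>
     (Cup (dl x) \<otimes> Strands [y, dl x])"


section \<open>Linear rigid monoidal categories, tensor ideals, functors\<close>

text \<open>
  Strict monoidal categories whose objects are finite sequences of letters, with concatenation as
  the tensor product of objects. Distinct Hom sets are disjoint. \<open>ev a\<close> goes from \<open>a \<otimes> a\<^sup>\<or>\<close>
  to the unit and \<open>coev a\<close> from the unit to \<open>a \<otimes> a\<^sup>\<or>\<close>; since \<open>a\<^sup>\<or>\<^sup>\<or> = a\<close>, their values at \<open>a\<^sup>\<or>\<close> give
  the other duality.
\<close>

record ('x, 'm) lcat =
  Obj :: "'x list set"
  Hom :: "'x list \<Rightarrow> 'x list \<Rightarrow> 'm set"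
  idm :: "'x list \<Rightarrow> 'm"
  cmp :: "'m \<Rightarrow> 'm \<Rightarrow> 'm"
  tns :: "'m \<Rightarrow> 'm \<Rightarrow> 'm"
  add :: "'m \<Rightarrow> 'm \<Rightarrow> 'm"
  scl :: "qring \<Rightarrow> 'm \<Rightarrow> 'm"
  dualo :: "'x list \<Rightarrow> 'x list"
  ev :: "'x list \<Rightarrow> 'm"
  coev :: "'x list \<Rightarrow> 'm"

definition Mor :: "('x, 'm) lcat \<Rightarrow> 'm set" where
  "Mor C = (\<Union>a\<in>Obj C. \<Union>b\<in>Obj C. Hom C a b)"

inductive_set tensor_ideal :: "('x, 'm) lcat \<Rightarrow> 'm set \<Rightarrow> 'm set" for C G where
  gen: "g \<in> G \<Longrightarrow> g \<in> tensor_ideal C G"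
| zero: "f \<in> Mor C \<Longrightarrow> scl C 0 f \<in> tensor_ideal C G"
| add: "f \<in> tensor_ideal C G \<Longrightarrow> g \<in> tensor_ideal C G \<Longrightarrow> f \<in> Hom C a b \<Longrightarrow> g \<in> Hom C a b \<Longrightarrow>
    add C f g \<in> tensor_ideal C G"
| scl: "f \<in> tensor_ideal C G \<Longrightarrow> scl C r f \<in> tensor_ideal C G"
| cmp_left: "f \<in> tensor_ideal C G \<Longrightarrow> f \<in> Hom C a b \<Longrightarrow> g \<in> Hom C b c \<Longrightarrow>
    cmp C g f \<in> tensor_ideal C G"
| cmp_right: "g \<in> tensor_ideal C G \<Longrightarrow> f \<in> Hom C a b \<Longrightarrow> g \<in> Hom C b c \<Longrightarrow>
    cmp C g f \<in> tensor_ideal C G"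
| tns_left: "f \<in> tensor_ideal C G \<Longrightarrow> g \<in> Mor C \<Longrightarrow> tns C g f \<in> tensor_ideal C G"
| tns_right: "f \<in> tensor_ideal C G \<Longrightarrow> g \<in> Mor C \<Longrightarrow> tns C f g \<in> tensor_ideal C G"

definition coset :: "('x, 'm) lcat \<Rightarrow> 'm set \<Rightarrow> 'm \<Rightarrow> 'm set" where
  "coset C I f = {g. \<exists>a\<in>Obj C. \<exists>b\<in>Obj C. f \<in> Hom C a b \<and> g \<in> Hom C a b \<and>
                     add C g (scl C (-1) f) \<in> I}"

text \<open>
  The quotient by a tensor ideal \<open>I\<close>. Since \<open>I\<close> is an ideal, the unions below run over equal
  cosets whenever the operation is defined.
\<close>

definition quotient :: "('x, 'm) lcat \<Rightarrow> 'm set \<Rightarrow> ('x, 'm set) lcat" where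
  "quotient C I =
    \<lparr> Obj = Obj C,
      Hom = (\<lambda>a b. coset C I ` Hom C a b),
      idm = (\<lambda>a. coset C I (idm C a)),
      cmp = (\<lambda>G F. \<Union>g\<in>G. \<Union>f\<in>F. coset C I (cmp C g f)),
      tns = (\<lambda>F G. \<Union>f\<in>F. \<Union>g\<in>G. coset C I (tns C f g)),
      add = (\<lambda>F G. \<Union>f\<in>F. \<Union>g\<in>G. coset C I (add C f g)),
      scl = (\<lambda>r F. \<Union>f\<in>F. coset C I (scl C r f)),
      dualo = dualo C,
      ev = (\<lambda>a. coset C I (ev C a)),
      coev = (\<lambda>a. coset C I (coev C a)) \<rparr>"

record ('x, 'm, 'y, 'n) func =
  fobj :: "'x list \<Rightarrow> 'y list"
  fmor :: "'m \<Rightarrow> 'n"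

definition linear_monoidal_functor ::
  "('x, 'm) lcat \<Rightarrow> ('y, 'n) lcat \<Rightarrow> ('x, 'm, 'y, 'n) func \<Rightarrow> bool" where
  "linear_monoidal_functor C D F \<longleftrightarrow>
     fobj F \<in> Obj C \<rightarrow>\<^sub>E Obj D \<and>
     fmor F \<in> extensional (Mor C) \<and>
     (\<forall>a\<in>Obj C. \<forall>b\<in>Obj C. \<forall>f\<in>Hom C a b. fmor F f \<in> Hom D (fobj F a) (fobj F b)) \<and>
     (\<forall>a\<in>Obj C. fmor F (idm C a) = idm D (fobj F a)) \<and>
     (\<forall>a\<in>Obj C. \<forall>b\<in>Obj C. \<forall>c\<in>Obj C. \<forall>f\<in>Hom C a b. \<forall>g\<in>Hom C b c.
        fmor F (cmp C g f) = cmp D (fmor F g) (fmor F f)) \<and>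
     (\<forall>a\<in>Obj C. \<forall>b\<in>Obj C. \<forall>f\<in>Hom C a b. \<forall>g\<in>Hom C a b.
        fmor F (add C f g) = add D (fmor F f) (fmor F g)) \<and>
     (\<forall>r. \<forall>f\<in>Mor C. fmor F (scl C r f) = scl D r (fmor F f)) \<and>
     fobj F [] = [] \<and>
     (\<forall>a\<in>Obj C. \<forall>b\<in>Obj C. fobj F (a @ b) = fobj F a @ fobj F b) \<and>
     (\<forall>f\<in>Mor C. \<forall>g\<in>Mor C. fmor F (tns C f g) = tns D (fmor F f) (fmor F g))"

text \<open>The braidings of \<open>C\<close> and \<open>D\<close> are given by \<open>\<beta> a b\<close> from \<open>a \<otimes> b\<close> to \<open>b \<otimes> a\<close>, and \<open>\<gamma>\<close>.\<close>

definition rigid_braided_functor ::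
  "('x, 'm) lcat \<Rightarrow> ('x list \<Rightarrow> 'x list \<Rightarrow> 'm) \<Rightarrow> ('y, 'n) lcat \<Rightarrow> ('y list \<Rightarrow> 'y list \<Rightarrow> 'n) \<Rightarrow>
   ('x, 'm, 'y, 'n) func \<Rightarrow> bool" where
  "rigid_braided_functor C \<beta> D \<gamma> F \<longleftrightarrow>
     linear_monoidal_functor C D F \<and>
     (\<forall>a\<in>Obj C. fobj F (dualo C a) = dualo D (fobj F a) \<and>
                fmor F (ev C a) = ev D (fobj F a) \<and>
                fmor F (coev C a) = coev D (fobj F a)) \<and>
     (\<forall>a\<in>Obj C. \<forall>b\<in>Obj C. fmor F (\<beta> a b) = \<gamma> (fobj F a) (fobj F b))"

definition func_comp ::
  "('x, 'm) lcat \<Rightarrow> ('y, 'n, 'z, 'k) func \<Rightarrow> ('x, 'm, 'y, 'n) func \<Rightarrow> ('x, 'm, 'z, 'k) func" where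
  "func_comp C G F =
    \<lparr> fobj = restrict (fobj G \<circ> fobj F) (Obj C), fmor = restrict (fmor G \<circ> fmor F) (Mor C) \<rparr>"

definition quotient_functor :: "('x, 'm) lcat \<Rightarrow> 'm set \<Rightarrow> ('x, 'm, 'x, 'm set) func" where
  "quotient_functor C I = \<lparr> fobj = restrict id (Obj C), fmor = restrict (coset C I) (Mor C) \<rparr>"

text \<open>The braiding of sequences that is determined by its values \<open>c x y\<close> on pairs of letters.\<close>

primrec braid_letter :: "('x, 'm) lcat \<Rightarrow> ('x \<Rightarrow> 'x \<Rightarrow> 'm) \<Rightarrow> 'x \<Rightarrow> 'x list \<Rightarrow> 'm" where
  "braid_letter C c x [] = idm C [x]"
| "braid_letter C c x (y # b) =
     cmp C (tns C (idm C [y]) (braid_letter C c x b)) (tns C (c x y) (idm C b))"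

primrec braid :: "('x, 'm) lcat \<Rightarrow> ('x \<Rightarrow> 'x \<Rightarrow> 'm) \<Rightarrow> 'x list \<Rightarrow> 'x list \<Rightarrow> 'm" where
  "braid C c [] b = idm C b"
| "braid C c (x # a) b =
     cmp C (tns C (braid_letter C c x b) (idm C a)) (tns C (idm C [x]) (braid C c a b))"


section \<open>Linear combinations of diagrams\<close>

text \<open>A morphism is a triple of source, target and a linear combination of isotopy classes.\<close>

type_synonym ('x, 'v) lin =
  "'x list \<times> 'x list \<times> (('x, 'v) diag set \<Rightarrow>\<^sub>0 qring)"

definition lin_comb ::
  "('x, 'v) kind \<Rightarrow> 'x list \<Rightarrow> 'x list \<Rightarrow> (qring \<times> ('x, 'v) diag) list \<Rightarrow> ('x, 'v) lin" where
  "lin_comb K a b cs = (a, b, (\<Sum>(c, d)\<leftarrow>cs. Poly_Mapping.single (iclass K d) c))"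

definition lin_diag :: "('x, 'v) kind \<Rightarrow> ('x, 'v) diag \<Rightarrow> ('x, 'v) lin" where
  "lin_diag K d = lin_comb K (src K d) (tgt K d) [(1, d)]"

definition bilinear_ext ::
  "('a \<Rightarrow> 'a \<Rightarrow> 'a) \<Rightarrow> ('a \<Rightarrow>\<^sub>0 qring) \<Rightarrow> ('a \<Rightarrow>\<^sub>0 qring) \<Rightarrow> ('a \<Rightarrow>\<^sub>0 qring)" where
  "bilinear_ext h f g =
     (\<Sum>A\<in>Poly_Mapping.keys f. \<Sum>B\<in>Poly_Mapping.keys g.
        Poly_Mapping.single (h A B) (Poly_Mapping.lookup f A * Poly_Mapping.lookup g B))"

text \<open>
  The linear category with objects \<open>Os\<close> in which the morphisms are linear combinations of isotopy
  classes of the diagrams in \<open>B\<close>.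
\<close>

definition diag_cat ::
  "('x, 'v) kind \<Rightarrow> 'x list set \<Rightarrow> ('x, 'v) diag set \<Rightarrow> ('x, ('x, 'v) lin) lcat" where
  "diag_cat K Os B =
    \<lparr> Obj = Os,
      Hom = (\<lambda>a b. {(a, b, f) | f. a \<in> Os \<and> b \<in> Os \<and>
               Poly_Mapping.keys f \<subseteq> iclass K ` {d \<in> B. wf_diag K d \<and> src K d = a \<and> tgt K d = b}}),
      idm = (\<lambda>a. lin_diag K (Strands a)),
      cmp = (\<lambda>(b', c, g) (a, b, f).
               (a, c, bilinear_ext (\<lambda>A B. \<Union>d\<in>A. \<Union>e\<in>B. iclass K (d \<cdot> e)) g f)),
      tns = (\<lambda>(a, b, f) (a', b', g).
               (a @ a', b @ b', bilinear_ext (\<lambda>A B. \<Union>d\<in>A. \<Union>e\<in>B. iclass K (d \<otimes> e)) f g)),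
      add = (\<lambda>(a, b, f) (a', b', g). (a, b, f + g)),
      scl = (\<lambda>r (a, b, f). (a, b, Poly_Mapping.map ((*) r) f)),
      dualo = dual_obj (dual K),
      ev = (\<lambda>a. lin_diag K (caps (dual K) a)),
      coev = (\<lambda>a. lin_diag K (cups (dual K) a)) \<rparr>"


section \<open>Oriented tangles\<close>

datatype ori = Up | Dn

primrec flip :: "ori \<Rightarrow> ori" where
  "flip Up = Dn"
| "flip Dn = Up"

text \<open>
  \<open>Crossing s x y\<close> is the crossing from \<open>x, y\<close> to \<open>y, x\<close>; the strand from bottom left to top
  right is the over-strand iff \<open>s\<close>. A quarter turn exchanges the two diagonals.
\<close>

datatype crossing = Crossing bool ori ori

definition tangle_kind :: "(ori, crossing) kind" where
  "tangle_kind =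
    \<lparr> dual = flip,
      vsrc = (\<lambda>v. case v of Crossing s x y \<Rightarrow> [x, y]),
      vtgt = (\<lambda>v. case v of Crossing s x y \<Rightarrow> [y, x]),
      turns = {(quarter_turn flip x y (Vert (Crossing s x y)),
                Vert (Crossing (\<not> s) y (flip x))) | s x y. True} \<rparr>"

abbreviation X :: "bool \<Rightarrow> ori \<Rightarrow> ori \<Rightarrow> (ori, crossing) diag" where
  "X s x y \<equiv> Vert (Crossing s x y)"

text \<open>
  In the third Reidemeister move the signs \<open>s\<close>, \<open>t\<close>, \<open>u\<close> of the crossings of the first and
  second, first and third, second and third strand come from a linear ordering of the three strands
  by height iff \<open>s = u\<close> implies \<open>t = s\<close>.
\<close>

definition reidemeister :: "((ori, crossing) diag \<times> (ori, crossing) diag) set" where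
  "reidemeister =
     {((Strands [x] \<otimes> Cap x) \<cdot> (X s x x \<otimes> Strands [flip x]) \<cdot> (Strands [x] \<otimes> Cup x),
       Strands [x]) | s x. True} \<union>
     {((Cap (flip x) \<otimes> Strands [x]) \<cdot> (Strands [flip x] \<otimes> X s x x) \<cdot> (Cup (flip x) \<otimes> Strands [x]),
       Strands [x]) | s x. True} \<union>
     {(X (\<not> s) y x \<cdot> X s x y, Strands [x, y]) | s x y. True} \<union>
     {((X u y z \<otimes> Strands [x]) \<cdot> (Strands [y] \<otimes> X t x z) \<cdot> (X s x y \<otimes> Strands [z]),
       (Strands [z] \<otimes> X s x y) \<cdot> (X t x z \<otimes> Strands [y]) \<cdot> (Strands [x] \<otimes> X u y z))
       | s t u x y z. s = u \<longrightarrow> t = s}"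

abbreviation tangle_diag_cat :: "(ori, (ori, crossing) lin) lcat" where
  "tangle_diag_cat \<equiv> diag_cat tangle_kind UNIV UNIV"

definition reidemeister_ideal :: "(ori, crossing) lin set" where
  "reidemeister_ideal = tensor_ideal tangle_diag_cat
     {lin_comb tangle_kind (src tangle_kind d) (tgt tangle_kind d) [(1, d), (-1, e)]
       | d e. (d, e) \<in> reidemeister}"

definition TD :: "(ori, (ori, crossing) lin set) lcat" where
  "TD = quotient tangle_diag_cat reidemeister_ideal"

definition td_class :: "(ori, crossing) lin \<Rightarrow> (ori, crossing) lin set" where
  "td_class = coset tangle_diag_cat reidemeister_ideal"

definition TD_braiding :: "ori list \<Rightarrow> ori list \<Rightarrow> (ori, crossing) lin set" where
  "TD_braiding = braid TD (\<lambda>x y. td_class (lin_diag tangle_kind (X True x y)))"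

text \<open>The skein relation, and the unknot with either of its two orientations.\<close>

definition jones_ideal :: "nat \<Rightarrow> (ori, crossing) lin set set" where
  "jones_ideal n = tensor_ideal TD
     ({td_class (lin_comb tangle_kind [Up, Up] [Up, Up]
        [(qpow (- int n), X True Up Up), (- qpow (int n), X False Up Up),
         (- (q_inv - q), Strands [Up, Up])])} \<union>
      {td_class (lin_comb tangle_kind [] [] [(1, Cap x \<cdot> Cup x), (- qint (int n), Strands [])])
        | x. True})"

definition Jones :: "nat \<Rightarrow> (ori, (ori, crossing) lin set set) lcat" where
  "Jones n = quotient TD (jones_ideal n)"

definition Jones_braiding :: "nat \<Rightarrow> ori list \<Rightarrow> ori list \<Rightarrow> (ori, crossing) lin set set" where
  "Jones_braiding n a b = coset TD (jones_ideal n) (TD_braiding a b)"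


section \<open>Trivalent graphs\<close>

datatype label = One | Two

type_synonym edge = "ori \<times> label"

text \<open>
  \<open>Join x\<close> has two 1-edges at the bottom and a 2-edge at the top, \<open>Fork x\<close> is the other way up;
  all three edges point in the direction \<open>x\<close>. Up to rotation these are all the vertices with
  labels in \<open>{1, 2}\<close> at which the incoming and the outgoing labels have the same sum.
\<close>

datatype vertex = Join ori | Fork ori

definition flip_edge :: "edge \<Rightarrow> edge" where
  "flip_edge e = (flip (fst e), snd e)"

definition web_kind :: "(edge, vertex) kind" where
  "web_kind =
    \<lparr> dual = flip_edge,
      vsrc = (\<lambda>v. case v of Join x \<Rightarrow> [(x, One), (x, One)] | Fork x \<Rightarrow> [(x, Two)]),
      vtgt = (\<lambda>v. case v of Join x \<Rightarrow> [(x, Two)] | Fork x \<Rightarrow> [(x, One), (x, One)]),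
      turns =
        {(half_turn flip_edge [(x, One), (x, One)] [(x, Two)] (Vert (Join x)),
          Vert (Fork (flip x))) | x. True} \<union>
        {(half_turn flip_edge [(x, Two)] [(x, One), (x, One)] (Vert (Fork x)),
          Vert (Join (flip x))) | x. True} \<rparr>"

text \<open>\<open>S Up\<close> is the graph $S$ and \<open>S Dn\<close> its dual.\<close>

definition S :: "ori \<Rightarrow> (edge, vertex) diag" where
  "S x = Vert (Fork x) \<cdot> Vert (Join x)"

definition strands1 :: "ori list \<Rightarrow> (edge, vertex) diag" where
  "strands1 a = Strands (map (\<lambda>x. (x, One)) a)"

abbreviation cap1 :: "ori \<Rightarrow> (edge, vertex) diag" where
  "cap1 x \<equiv> Cap (x, One)"

abbreviation cup1 :: "ori \<Rightarrow> (edge, vertex) diag" where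
  "cup1 x \<equiv> Cup (x, One)"

text \<open>
  The graphs with boundary edges labelled 1. Every 2-edge joins two vertices, and a neighbourhood
  of it can be turned to be \<open>S Up\<close> or \<open>S Dn\<close>; closed 2-labelled circles without vertices are
  excluded.
\<close>

inductive_set webs :: "(edge, vertex) diag set" where
  "strands1 a \<in> webs"
| "cap1 x \<in> webs"
| "cup1 x \<in> webs"
| "S x \<in> webs"
| "d \<in> webs \<Longrightarrow> e \<in> webs \<Longrightarrow> d \<cdot> e \<in> webs"
| "d \<in> webs \<Longrightarrow> e \<in> webs \<Longrightarrow> d \<otimes> e \<in> webs"

definition TrPD :: "(edge, (edge, vertex) lin) lcat" where
  "TrPD = diag_cat web_kind (range (map (\<lambda>x. (x, One)))) webs"

definition web_comb ::
  "ori list \<Rightarrow> ori list \<Rightarrow> (qring \<times> (edge, vertex) diag) list \<Rightarrow> (edge, vertex) lin" where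
  "web_comb a b cs = lin_comb web_kind (map (\<lambda>x. (x, One)) a) (map (\<lambda>x. (x, One)) b) cs"

text \<open>For \<open>x = Up\<close> these are the defining relations, and for \<open>x = Dn\<close> their duals.\<close>

definition moy_relations :: "nat \<Rightarrow> ori \<Rightarrow> (edge, vertex) lin set" where
  "moy_relations n x =
     (let y = flip x; I = strands1 [x]; J = strands1 [y] in
      {web_comb [] []
         [(1, cap1 x \<cdot> cup1 x), (- qint (int n), strands1 [])],
       web_comb [x, x] [x, x]
         [(1, S x \<cdot> S x), (- (q + q_inv), S x)],
       web_comb [x] [x]
         [(1, (cap1 y \<otimes> I) \<cdot> (J \<otimes> S x) \<cdot> (cup1 y \<otimes> I)), (- qint (int n - 1), I)],
       web_comb [x, y] [x, y]
         [(1, (I \<otimes> cap1 x \<otimes> J) \<cdot> (S x \<otimes> S y) \<cdot> (I \<otimes> cup1 x \<otimes> J)),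
          (-1, cup1 x \<cdot> cap1 x), (- qint (int n - 2), I \<otimes> J)],
       web_comb [x, x, x] [x, x, x]
         [(1, (S x \<otimes> I) \<cdot> (I \<otimes> S x) \<cdot> (S x \<otimes> I)), (1, I \<otimes> S x),
          (-1, (I \<otimes> S x) \<cdot> (S x \<otimes> I) \<cdot> (I \<otimes> S x)), (-1, S x \<otimes> I)]})"

definition moy_ideal :: "nat \<Rightarrow> (edge, vertex) lin set" where
  "moy_ideal n = tensor_ideal TrPD (moy_relations n Up \<union> moy_relations n Dn)"

definition MOY :: "nat \<Rightarrow> (edge, (edge, vertex) lin set) lcat" where
  "MOY n = quotient TrPD (moy_ideal n)"

text \<open>
  The crossings in \<open>MOY\<close>, as linear combinations of graphs: for \<open>s\<close> this is the element
  \<open>\<sigma>\<^sup>+\<close> and otherwise \<open>\<sigma>\<^sup>-\<close> on two upward strands. In a rigid braided category the braiding of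
  other orientations is obtained by turning the braiding of two upward strands, or its inverse, as
  for crossings of tangles.
\<close>

definition sigma_up :: "nat \<Rightarrow> bool \<Rightarrow> (qring \<times> (edge, vertex) diag) list" where
  "sigma_up n s =
     (if s then [(qpow (int n - 1), strands1 [Up, Up]), (- qpow (int n), S Up)]
      else [(qpow (1 - int n), strands1 [Up, Up]), (- qpow (- int n), S Up)])"

definition turn_comb ::
  "ori \<Rightarrow> ori \<Rightarrow> (qring \<times> (edge, vertex) diag) list \<Rightarrow> (qring \<times> (edge, vertex) diag) list" where
  "turn_comb x y cs = map (\<lambda>(c, d). (c, quarter_turn flip_edge (x, One) (y, One) d)) cs"

fun sigma :: "nat \<Rightarrow> bool \<Rightarrow> ori \<Rightarrow> ori \<Rightarrow> (qring \<times> (edge, vertex) diag) list" where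
  "sigma n s Up Up = sigma_up n s"
| "sigma n s Up Dn = turn_comb Up Up (sigma_up n (\<not> s))"
| "sigma n s Dn Dn = turn_comb Up Dn (turn_comb Up Up (sigma_up n s))"
| "sigma n s Dn Up = turn_comb Dn Dn (turn_comb Up Dn (turn_comb Up Up (sigma_up n (\<not> s))))"

definition MOY_braiding :: "nat \<Rightarrow> edge list \<Rightarrow> edge list \<Rightarrow> (edge, vertex) lin set" where
  "MOY_braiding n = braid (MOY n)
     (\<lambda>x y. coset TrPD (moy_ideal n)
              (web_comb [fst x, fst y] [fst y, fst x] (sigma n True (fst x) (fst y))))"


section \<open>The functor\<close>

type_synonym moy_functor =
  "(ori, (ori, crossing) lin set, edge, (edge, vertex) lin set) func"

definition is_Z_MOY :: "nat \<Rightarrow> moy_functor \<Rightarrow> bool" where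
  "is_Z_MOY n Z \<longleftrightarrow>
     rigid_braided_functor TD TD_braiding (MOY n) (MOY_braiding n) Z \<and> fobj Z [Up] = [(Up, One)]"

definition Z_MOY :: "nat \<Rightarrow> moy_functor" where
  "Z_MOY n = (THE Z. is_Z_MOY n Z)"

end

theory Submission
  imports Defs
begin

text \<open>
  Sending a crossing to its expansion in webs is compatible with plane isotopy already in \<open>TrPD\<close>:
  the only point is that a full turn fixes $S$, and this holds because half a turn exchanges the two
  vertices of $S$. In \<open>MOY\<close> a curl is
  $q^{\pm(n-1)}[n] - q^{\pm n}[n-1] = 1$ times a strand, and the second Reidemeister moves follow from
  $S^2 = (q + 1/q) S$ and, for antiparallel strands, from relation (4) turned by 90 degrees and
  $[n] + [n-2] = (q + 1/q)[n-1]$. The third move holds for three parallel strands by relation (5);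
  turning it by one end and conjugating it with second moves gives all orientations. The skein
  relation is linear algebra in $\mathrm{id}$ and $S$. For uniqueness, the braiding determines the
  crossings with the strand from bottom left over, and quarter turns of these are the other ones.

  Concrete isotopies are checked by computation on lists of layers.
\<close>

section \<open>Quotients by tensor ideals\<close>

text \<open>The obstacle is well-definedness: a morphism of \<open>TD\<close> is a coset of
  combinations of isotopy classes, so a functor on it has to respect every generating isotopy and
  every Reidemeister move. These two demands are met at different levels, isotopies in
  \<open>TrPD\<close> and Reidemeister moves only modulo \<open>moy_ideal n\<close>. A single lemma
  on functors that kill the generators of a tensor ideal serves both for passing to
  \<open>TD\<close> and for passing on to \<open>Jones n\<close>.

  Both crossings of parallel strands have the form b (p id - S) with (b, p) = (q^n, 1/q) or (q^{-n},
  q), so one calculation treats both signs. The power of q in b is forced by the curl, because p [n]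
  - [n-1] = 1/b. In the third move with signs s, t, u the two sides differ by a multiple of (p_t -
  p_s) (p_t - p_u); this vanishes because t is s or u, which is what it means that the signs come
  from an ordering of the strands by height.\<close>

locale linear_tensor_cat =
  fixes C :: "('x, 'm) lcat"
  assumes Hom_Obj: "f \<in> Hom C a b \<Longrightarrow> a \<in> Obj C \<and> b \<in> Obj C"
    and Hom_unique: "f \<in> Hom C a b \<Longrightarrow> f \<in> Hom C a' b' \<Longrightarrow> a' = a \<and> b' = b"
    and idm_Hom: "a \<in> Obj C \<Longrightarrow> idm C a \<in> Hom C a a"
    and cmp_Hom: "f \<in> Hom C a b \<Longrightarrow> g \<in> Hom C b c \<Longrightarrow> cmp C g f \<in> Hom C a c"
    and tns_Hom: "f \<in> Hom C a b \<Longrightarrow> g \<in> Hom C a' b' \<Longrightarrow> tns C f g \<in> Hom C (a @ a') (b @ b')"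
    and add_Hom: "f \<in> Hom C a b \<Longrightarrow> g \<in> Hom C a b \<Longrightarrow> lcat.add C f g \<in> Hom C a b"
    and scl_Hom: "f \<in> Hom C a b \<Longrightarrow> scl C r f \<in> Hom C a b"
    and add_assoc: "f \<in> Hom C a b \<Longrightarrow> g \<in> Hom C a b \<Longrightarrow> h \<in> Hom C a b \<Longrightarrow>
      lcat.add C (lcat.add C f g) h = lcat.add C f (lcat.add C g h)"
    and add_commute: "f \<in> Hom C a b \<Longrightarrow> g \<in> Hom C a b \<Longrightarrow> lcat.add C f g = lcat.add C g f"
    and add_zero: "f \<in> Hom C a b \<Longrightarrow> g \<in> Hom C a b \<Longrightarrow> lcat.add C f (scl C 0 g) = f"
    and scl_one: "f \<in> Hom C a b \<Longrightarrow> scl C 1 f = f"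
    and scl_scl: "f \<in> Hom C a b \<Longrightarrow> scl C r (scl C s f) = scl C (r * s) f"
    and scl_plus: "f \<in> Hom C a b \<Longrightarrow> scl C (r + s) f = lcat.add C (scl C r f) (scl C s f)"
    and scl_add: "f \<in> Hom C a b \<Longrightarrow> g \<in> Hom C a b \<Longrightarrow>
      scl C r (lcat.add C f g) = lcat.add C (scl C r f) (scl C r g)"
    and cmp_add_right: "f \<in> Hom C a b \<Longrightarrow> f' \<in> Hom C a b \<Longrightarrow> g \<in> Hom C b c \<Longrightarrow>
      cmp C g (lcat.add C f f') = lcat.add C (cmp C g f) (cmp C g f')"
    and cmp_add_left: "f \<in> Hom C a b \<Longrightarrow> g \<in> Hom C b c \<Longrightarrow> g' \<in> Hom C b c \<Longrightarrow>
      cmp C (lcat.add C g g') f = lcat.add C (cmp C g f) (cmp C g' f)"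
    and cmp_scl_right: "f \<in> Hom C a b \<Longrightarrow> g \<in> Hom C b c \<Longrightarrow> cmp C g (scl C r f) = scl C r (cmp C g f)"
    and cmp_scl_left: "f \<in> Hom C a b \<Longrightarrow> g \<in> Hom C b c \<Longrightarrow> cmp C (scl C r g) f = scl C r (cmp C g f)"
    and tns_add_right: "f \<in> Hom C a b \<Longrightarrow> f' \<in> Hom C a b \<Longrightarrow> g \<in> Hom C c d \<Longrightarrow>
      tns C g (lcat.add C f f') = lcat.add C (tns C g f) (tns C g f')"
    and tns_add_left: "f \<in> Hom C a b \<Longrightarrow> g \<in> Hom C c d \<Longrightarrow> g' \<in> Hom C c d \<Longrightarrow>
      tns C (lcat.add C g g') f = lcat.add C (tns C g f) (tns C g' f)"
    and tns_scl_right: "f \<in> Hom C a b \<Longrightarrow> g \<in> Hom C c d \<Longrightarrow> tns C g (scl C r f) = scl C r (tns C g f)"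
    and tns_scl_left: "f \<in> Hom C a b \<Longrightarrow> g \<in> Hom C c d \<Longrightarrow> tns C (scl C r g) f = scl C r (tns C g f)"
begin

lemma Mor_iff: "f \<in> Mor C \<longleftrightarrow> (\<exists>a b. f \<in> Hom C a b)"
  unfolding Mor_def using Hom_Obj by blast

lemma MorI: "f \<in> Hom C a b \<Longrightarrow> f \<in> Mor C"
  using Mor_iff by blast

definition sub :: "'m \<Rightarrow> 'm \<Rightarrow> 'm" where
  "sub f g = lcat.add C f (scl C (-1) g)"

lemma sub_Hom: "f \<in> Hom C a b \<Longrightarrow> g \<in> Hom C a b \<Longrightarrow> sub f g \<in> Hom C a b"
  unfolding sub_def by (intro add_Hom scl_Hom)

text \<open>Each of the two is neutral for addition in the Hom set, so by commutativity both equal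
  their sum. Hence \<open>scl C 0 f\<close> serves as the zero of a Hom set, whichever member
  \<open>f\<close> is at hand.\<close>

lemma scl_zero_eq:
  assumes "f \<in> Hom C a b" "g \<in> Hom C a b" shows "scl C 0 f = scl C 0 g"
  by (metis assms add_zero add_commute scl_Hom)

lemma sub_self: "f \<in> Hom C a b \<Longrightarrow> sub f f = scl C 0 f"
  unfolding sub_def using scl_plus[of f a b 1 "-1"] scl_one[of f a b] by simp

lemma scl_sub:
  assumes "f \<in> Hom C a b" "g \<in> Hom C a b" shows "scl C r (sub f g) = sub (scl C r f) (scl C r g)"
  unfolding sub_def using assms by (simp add: scl_add[OF _ scl_Hom] scl_scl)

lemma scl_minus_sub:
  assumes "f \<in> Hom C a b" "g \<in> Hom C a b" shows "scl C (-1) (sub f g) = sub g f"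
  unfolding sub_def using assms
  by (simp add: scl_add[OF _ scl_Hom] scl_scl scl_one add_commute[OF scl_Hom])

lemma add_left_commute:
  assumes "f \<in> Hom C a b" "g \<in> Hom C a b" "h \<in> Hom C a b"
  shows "lcat.add C f (lcat.add C g h) = lcat.add C g (lcat.add C f h)"
  using assms by (simp add: add_assoc[of _ a b, symmetric] add_commute[of f a b g])

text \<open>Telescoping, which makes congruence modulo a tensor ideal transitive.\<close>

lemma sub_trans:
  assumes f: "f \<in> Hom C a b" and g: "g \<in> Hom C a b" and h: "h \<in> Hom C a b"
  shows "lcat.add C (sub f g) (sub g h) = sub f h"
proof -
  let ?m = "scl C (-1)"
  have "lcat.add C (sub f g) (sub g h) = lcat.add C f (lcat.add C (?m g) (lcat.add C g (?m h)))"
    unfolding sub_def using f g h by (intro add_assoc add_Hom scl_Hom)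
  also have "lcat.add C (?m g) (lcat.add C g (?m h)) = lcat.add C (sub g g) (?m h)"
    unfolding sub_def using g h
    by (simp add: add_left_commute[of "?m g" a b g] add_assoc[of _ a b] scl_Hom)
  also have "\<dots> = ?m h"
    using g h by (metis sub_self add_zero add_commute scl_Hom)
  finally show ?thesis unfolding sub_def .
qed

lemma sub_add:
  assumes "f \<in> Hom C a b" "g \<in> Hom C a b" "f' \<in> Hom C a b" "g' \<in> Hom C a b"
  shows "sub (lcat.add C f f') (lcat.add C g g') = lcat.add C (sub f g) (sub f' g')"
proof -
  let ?m = "scl C (-1)" and ?p = "lcat.add C"
  have "sub (?p f f') (?p g g') = ?p (?p f f') (?p (?m g) (?m g'))"
    unfolding sub_def using assms by (simp add: scl_add[of _ a b])
  also have "\<dots> = ?p (?p f (?m g)) (?p f' (?m g'))"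
    using assms by (simp add: add_assoc[of _ a b] add_left_commute[of f' a b "?m g"] scl_Hom add_Hom)
  finally show ?thesis unfolding sub_def .
qed

lemma add_sub:
  assumes "f \<in> Hom C a b" "g \<in> Hom C a b" shows "lcat.add C g (sub f g) = f"
proof -
  have "lcat.add C g (sub f g) = lcat.add C f (sub g g)"
    unfolding sub_def using assms by (intro add_left_commute scl_Hom)
  then show ?thesis using assms by (simp add: sub_self add_zero)
qed

lemma cmp_sub:
  assumes "f \<in> Hom C a b" "f' \<in> Hom C a b" "g \<in> Hom C b c" "g' \<in> Hom C b c"
  shows "cmp C g (sub f f') = sub (cmp C g f) (cmp C g f')"
    and "cmp C (sub g g') f = sub (cmp C g f) (cmp C g' f)"
  unfolding sub_def using assms
  by (simp_all add: cmp_add_right[OF _ scl_Hom] cmp_scl_right cmp_add_left[OF _ _ scl_Hom] cmp_scl_left)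

lemma tns_sub:
  assumes "f \<in> Hom C a b" "f' \<in> Hom C a b" "g \<in> Hom C c d" "g' \<in> Hom C c d"
  shows "tns C g (sub f f') = sub (tns C g f) (tns C g f')"
    and "tns C (sub g g') f = sub (tns C g f) (tns C g' f)"
  unfolding sub_def using assms
  by (simp_all add: tns_add_right[OF _ scl_Hom] tns_scl_right tns_add_left[OF _ _ scl_Hom] tns_scl_left)

end

locale tensor_ideal_of = linear_tensor_cat C for C :: "('x, 'm) lcat" +
  fixes G :: "'m set"
  assumes gens: "G \<subseteq> Mor C"
begin

definition I :: "'m set" where "I = tensor_ideal C G"

abbreviation Q :: "('x, 'm set) lcat" where "Q \<equiv> quotient C I"

lemma ideal_Mor: "f \<in> I \<Longrightarrow> \<exists>a b. f \<in> Hom C a b"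
  unfolding I_def
proof (induction rule: tensor_ideal.induct)
  case (gen g)
  then show ?case using gens Mor_iff by blast
next
  case (tns_left f g)
  then show ?case using Mor_iff tns_Hom by blast
next
  case (tns_right f g)
  then show ?case using Mor_iff tns_Hom by blast
qed (use Mor_iff scl_Hom add_Hom cmp_Hom in \<open>metis+\<close>)

text \<open>\<open>coset\<close> only asks that some pair of objects fits; since distinct Hom sets
  are disjoint, the pair is determined by \<open>f\<close>.\<close>

lemma coset_iff: "f \<in> Hom C a b \<Longrightarrow> g \<in> coset C I f \<longleftrightarrow> g \<in> Hom C a b \<and> sub g f \<in> I"
  unfolding coset_def sub_def using Hom_Obj Hom_unique by blast

lemma sub_self_ideal: "f \<in> Hom C a b \<Longrightarrow> sub f f \<in> I"
  unfolding sub_self I_def by (metis MorI sub_self tensor_ideal.zero)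

lemma coset_self: "f \<in> Hom C a b \<Longrightarrow> f \<in> coset C I f"
  using coset_iff sub_self_ideal by blast

lemma sub_sym_ideal:
  assumes "f \<in> Hom C a b" "g \<in> Hom C a b" "sub f g \<in> I" shows "sub g f \<in> I"
  using assms(3) unfolding I_def scl_minus_sub[OF assms(1,2), symmetric] by (rule tensor_ideal.scl)

lemma sub_trans_ideal:
  assumes "f \<in> Hom C a b" "g \<in> Hom C a b" "h \<in> Hom C a b" "sub f g \<in> I" "sub g h \<in> I"
  shows "sub f h \<in> I"
  using assms(4,5) tensor_ideal.add[OF _ _ sub_Hom[OF assms(1,2)] sub_Hom[OF assms(2,3)]]
  unfolding sub_trans[OF assms(1-3), symmetric] I_def by blast

lemma coset_eq_iff:
  assumes "f \<in> Hom C a b" "g \<in> Hom C a b"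
  shows "coset C I f = coset C I g \<longleftrightarrow> sub f g \<in> I"
proof
  assume "coset C I f = coset C I g"
  then show "sub f g \<in> I" using coset_self[OF assms(1)] coset_iff[OF assms(2)] by simp
next
  assume *: "sub f g \<in> I"
  have "sub h f \<in> I \<longleftrightarrow> sub h g \<in> I" if h: "h \<in> Hom C a b" for h
    using sub_trans_ideal[OF h assms _ *] sub_trans_ideal[OF h assms(2,1) _ sub_sym_ideal[OF assms *]] by auto
  then show "coset C I f = coset C I g"
    unfolding set_eq_iff coset_iff[OF assms(1)] coset_iff[OF assms(2)] by auto
qed

lemma coset_member:
  assumes f: "f \<in> Hom C a b" and g: "g \<in> coset C I f"
  shows "g \<in> Hom C a b" and "coset C I f = coset C I g"
proof -
  show *: "g \<in> Hom C a b" using g coset_iff[OF f] by simp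
  show "coset C I f = coset C I g"
    unfolding coset_eq_iff[OF f *] using g coset_iff[OF f] sub_sym_ideal[OF * f] by simp
qed

text \<open>The operations of a quotient are unions over representatives. If all members of a coset
  give the same set, the union collapses to it, because a coset is never empty.\<close>

lemma UN_coset:
  assumes f: "f \<in> Hom C a b"
    and "\<And>f'. f' \<in> Hom C a b \<Longrightarrow> coset C I f = coset C I f' \<Longrightarrow> h f = h f'"
  shows "(\<Union>f'\<in>coset C I f. h f') = h f"
proof -
  have "h f' = h f" if "f' \<in> coset C I f" for f'
    using assms(2)[OF coset_member[OF f that]] by simp
  then have "(\<Union>f'\<in>coset C I f. h f') = (\<Union>f'\<in>coset C I f. h f)" by (intro SUP_cong) simp_all
  also have "\<dots> = h f" using coset_self[OF f] by auto
  finally show ?thesis .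
qed

text \<open>One factor is changed at a time: g f - g f' lies in the ideal by
  \<open>cmp_left\<close>, and g f' - g' f' by \<open>cmp_right\<close>.\<close>

lemma coset_cmp_cong:
  assumes "f \<in> Hom C a b" "f' \<in> Hom C a b" "g \<in> Hom C b c" "g' \<in> Hom C b c"
    and "coset C I f = coset C I f'" "coset C I g = coset C I g'"
  shows "coset C I (cmp C g f) = coset C I (cmp C g' f')"
proof -
  have "sub f f' \<in> I" "sub g g' \<in> I"
    using assms(5,6) unfolding coset_eq_iff[OF assms(1,2)] coset_eq_iff[OF assms(3,4)] by auto
  then have "cmp C g (sub f f') \<in> I" "cmp C (sub g g') f' \<in> I"
    using tensor_ideal.cmp_left[OF _ sub_Hom[OF assms(1,2)] assms(3)]
      tensor_ideal.cmp_right[OF _ assms(2) sub_Hom[OF assms(3,4)]] unfolding I_def by simp_all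
  then have "sub (cmp C g f) (cmp C g f') \<in> I" "sub (cmp C g f') (cmp C g' f') \<in> I"
    using cmp_sub[OF assms(1,2,3,3)] cmp_sub[OF assms(2,2,3,4)] by simp_all
  then show ?thesis
    unfolding coset_eq_iff[OF cmp_Hom[OF assms(1,3)] cmp_Hom[OF assms(2,4)]]
    by (rule sub_trans_ideal[OF cmp_Hom[OF assms(1,3)] cmp_Hom[OF assms(2,3)] cmp_Hom[OF assms(2,4)]])
qed

lemma coset_tns_cong:
  assumes "f \<in> Hom C a b" "f' \<in> Hom C a b" "g \<in> Hom C c d" "g' \<in> Hom C c d"
    and "coset C I f = coset C I f'" "coset C I g = coset C I g'"
  shows "coset C I (tns C g f) = coset C I (tns C g' f')"
proof -
  have "sub f f' \<in> I" "sub g g' \<in> I"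
    using assms(5,6) unfolding coset_eq_iff[OF assms(1,2)] coset_eq_iff[OF assms(3,4)] by auto
  then have "tns C g (sub f f') \<in> I" "tns C (sub g g') f' \<in> I"
    using tensor_ideal.tns_left[OF _ MorI[OF assms(3)]]
      tensor_ideal.tns_right[OF _ MorI[OF assms(2)]] unfolding I_def by simp_all
  then have "sub (tns C g f) (tns C g f') \<in> I" "sub (tns C g f') (tns C g' f') \<in> I"
    using tns_sub[OF assms(1,2,3,3)] tns_sub[OF assms(2,2,3,4)] by simp_all
  then show ?thesis
    unfolding coset_eq_iff[OF tns_Hom[OF assms(3,1)] tns_Hom[OF assms(4,2)]]
    by (rule sub_trans_ideal[OF tns_Hom[OF assms(3,1)] tns_Hom[OF assms(3,2)] tns_Hom[OF assms(4,2)]])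
qed

lemma coset_add_cong:
  assumes "f \<in> Hom C a b" "f' \<in> Hom C a b" "g \<in> Hom C a b" "g' \<in> Hom C a b"
    and "coset C I f = coset C I f'" "coset C I g = coset C I g'"
  shows "coset C I (lcat.add C g f) = coset C I (lcat.add C g' f')"
proof -
  have "sub f f' \<in> I" "sub g g' \<in> I"
    using assms(5,6) unfolding coset_eq_iff[OF assms(1,2)] coset_eq_iff[OF assms(3,4)] by auto
  then have "sub (lcat.add C g f) (lcat.add C g' f') \<in> I"
    unfolding sub_add[OF assms(3,4,1,2)]
    using tensor_ideal.add[OF _ _ sub_Hom[OF assms(3,4)] sub_Hom[OF assms(1,2)]] unfolding I_def by blast
  then show ?thesis by (simp add: coset_eq_iff[OF add_Hom[OF assms(3,1)] add_Hom[OF assms(4,2)]])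
qed

lemma coset_scl_cong:
  assumes "f \<in> Hom C a b" "f' \<in> Hom C a b" and "coset C I f = coset C I f'"
  shows "coset C I (scl C r f) = coset C I (scl C r f')"
proof -
  have "sub f f' \<in> I"
    using assms(3) unfolding coset_eq_iff[OF assms(1,2)] by auto
  then have "sub (scl C r f) (scl C r f') \<in> I"
    unfolding scl_sub[OF assms(1,2), symmetric] I_def by (rule tensor_ideal.scl)
  then show ?thesis by (simp add: coset_eq_iff[OF scl_Hom[OF assms(1)] scl_Hom[OF assms(2)]])
qed

lemma quotient_simps:
  "Obj Q = Obj C" "idm Q a = coset C I (idm C a)" "dualo Q = dualo C"
  "ev Q a = coset C I (ev C a)" "coev Q a = coset C I (coev C a)"
  by (simp_all add: quotient_def)

lemma quotient_Hom: "F \<in> Hom Q a b \<longleftrightarrow> (\<exists>f\<in>Hom C a b. F = coset C I f)"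
  by (auto simp: quotient_def)

lemma quotient_cmp:
  assumes "f \<in> Hom C a b" "g \<in> Hom C b c"
  shows "cmp Q (coset C I g) (coset C I f) = coset C I (cmp C g f)"
proof -
  have "(\<Union>f'\<in>coset C I f. coset C I (cmp C g' f')) = coset C I (cmp C g' f)" if "g' \<in> Hom C b c" for g'
    by (rule UN_coset[OF assms(1)]) (rule coset_cmp_cong[OF assms(1) _ that that _ HOL.refl])
  moreover have "(\<Union>g'\<in>coset C I g. coset C I (cmp C g' f)) = coset C I (cmp C g f)"
    by (rule UN_coset[OF assms(2)]) (rule coset_cmp_cong[OF assms(1,1,2) _ HOL.refl])
  ultimately show ?thesis using coset_member(1)[OF assms(2)] by (simp add: quotient_def)
qed

lemma quotient_tns:
  assumes "f \<in> Hom C a b" "g \<in> Hom C c d"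
  shows "tns Q (coset C I g) (coset C I f) = coset C I (tns C g f)"
proof -
  have "(\<Union>f'\<in>coset C I f. coset C I (tns C g' f')) = coset C I (tns C g' f)" if "g' \<in> Hom C c d" for g'
    by (rule UN_coset[OF assms(1)]) (rule coset_tns_cong[OF assms(1) _ that that _ HOL.refl])
  moreover have "(\<Union>g'\<in>coset C I g. coset C I (tns C g' f)) = coset C I (tns C g f)"
    by (rule UN_coset[OF assms(2)]) (rule coset_tns_cong[OF assms(1,1,2) _ HOL.refl])
  ultimately show ?thesis using coset_member(1)[OF assms(2)] by (simp add: quotient_def)
qed

lemma quotient_add:
  assumes "f \<in> Hom C a b" "g \<in> Hom C a b"
  shows "lcat.add Q (coset C I g) (coset C I f) = coset C I (lcat.add C g f)"
proof -
  have "(\<Union>f'\<in>coset C I f. coset C I (lcat.add C g' f')) = coset C I (lcat.add C g' f)"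
    if "g' \<in> Hom C a b" for g'
    by (rule UN_coset[OF assms(1)]) (rule coset_add_cong[OF assms(1) _ that that _ HOL.refl])
  moreover have "(\<Union>g'\<in>coset C I g. coset C I (lcat.add C g' f)) = coset C I (lcat.add C g f)"
    by (rule UN_coset[OF assms(2)]) (rule coset_add_cong[OF assms(1,1,2) _ HOL.refl])
  ultimately show ?thesis using coset_member(1)[OF assms(2)] by (simp add: quotient_def)
qed

lemma quotient_scl:
  assumes "f \<in> Hom C a b"
  shows "scl Q r (coset C I f) = coset C I (scl C r f)"
  using UN_coset[OF assms, of "\<lambda>f. coset C I (scl C r f)"] coset_scl_cong[OF assms]
  by (simp add: quotient_def)

lemma coset_Hom: "f \<in> Hom C a b \<Longrightarrow> coset C I f \<in> Hom Q a b"
  using quotient_Hom by blast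

text \<open>Being of the same kind again, a quotient can be divided once more:
  \<open>Jones n\<close> is a quotient of \<open>TD\<close>, which is itself a quotient.\<close>

sublocale quot: linear_tensor_cat Q
proof
  note H = quotient_Hom
  fix f g h f' g' r s a b c d a' b'
  show "f \<in> Hom Q a b \<Longrightarrow> a \<in> Obj Q \<and> b \<in> Obj Q"
    unfolding H quotient_simps using Hom_Obj by blast
  show "a' = a \<and> b' = b" if f: "f \<in> Hom Q a b" "f \<in> Hom Q a' b'"
  proof -
    obtain f1 f2 where *: "f1 \<in> Hom C a b" "f2 \<in> Hom C a' b'" "f = coset C I f1" "f = coset C I f2"
      using f unfolding H by blast
    \<comment> \<open>All members of a coset lie in one Hom set, so a common coset forces both pairs
      of objects to agree.\<close>
    then have "f2 \<in> coset C I f1" using coset_self by metis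
    then show ?thesis using coset_member(1)[OF *(1)] Hom_unique *(2) by blast
  qed
  show "a \<in> Obj Q \<Longrightarrow> idm Q a \<in> Hom Q a a"
    unfolding H quotient_simps using idm_Hom by blast
  show "f \<in> Hom Q a b \<Longrightarrow> g \<in> Hom Q b c \<Longrightarrow> cmp Q g f \<in> Hom Q a c"
    unfolding H by (elim bexE, simp add: quotient_cmp) (blast intro: cmp_Hom)
  show "f \<in> Hom Q a b \<Longrightarrow> g \<in> Hom Q a' b' \<Longrightarrow> tns Q f g \<in> Hom Q (a @ a') (b @ b')"
    unfolding H by (elim bexE, simp add: quotient_tns) (blast intro: tns_Hom)
  show "f \<in> Hom Q a b \<Longrightarrow> g \<in> Hom Q a b \<Longrightarrow> lcat.add Q f g \<in> Hom Q a b"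
    unfolding H by (elim bexE, simp add: quotient_add) (blast intro: add_Hom)
  show "f \<in> Hom Q a b \<Longrightarrow> scl Q r f \<in> Hom Q a b"
    unfolding H by (elim bexE, simp add: quotient_scl) (blast intro: scl_Hom)
  show "f \<in> Hom Q a b \<Longrightarrow> g \<in> Hom Q a b \<Longrightarrow> h \<in> Hom Q a b \<Longrightarrow>
      lcat.add Q (lcat.add Q f g) h = lcat.add Q f (lcat.add Q g h)"
    unfolding H by (elim bexE) (simp add: quotient_add[of _ a b] add_Hom add_assoc)
  note add = quotient_add[of _ a b] quotient_scl[of _ a b] add_Hom scl_Hom
  show "f \<in> Hom Q a b \<Longrightarrow> g \<in> Hom Q a b \<Longrightarrow> lcat.add Q f g = lcat.add Q g f"
    unfolding H by (elim bexE) (simp add: add add_commute[of _ a b])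
  show "f \<in> Hom Q a b \<Longrightarrow> g \<in> Hom Q a b \<Longrightarrow> lcat.add Q f (scl Q 0 g) = f"
    unfolding H by (elim bexE) (simp add: add add_zero[of _ a b])
  show "f \<in> Hom Q a b \<Longrightarrow> g \<in> Hom Q a b \<Longrightarrow>
      scl Q r (lcat.add Q f g) = lcat.add Q (scl Q r f) (scl Q r g)"
    unfolding H by (elim bexE) (simp add: add scl_add[of _ a b])
  show "f \<in> Hom Q a b \<Longrightarrow> scl Q 1 f = f"
    unfolding H by (elim bexE) (simp add: add scl_one[of _ a b])
  show "f \<in> Hom Q a b \<Longrightarrow> scl Q r (scl Q s f) = scl Q (r * s) f"
    unfolding H by (elim bexE) (simp add: add scl_scl[of _ a b])
  show "f \<in> Hom Q a b \<Longrightarrow> scl Q (r + s) f = lcat.add Q (scl Q r f) (scl Q s f)"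
    unfolding H by (elim bexE) (simp add: add scl_plus[of _ a b])
  note cmp = quotient_cmp[of _ a b _ c] quotient_add[of _ a b] quotient_add[of _ b c] quotient_add[of _ a c]
    quotient_scl[of _ a b] quotient_scl[of _ b c] quotient_scl[of _ a c]
    add_Hom scl_Hom cmp_Hom[of _ a b _ c]
  show "f \<in> Hom Q a b \<Longrightarrow> f' \<in> Hom Q a b \<Longrightarrow> g \<in> Hom Q b c \<Longrightarrow>
      cmp Q g (lcat.add Q f f') = lcat.add Q (cmp Q g f) (cmp Q g f')"
    unfolding H by (elim bexE) (simp add: cmp cmp_add_right[of _ a b _ _ c])
  show "f \<in> Hom Q a b \<Longrightarrow> g \<in> Hom Q b c \<Longrightarrow> g' \<in> Hom Q b c \<Longrightarrow>
      cmp Q (lcat.add Q g g') f = lcat.add Q (cmp Q g f) (cmp Q g' f)"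
    unfolding H by (elim bexE) (simp add: cmp cmp_add_left[of _ a b _ c])
  show "f \<in> Hom Q a b \<Longrightarrow> g \<in> Hom Q b c \<Longrightarrow> cmp Q g (scl Q r f) = scl Q r (cmp Q g f)"
    unfolding H by (elim bexE) (simp add: cmp cmp_scl_right[of _ a b _ c])
  show "f \<in> Hom Q a b \<Longrightarrow> g \<in> Hom Q b c \<Longrightarrow> cmp Q (scl Q r g) f = scl Q r (cmp Q g f)"
    unfolding H by (elim bexE) (simp add: cmp cmp_scl_left[of _ a b _ c])
  note tns = quotient_tns[of _ a b _ c d] quotient_add[of _ a b] quotient_add[of _ c d]
    quotient_add[of _ "c @ a" "d @ b"] quotient_scl[of _ a b] quotient_scl[of _ c d]
    quotient_scl[of _ "c @ a" "d @ b"] add_Hom scl_Hom tns_Hom[of _ c d _ a b]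
  show "f \<in> Hom Q a b \<Longrightarrow> f' \<in> Hom Q a b \<Longrightarrow> g \<in> Hom Q c d \<Longrightarrow>
      tns Q g (lcat.add Q f f') = lcat.add Q (tns Q g f) (tns Q g f')"
    unfolding H by (elim bexE) (simp add: tns tns_add_right[of _ a b _ _ c d])
  show "f \<in> Hom Q a b \<Longrightarrow> g \<in> Hom Q c d \<Longrightarrow> g' \<in> Hom Q c d \<Longrightarrow>
      tns Q (lcat.add Q g g') f = lcat.add Q (tns Q g f) (tns Q g' f)"
    unfolding H by (elim bexE) (simp add: tns tns_add_left[of _ a b _ c d])
  show "f \<in> Hom Q a b \<Longrightarrow> g \<in> Hom Q c d \<Longrightarrow> tns Q g (scl Q r f) = scl Q r (tns Q g f)"
    unfolding H by (elim bexE) (simp add: tns tns_scl_right[of _ a b _ c d])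
  show "f \<in> Hom Q a b \<Longrightarrow> g \<in> Hom Q c d \<Longrightarrow> tns Q (scl Q r g) f = scl Q r (tns Q g f)"
    unfolding H by (elim bexE) (simp add: tns tns_scl_left[of _ a b _ c d])
qed

end

section \<open>Functors that kill the generators of a tensor ideal\<close>

lemma linear_functorD:
  assumes "linear_monoidal_functor C D F"
  shows "a \<in> Obj C \<Longrightarrow> fobj F a \<in> Obj D"
    and "a \<in> Obj C \<Longrightarrow> b \<in> Obj C \<Longrightarrow> f \<in> Hom C a b \<Longrightarrow> fmor F f \<in> Hom D (fobj F a) (fobj F b)"
    and "a \<in> Obj C \<Longrightarrow> fmor F (idm C a) = idm D (fobj F a)"
    and "a \<in> Obj C \<Longrightarrow> b \<in> Obj C \<Longrightarrow> c \<in> Obj C \<Longrightarrow> f \<in> Hom C a b \<Longrightarrow> g \<in> Hom C b c \<Longrightarrow>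
      fmor F (cmp C g f) = cmp D (fmor F g) (fmor F f)"
    and "a \<in> Obj C \<Longrightarrow> b \<in> Obj C \<Longrightarrow> f \<in> Hom C a b \<Longrightarrow> g \<in> Hom C a b \<Longrightarrow>
      fmor F (lcat.add C f g) = lcat.add D (fmor F f) (fmor F g)"
    and "f \<in> Mor C \<Longrightarrow> fmor F (scl C r f) = scl D r (fmor F f)"
    and "fobj F [] = []"
    and "a \<in> Obj C \<Longrightarrow> b \<in> Obj C \<Longrightarrow> fobj F (a @ b) = fobj F a @ fobj F b"
    and "f \<in> Mor C \<Longrightarrow> g \<in> Mor C \<Longrightarrow> fmor F (tns C f g) = tns D (fmor F f) (fmor F g)"
  using assms unfolding linear_monoidal_functor_def by blast+

context tensor_ideal_of
begin

text \<open>As zero morphisms are not named, \<open>scl D 0 u = u\<close> expresses that \<open>u\<close> is zero.\<close>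

lemma ideal_killed:
  assumes D: "linear_tensor_cat D" and F: "linear_monoidal_functor C D F"
    and kills: "\<And>g. g \<in> G \<Longrightarrow> scl D 0 (fmor F g) = fmor F g"
    and "f \<in> I"
  shows "scl D 0 (fmor F f) = fmor F f"
proof -
  interpret D: linear_tensor_cat D by (rule D)
  note FD = linear_functorD[OF F]
  have H: "\<exists>a b. fmor F f \<in> Hom D a b" if "f \<in> Mor C" for f
    using that FD(2) Mor_iff Hom_Obj by metis
  have z: "scl D 0 (scl D r (fmor F f)) = scl D r (fmor F f)"
    if "f \<in> Mor C" "scl D 0 (fmor F f) = fmor F f" for f r
    using H[OF that(1)] that(2) D.scl_scl by (metis mult.commute)
  from \<open>f \<in> I\<close> show ?thesis unfolding I_def
  proof (induction rule: tensor_ideal.induct)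
    case (gen g)
    then show ?case using kills by blast
  next
    case (zero f)
    then have "fmor F (scl C 0 f) = scl D 0 (fmor F f)" using FD by blast
    then show ?case using H[OF zero] D.scl_scl by (metis mult_zero_left)
  next
    case (add f g a b)
    have o: "a \<in> Obj C" "b \<in> Obj C" using add Hom_Obj by blast+
    have f: "fmor F f \<in> Hom D (fobj F a) (fobj F b)" "fmor F g \<in> Hom D (fobj F a) (fobj F b)"
      using FD(2)[OF o] add by blast+
    have "fmor F (lcat.add C f g) = lcat.add D (fmor F f) (fmor F g)"
      using FD(5)[OF o] add by blast
    then show ?case using add.IH D.scl_add[OF f] by simp
  next
    case (scl f r)
    then have "f \<in> Mor C" using ideal_Mor Mor_iff unfolding I_def by blast
    then show ?case using FD(6) z scl.IH by presburger
  next
    case (cmp_left f a b g c)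
    have o: "a \<in> Obj C" "b \<in> Obj C" "c \<in> Obj C" using cmp_left Hom_Obj by blast+
    have H: "fmor F f \<in> Hom D (fobj F a) (fobj F b)" "fmor F g \<in> Hom D (fobj F b) (fobj F c)"
      using FD(2) o cmp_left by blast+
    have "fmor F (cmp C g f) = cmp D (fmor F g) (fmor F f)" using FD(4) o cmp_left by blast
    then show ?case using cmp_left.IH D.cmp_scl_right[OF H] by metis
  next
    case (cmp_right g f a b c)
    have o: "a \<in> Obj C" "b \<in> Obj C" "c \<in> Obj C" using cmp_right Hom_Obj by blast+
    have H: "fmor F f \<in> Hom D (fobj F a) (fobj F b)" "fmor F g \<in> Hom D (fobj F b) (fobj F c)"
      using FD(2) o cmp_right by blast+
    have "fmor F (cmp C g f) = cmp D (fmor F g) (fmor F f)" using FD(4) o cmp_right by blast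
    then show ?case using cmp_right.IH D.cmp_scl_left[OF H] by metis
  next
    case (tns_left f g)
    then have M: "f \<in> Mor C" using ideal_Mor Mor_iff unfolding I_def by blast
    have "fmor F (tns C g f) = tns D (fmor F g) (fmor F f)" using FD(9) M tns_left by blast
    then show ?case using tns_left.IH D.tns_scl_right H[OF M] H[OF tns_left.hyps(2)] by metis
  next
    case (tns_right f g)
    then have M: "f \<in> Mor C" using ideal_Mor Mor_iff unfolding I_def by blast
    have "fmor F (tns C f g) = tns D (fmor F f) (fmor F g)" using FD(9) M tns_right by blast
    then show ?case using tns_right.IH D.tns_scl_left H[OF M] H[OF tns_right.hyps(2)] by metis
  qed
qed

text \<open>A coset takes the value of a chosen member; \<open>induced_coset\<close> shows that the
  choice has no influence once the generators are killed.\<close>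

definition induced :: "('x, 'm, 'y, 'n) func \<Rightarrow> ('x, 'm set, 'y, 'n) func" where
  "induced F = \<lparr>fobj = fobj F, fmor = restrict (\<lambda>X. fmor F (SOME f. f \<in> X)) (Mor Q)\<rparr>"

text \<open>The chosen member is \<open>f\<close> plus an element of the ideal, and by
  \<open>ideal_killed\<close> the image of that element is zero.\<close>

lemma induced_coset:
  assumes D: "linear_tensor_cat D" and F: "linear_monoidal_functor C D F"
    and kills: "\<And>g. g \<in> G \<Longrightarrow> scl D 0 (fmor F g) = fmor F g"
    and f: "f \<in> Hom C a b"
  shows "fmor (induced F) (coset C I f) = fmor F f"
proof -
  interpret D: linear_tensor_cat D by (rule D)
  note FD = linear_functorD[OF F]
  define g where "g = (SOME g. g \<in> coset C I f)"
  have g: "g \<in> coset C I f" unfolding g_def using coset_self[OF f] by (metis someI)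
  then have gH: "g \<in> Hom C a b" and sI: "sub g f \<in> I" using coset_iff[OF f] by auto
  have o: "a \<in> Obj C" "b \<in> Obj C" using f Hom_Obj by blast+
  note z = ideal_killed[OF D F kills sI, simplified]
  have sH: "sub g f \<in> Hom C a b" using gH f sub_Hom by blast
  have "fmor F g = fmor F (lcat.add C f (sub g f))" using add_sub gH f by simp
  also have "\<dots> = lcat.add D (fmor F f) (fmor F (sub g f))" using FD(5) o f sH by blast
  also have "\<dots> = lcat.add D (fmor F f) (scl D 0 (fmor F (sub g f)))" using z by simp
  also have "\<dots> = fmor F f" using D.add_zero FD(2)[OF o] f sH by blast
  finally have "fmor F g = fmor F f" .
  moreover have "coset C I f \<in> Mor Q" using quot.MorI coset_Hom f by blast
  ultimately show ?thesis unfolding induced_def g_def by simp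
qed

lemma induced_functor:
  assumes D: "linear_tensor_cat D" and F: "linear_monoidal_functor C D F"
    and kills: "\<And>g. g \<in> G \<Longrightarrow> scl D 0 (fmor F g) = fmor F g"
  shows "linear_monoidal_functor Q D (induced F)"
proof -
  note FD = linear_functorD[OF F]
  note c = induced_coset[OF D F kills, simplified]
  have o: "fobj (induced F) = fobj F" by (simp add: induced_def)
  show ?thesis unfolding linear_monoidal_functor_def o quotient_simps(1)
  proof (intro conjI ballI allI)
    show "fobj F \<in> Obj C \<rightarrow>\<^sub>E Obj D" using F unfolding linear_monoidal_functor_def by blast
    show "fmor (induced F) \<in> extensional (Mor Q)" by (simp add: induced_def)
    show "fobj F [] = []" by (rule FD)
    show "fmor (induced F) (idm Q a) = idm D (fobj F a)" if "a \<in> Obj C" for a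
      unfolding quotient_simps using c[OF idm_Hom[OF that]] FD(3)[OF that] by simp
    show "fobj F (a @ b) = fobj F a @ fobj F b" if "a \<in> Obj C" "b \<in> Obj C" for a b
      using FD(8) that by blast
    show "fmor (induced F) f \<in> Hom D (fobj F a) (fobj F b)"
      if "a \<in> Obj C" "b \<in> Obj C" "f \<in> Hom Q a b" for a b f
      using that c FD(2) unfolding quotient_Hom by metis
    show "fmor (induced F) (lcat.add Q f g) = lcat.add D (fmor (induced F) f) (fmor (induced F) g)"
      if ab: "a \<in> Obj C" "b \<in> Obj C" and fg: "f \<in> Hom Q a b" "g \<in> Hom Q a b" for a b f g
    proof -
      obtain f' g' where *: "f' \<in> Hom C a b" "g' \<in> Hom C a b" "f = coset C I f'" "g = coset C I g'"
        using fg unfolding quotient_Hom by blast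
      show ?thesis using *(1,2) unfolding *(3-)
        by (simp add: c[of _ a b] quotient_add[of _ a b] add_Hom FD(5)[OF ab])
    qed
    show "fmor (induced F) (cmp Q g f) = cmp D (fmor (induced F) g) (fmor (induced F) f)"
      if o: "a \<in> Obj C" "b \<in> Obj C" "c \<in> Obj C" and fg: "f \<in> Hom Q a b" "g \<in> Hom Q b c" for a b c f g
    proof -
      obtain f' g' where *: "f' \<in> Hom C a b" "g' \<in> Hom C b c" "f = coset C I f'" "g = coset C I g'"
        using fg unfolding quotient_Hom by blast
      show ?thesis using *(1,2) unfolding *(3-)
        by (simp add: c[of _ a b] c[of _ b c] quotient_cmp c[OF cmp_Hom] FD(4)[OF o])
    qed
    show "fmor (induced F) (scl Q r f) = scl D r (fmor (induced F) f)" if "f \<in> Mor Q" for r f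
      using that unfolding quot.Mor_iff quotient_Hom
      by (metis c quotient_scl scl_Hom FD(6) MorI)
    show "fmor (induced F) (tns Q f g) = tns D (fmor (induced F) f) (fmor (induced F) g)"
      if "f \<in> Mor Q" "g \<in> Mor Q" for f g
      using that unfolding quot.Mor_iff quotient_Hom
      by (metis c quotient_tns tns_Hom FD(9) MorI)
  qed
qed

end

section \<open>Linear combinations\<close>

abbreviation "supp \<equiv> Poly_Mapping.keys"
abbreviation "lookup \<equiv> Poly_Mapping.lookup"
abbreviation "single \<equiv> Poly_Mapping.single"

abbreviation smult :: "qring \<Rightarrow> ('a \<Rightarrow>\<^sub>0 qring) \<Rightarrow> ('a \<Rightarrow>\<^sub>0 qring)" where
  "smult r \<equiv> Poly_Mapping.map ((*) r)"

lemma lookup_smult: "lookup (smult r f) k = r * lookup f k"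
  by (auto simp: Poly_Mapping.map.rep_eq when_def)

lemma smult_add: "smult r (f + g) = smult r f + smult r g"
  by (rule poly_mapping_eqI) (simp add: lookup_smult lookup_add algebra_simps)

lemma smult_plus: "smult (r + s) f = smult r f + smult s f"
  by (rule poly_mapping_eqI) (simp add: lookup_smult lookup_add algebra_simps)

lemma smult_smult: "smult r (smult s f) = smult (r * s) f"
  by (rule poly_mapping_eqI) (simp add: lookup_smult algebra_simps)

lemma smult_one: "smult 1 f = f"
  by (rule poly_mapping_eqI) (simp add: lookup_smult)

lemma smult_zero: "smult 0 f = 0" "smult r 0 = 0"
  by (rule poly_mapping_eqI, simp add: lookup_smult)+

lemma smult_single: "smult r (single A s) = single A (r * s)"
  by (rule poly_mapping_eqI) (simp add: lookup_smult lookup_single when_def)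

lemma smult_sum: "smult r (\<Sum>x\<in>U. f x) = (\<Sum>x\<in>U. smult r (f x))"
  by (induction U rule: infinite_finite_induct) (simp_all add: smult_zero smult_add)

lemma keys_smult: "supp (smult r f) \<subseteq> supp f"
  by (auto simp: in_keys_iff lookup_smult)

lemma keys_add_subset:
  "supp f \<subseteq> U \<Longrightarrow> supp g \<subseteq> U \<Longrightarrow> supp (f + g) \<subseteq> U"
  by (meson Poly_Mapping.keys_add Un_least order_trans)

lemma keys_sum_subset:
  "(\<And>x. x \<in> V \<Longrightarrow> supp (f x) \<subseteq> U) \<Longrightarrow> supp (\<Sum>x\<in>V. f x) \<subseteq> U"
  by (induction V rule: infinite_finite_induct) (simp_all add: keys_add_subset)

lemma keys_sum_list_subset:
  "(\<And>x. x \<in> set xs \<Longrightarrow> supp (f x) \<subseteq> U) \<Longrightarrow> supp (\<Sum>x\<leftarrow>xs. f x) \<subseteq> U"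
  by (induction xs) (simp_all add: keys_add_subset)

lemma poly_mapping_sum_singles:
  "f = (\<Sum>A\<in>supp f. single A (lookup f A))"
  by (rule poly_mapping_eqI) (auto simp: lookup_sum lookup_single when_def not_in_keys_iff_lookup_eq_zero sum.delta)

definition additive :: "(('a \<Rightarrow>\<^sub>0 qring) \<Rightarrow> ('b \<Rightarrow>\<^sub>0 qring)) \<Rightarrow> bool" where
  "additive \<phi> \<longleftrightarrow> \<phi> 0 = 0 \<and> (\<forall>f g. \<phi> (f + g) = \<phi> f + \<phi> g)"

lemma additive_sum: "additive \<phi> \<Longrightarrow> \<phi> (\<Sum>x\<in>U. f x) = (\<Sum>x\<in>U. \<phi> (f x))"
  by (induction U rule: infinite_finite_induct) (simp_all add: additive_def)

lemma additive_sum_list: "additive \<phi> \<Longrightarrow> \<phi> (\<Sum>x\<leftarrow>xs. f x) = (\<Sum>x\<leftarrow>xs. \<phi> (f x))"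
  by (induction xs) (simp_all add: additive_def)

text \<open>A finitely supported function is a sum of terms \<open>single A r\<close>. Additivity
  suffices because these are compared for every coefficient \<open>r\<close>.\<close>

lemma additive_eqI:
  assumes "additive \<phi>" "additive \<psi>" "supp f \<subseteq> U"
    and "\<And>A r. A \<in> U \<Longrightarrow> \<phi> (single A r) = \<psi> (single A r)"
  shows "\<phi> f = \<psi> f"
proof -
  have "\<phi> (\<Sum>A\<in>supp f. single A (lookup f A)) =
      \<psi> (\<Sum>A\<in>supp f. single A (lookup f A))"
    unfolding additive_sum[OF assms(1)] additive_sum[OF assms(2)]
    using assms(3,4) by (intro sum.cong) auto
  then show ?thesis by (simp flip: poly_mapping_sum_singles)
qed

definition linear_ext :: "('a \<Rightarrow> ('b \<Rightarrow>\<^sub>0 qring)) \<Rightarrow> ('a \<Rightarrow>\<^sub>0 qring) \<Rightarrow> ('b \<Rightarrow>\<^sub>0 qring)" where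
  "linear_ext \<phi> f = (\<Sum>A\<in>supp f. smult (lookup f A) (\<phi> A))"

text \<open>The support of a sum can be smaller than the union of the supports, so additivity is
  proved by summing over one common finite set.\<close>

lemma linear_ext_superset:
  assumes "finite U" "supp f \<subseteq> U"
  shows "linear_ext \<phi> f = (\<Sum>A\<in>U. smult (lookup f A) (\<phi> A))"
  unfolding linear_ext_def using assms
  by (intro sum.mono_neutral_left) (auto simp: not_in_keys_iff_lookup_eq_zero smult_zero)

lemma linear_ext_zero: "linear_ext \<phi> 0 = 0"
  by (simp add: linear_ext_def)

lemma linear_ext_add: "linear_ext \<phi> (f + g) = linear_ext \<phi> f + linear_ext \<phi> g"
proof -
  let ?U = "supp f \<union> supp g"
  have U: "finite ?U" by simp
  show ?thesis
    using linear_ext_superset[OF U, of f \<phi>] linear_ext_superset[OF U, of g \<phi>]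
      linear_ext_superset[OF U Poly_Mapping.keys_add, of \<phi>]
    by (simp add: lookup_add smult_plus sum.distrib)
qed

lemma additive_linear_ext: "additive (linear_ext \<phi>)"
  by (simp add: additive_def linear_ext_zero linear_ext_add)

lemma linear_ext_single: "linear_ext \<phi> (single A r) = smult r (\<phi> A)"
  by (subst linear_ext_superset[of "{A}"]) auto

lemma linear_ext_smult: "linear_ext \<phi> (smult r f) = smult r (linear_ext \<phi> f)"
  unfolding linear_ext_superset[OF finite_keys keys_smult, of \<phi>]
  by (simp add: linear_ext_def smult_sum lookup_smult smult_smult)

text \<open>Written as an iterated linear extension, \<open>bilinear_ext\<close> inherits
  bilinearity from the case of one variable.\<close>

lemma bilinear_ext_linear_ext:
  "bilinear_ext h f g = linear_ext (\<lambda>A. linear_ext (\<lambda>B. single (h A B) 1) g) f"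
  by (simp add: bilinear_ext_def linear_ext_def smult_sum smult_single)

lemma linear_ext_fun_add:
  "linear_ext (\<lambda>A. \<phi> A + \<psi> A) f = linear_ext \<phi> f + linear_ext \<psi> f"
  by (simp add: linear_ext_def smult_add sum.distrib)

lemma linear_ext_fun_smult: "linear_ext (\<lambda>A. smult r (\<phi> A)) f = smult r (linear_ext \<phi> f)"
  by (simp add: linear_ext_def smult_sum smult_smult mult.commute)

lemma bilinear_ext_add:
  "bilinear_ext h (f + f') g = bilinear_ext h f g + bilinear_ext h f' g"
  "bilinear_ext h f (g + g') = bilinear_ext h f g + bilinear_ext h f g'"
  by (simp_all add: bilinear_ext_linear_ext linear_ext_add linear_ext_fun_add)

lemma bilinear_ext_zero: "bilinear_ext h 0 g = 0" "bilinear_ext h f 0 = 0"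
  by (simp_all add: bilinear_ext_def)

lemma bilinear_ext_smult:
  "bilinear_ext h (smult r f) g = smult r (bilinear_ext h f g)"
  "bilinear_ext h f (smult r g) = smult r (bilinear_ext h f g)"
  by (simp_all add: bilinear_ext_linear_ext linear_ext_smult linear_ext_fun_smult)

lemma bilinear_ext_single:
  "bilinear_ext h (single A r) (single B s) = single (h A B) (r * s)"
  by (simp add: bilinear_ext_linear_ext linear_ext_single smult_single)

text \<open>Closure rules: any nest of bilinear extensions is additive in each of its slots, so that
  \<open>additive_eqI\<close> can be applied to one slot after another.\<close>

lemma additive_bilinear_ext:
  "additive \<phi> \<Longrightarrow> additive (\<lambda>f. bilinear_ext h (\<phi> f) g)"
  "additive \<phi> \<Longrightarrow> additive (\<lambda>f. bilinear_ext h g (\<phi> f))"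
  "additive (\<lambda>f. f)"
  by (simp_all add: additive_def bilinear_ext_add bilinear_ext_zero)

lemma keys_bilinear_ext:
  assumes "supp f \<subseteq> U" "supp g \<subseteq> Y"
    and "\<And>A B. A \<in> U \<Longrightarrow> B \<in> Y \<Longrightarrow> h A B \<in> Z"
  shows "supp (bilinear_ext h f g) \<subseteq> Z"
  unfolding bilinear_ext_def using assms
  by (intro keys_sum_subset) (auto split: if_splits)


section \<open>Categories of diagrams\<close>

definition stack_class :: "('x, 'v) kind \<Rightarrow> ('x, 'v) diag set \<Rightarrow> ('x, 'v) diag set \<Rightarrow> ('x, 'v) diag set" where
  "stack_class K A B = (\<Union>d\<in>A. \<Union>e\<in>B. iclass K (d \<cdot> e))"

definition juxt_class :: "('x, 'v) kind \<Rightarrow> ('x, 'v) diag set \<Rightarrow> ('x, 'v) diag set \<Rightarrow> ('x, 'v) diag set" where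
  "juxt_class K A B = (\<Union>d\<in>A. \<Union>e\<in>B. iclass K (d \<otimes> e))"

locale diag_kind =
  fixes K :: "('x, 'v) kind"
  assumes dual_dual: "dual K (dual K x) = x"
    and turns_wf: "(d, e) \<in> turns K \<Longrightarrow> wf_diag K d \<and> wf_diag K e \<and> src K d = src K e \<and> tgt K d = tgt K e"
begin

lemma isotopic_wf:
  "isotopic K d e \<Longrightarrow> wf_diag K d \<and> wf_diag K e \<and> src K d = src K e \<and> tgt K d = tgt K e"
  by (induction rule: isotopic.induct) (use turns_wf in \<open>auto simp: dual_dual\<close>)

lemma iclass_eq: "isotopic K d e \<Longrightarrow> iclass K d = iclass K e"
  unfolding iclass_def using isotopic.trans isotopic.sym by blast

lemma iclass_self: "wf_diag K d \<Longrightarrow> d \<in> iclass K d"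
  by (simp add: iclass_def isotopic.refl)

lemma stack_class_iclass:
  assumes "wf_diag K (d \<cdot> e)"
  shows "stack_class K (iclass K d) (iclass K e) = iclass K (d \<cdot> e)"
proof -
  have "iclass K (d' \<cdot> e') = iclass K (d \<cdot> e)" if "d' \<in> iclass K d" "e' \<in> iclass K e" for d' e'
    using that assms iclass_eq[OF isotopic.stack] unfolding iclass_def by simp
  moreover have "d \<in> iclass K d" "e \<in> iclass K e" using assms iclass_self by auto
  ultimately show ?thesis unfolding stack_class_def by blast
qed

lemma juxt_class_iclass:
  assumes "wf_diag K (d \<otimes> e)"
  shows "juxt_class K (iclass K d) (iclass K e) = iclass K (d \<otimes> e)"
proof -
  have "iclass K (d' \<otimes> e') = iclass K (d \<otimes> e)" if "d' \<in> iclass K d" "e' \<in> iclass K e" for d' e'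
    using that assms iclass_eq[OF isotopic.juxt] unfolding iclass_def by simp
  moreover have "d \<in> iclass K d" "e \<in> iclass K e" using assms iclass_self by auto
  ultimately show ?thesis unfolding juxt_class_def by blast
qed

abbreviation stack_lin where "stack_lin \<equiv> bilinear_ext (stack_class K)"
abbreviation juxt_lin where "juxt_lin \<equiv> bilinear_ext (juxt_class K)"

definition class_single :: "('x, 'v) diag \<Rightarrow> ('x, 'v) diag set \<Rightarrow>\<^sub>0 qring" where
  "class_single d = single (iclass K d) 1"

lemma stack_lin_single:
  "wf_diag K (d \<cdot> e) \<Longrightarrow> stack_lin (single (iclass K d) r) (single (iclass K e) s) =
     single (iclass K (d \<cdot> e)) (r * s)"
  using stack_class_iclass by (simp add: bilinear_ext_single)

lemma juxt_lin_single:
  "wf_diag K (d \<otimes> e) \<Longrightarrow> juxt_lin (single (iclass K d) r) (single (iclass K e) s) =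
     single (iclass K (d \<otimes> e)) (r * s)"
  using juxt_class_iclass by (simp add: bilinear_ext_single)

definition classes :: "('x, 'v) diag set \<Rightarrow> 'x list \<Rightarrow> 'x list \<Rightarrow> ('x, 'v) diag set set" where
  "classes B a b = iclass K ` {d \<in> B. wf_diag K d \<and> src K d = a \<and> tgt K d = b}"

text \<open>Each slot in turn is reduced to a single isotopy class; for single classes the law is
  one of the rules of \<open>isotopic\<close>. The other laws for linear combinations follow the
  same pattern.\<close>

lemma stack_lin_assoc:
  assumes f: "supp f \<subseteq> classes U a b" and g: "supp g \<subseteq> classes U b c"
    and h: "supp h \<subseteq> classes U c d"
  shows "stack_lin (stack_lin h g) f = stack_lin h (stack_lin g f)"
  apply (rule additive_eqI[OF _ _ f, of "\<lambda>f. stack_lin (stack_lin h g) f"], (intro additive_bilinear_ext)+)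
  apply (rule additive_eqI[OF _ _ g, of "\<lambda>g. stack_lin (stack_lin h g) _"], (intro additive_bilinear_ext)+)
  apply (rule additive_eqI[OF _ _ h, of "\<lambda>h. stack_lin (stack_lin h _) _"], (intro additive_bilinear_ext)+)
  by (auto simp: classes_def stack_lin_single mult.assoc iclass_eq[OF isotopic.stack_assoc])

lemma stack_lin_strands:
  assumes f: "supp f \<subseteq> classes U a b"
  shows "stack_lin (single (iclass K (Strands b)) 1) f = f"
    and "stack_lin f (single (iclass K (Strands a)) 1) = f"
proof -
  show "stack_lin (single (iclass K (Strands b)) 1) f = f"
    by (rule additive_eqI[OF _ _ f], (intro additive_bilinear_ext)+)
      (auto simp: classes_def stack_lin_single iclass_eq[OF isotopic.stack_top])
  show "stack_lin f (single (iclass K (Strands a)) 1) = f"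
    by (rule additive_eqI[OF _ _ f], (intro additive_bilinear_ext)+)
      (auto simp: classes_def stack_lin_single iclass_eq[OF isotopic.stack_bottom])
qed

lemma juxt_lin_assoc:
  assumes f: "supp f \<subseteq> classes U a b" and g: "supp g \<subseteq> classes U a' b'"
    and h: "supp h \<subseteq> classes U a'' b''"
  shows "juxt_lin (juxt_lin h g) f = juxt_lin h (juxt_lin g f)"
  apply (rule additive_eqI[OF _ _ f, of "\<lambda>f. juxt_lin (juxt_lin h g) f"], (intro additive_bilinear_ext)+)
  apply (rule additive_eqI[OF _ _ g, of "\<lambda>g. juxt_lin (juxt_lin h g) _"], (intro additive_bilinear_ext)+)
  apply (rule additive_eqI[OF _ _ h, of "\<lambda>h. juxt_lin (juxt_lin h _) _"], (intro additive_bilinear_ext)+)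
  by (auto simp: classes_def juxt_lin_single mult.assoc iclass_eq[OF isotopic.juxt_assoc])

lemma juxt_lin_strands:
  assumes f: "supp f \<subseteq> classes U a b"
  shows "juxt_lin (single (iclass K (Strands [])) 1) f = f"
    and "juxt_lin f (single (iclass K (Strands [])) 1) = f"
proof -
  show "juxt_lin (single (iclass K (Strands [])) 1) f = f"
    by (rule additive_eqI[OF _ _ f], (intro additive_bilinear_ext)+)
      (auto simp: classes_def juxt_lin_single iclass_eq[OF isotopic.juxt_left])
  show "juxt_lin f (single (iclass K (Strands [])) 1) = f"
    by (rule additive_eqI[OF _ _ f], (intro additive_bilinear_ext)+)
      (auto simp: classes_def juxt_lin_single iclass_eq[OF isotopic.juxt_right])
qed

lemma lin_interchange:
  assumes f: "supp f \<subseteq> classes U a b" and g: "supp g \<subseteq> classes U b c"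
    and f': "supp f' \<subseteq> classes U a' b'" and g': "supp g' \<subseteq> classes U b' c'"
  shows "juxt_lin (stack_lin g f) (stack_lin g' f') = stack_lin (juxt_lin g g') (juxt_lin f f')"
  apply (rule additive_eqI[OF _ _ f, of "\<lambda>f. juxt_lin (stack_lin g f) _"], (intro additive_bilinear_ext)+)
  apply (rule additive_eqI[OF _ _ g, of "\<lambda>g. juxt_lin (stack_lin g _) _"], (intro additive_bilinear_ext)+)
  apply (rule additive_eqI[OF _ _ f', of "\<lambda>f'. juxt_lin _ (stack_lin _ f')"], (intro additive_bilinear_ext)+)
  apply (rule additive_eqI[OF _ _ g', of "\<lambda>g'. juxt_lin _ (stack_lin g' _)"], (intro additive_bilinear_ext)+)
  by (auto simp: classes_def juxt_lin_single stack_lin_single mult_ac iclass_eq[OF isotopic.interchange])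

end

text \<open>\<open>B\<close> is everything for tangles and \<open>webs\<close> for
  \<open>TrPD\<close>. The keys of a morphism are classes with some representative in
  \<open>B\<close>, and the closure of \<open>B\<close> makes them stable under both
  products.\<close>

locale diag_category = diag_kind K for K :: "('x, 'v) kind" +
  fixes Os :: "'x list set" and B :: "('x, 'v) diag set"
  assumes Os_append: "a \<in> Os \<Longrightarrow> b \<in> Os \<Longrightarrow> a @ b \<in> Os"
    and B_strands: "a \<in> Os \<Longrightarrow> Strands a \<in> B"
    and B_stack: "d \<in> B \<Longrightarrow> e \<in> B \<Longrightarrow> d \<cdot> e \<in> B"
    and B_juxt: "d \<in> B \<Longrightarrow> e \<in> B \<Longrightarrow> d \<otimes> e \<in> B"
begin

abbreviation D where "D \<equiv> diag_cat K Os B"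

lemma diag_cat_simps:
  "Obj D = Os" "idm D a = lin_diag K (Strands a)"
  "cmp D (b', c, g) (a, b, f) = (a, c, stack_lin g f)"
  "tns D (a, b, f) (a', b', g) = (a @ a', b @ b', juxt_lin f g)"
  "lcat.add D (a, b, f) (a', b', g) = (a, b, f + g)"
  "scl D r (a, b, f) = (a, b, smult r f)"
  "dualo D = dual_obj (dual K)"
  "ev D a = lin_diag K (caps (dual K) a)" "coev D a = lin_diag K (cups (dual K) a)"
  by (simp_all add: diag_cat_def stack_class_def[abs_def] juxt_class_def[abs_def])

lemma diag_cat_Hom:
  "F \<in> Hom D a b \<longleftrightarrow> (\<exists>f. F = (a, b, f) \<and> a \<in> Os \<and> b \<in> Os \<and> supp f \<subseteq> classes B a b)"
  by (auto simp: diag_cat_def classes_def)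

lemma keys_stack_lin:
  assumes "supp f \<subseteq> classes B a b" "supp g \<subseteq> classes B b c"
  shows "supp (stack_lin g f) \<subseteq> classes B a c"
proof (rule keys_bilinear_ext[OF assms(2,1)])
  fix A A' assume "A \<in> classes B b c" "A' \<in> classes B a b"
  then obtain d e where "A = iclass K d" "A' = iclass K e" "d \<in> B" "e \<in> B" "wf_diag K d" "wf_diag K e"
    "src K d = b" "tgt K d = c" "src K e = a" "tgt K e = b"
    by (auto simp: classes_def)
  then show "stack_class K A A' \<in> classes B a c"
    using B_stack by (auto simp: stack_class_iclass classes_def)
qed

lemma keys_juxt_lin:
  assumes "supp f \<subseteq> classes B a b" "supp g \<subseteq> classes B a' b'"
  shows "supp (juxt_lin f g) \<subseteq> classes B (a @ a') (b @ b')"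
proof (rule keys_bilinear_ext[OF assms])
  fix A A' assume "A \<in> classes B a b" "A' \<in> classes B a' b'"
  then obtain d e where "A = iclass K d" "A' = iclass K e" "d \<in> B" "e \<in> B" "wf_diag K d" "wf_diag K e"
    "src K d = a" "tgt K d = b" "src K e = a'" "tgt K e = b'"
    by (auto simp: classes_def)
  then show "juxt_class K A A' \<in> classes B (a @ a') (b @ b')"
    using B_juxt by (auto simp: juxt_class_iclass classes_def)
qed

lemma iclass_classes: "d \<in> B \<Longrightarrow> wf_diag K d \<Longrightarrow> iclass K d \<in> classes B (src K d) (tgt K d)"
  by (auto simp: classes_def)

sublocale linear_tensor_cat D
proof
  fix a
  show "a \<in> Obj D \<Longrightarrow> idm D a \<in> Hom D a a"
    using iclass_classes[OF B_strands, of a]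
    by (auto simp: diag_cat_simps diag_cat_Hom lin_diag_def lin_comb_def)
next
  fix f g a b c a' b' r
  show "f \<in> Hom D a b \<Longrightarrow> g \<in> Hom D b c \<Longrightarrow> cmp D g f \<in> Hom D a c"
    unfolding diag_cat_Hom by (elim exE conjE) (simp add: diag_cat_simps keys_stack_lin)
  show "f \<in> Hom D a b \<Longrightarrow> g \<in> Hom D a' b' \<Longrightarrow> tns D f g \<in> Hom D (a @ a') (b @ b')"
    unfolding diag_cat_Hom by (elim exE conjE) (simp add: diag_cat_simps keys_juxt_lin Os_append)
  show "f \<in> Hom D a b \<Longrightarrow> g \<in> Hom D a b \<Longrightarrow> lcat.add D f g \<in> Hom D a b"
    unfolding diag_cat_Hom by (elim exE conjE) (simp add: diag_cat_simps keys_add_subset)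
  show "f \<in> Hom D a b \<Longrightarrow> scl D r f \<in> Hom D a b"
    unfolding diag_cat_Hom by (elim exE conjE) (simp add: diag_cat_simps order_trans[OF keys_smult])
qed (auto simp: diag_cat_Hom diag_cat_simps smult_one smult_smult smult_plus smult_add smult_zero
       bilinear_ext_add bilinear_ext_smult add_ac)

lemma lin_diag_Hom:
  "d \<in> B \<Longrightarrow> wf_diag K d \<Longrightarrow> src K d \<in> Os \<Longrightarrow> tgt K d \<in> Os \<Longrightarrow> lin_diag K d \<in> Hom D (src K d) (tgt K d)"
  using iclass_classes[of d] by (simp add: diag_cat_Hom lin_diag_def lin_comb_def)

lemma lin_diag_stack:
  "wf_diag K (d \<cdot> e) \<Longrightarrow> cmp D (lin_diag K d) (lin_diag K e) = lin_diag K (d \<cdot> e)"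
  by (simp add: lin_diag_def lin_comb_def diag_cat_simps stack_lin_single)

lemma lin_diag_juxt:
  "wf_diag K (d \<otimes> e) \<Longrightarrow> tns D (lin_diag K d) (lin_diag K e) = lin_diag K (d \<otimes> e)"
  by (simp add: lin_diag_def lin_comb_def diag_cat_simps juxt_lin_single)

lemma lin_diag_isotopic: "isotopic K d e \<Longrightarrow> lin_diag K d = lin_diag K e"
  using isotopic_wf[of d e] iclass_eq[of d e] by (simp add: lin_diag_def lin_comb_def)

end

lemma wf_caps:
  "wf_diag K (caps (dual K) a) \<and> src K (caps (dual K) a) = a @ dual_obj (dual K) a \<and> tgt K (caps (dual K) a) = []"
  by (induction a) (auto simp: dual_obj_def)

lemma wf_cups:
  "wf_diag K (cups (dual K) a) \<and> src K (cups (dual K) a) = [] \<and> tgt K (cups (dual K) a) = a @ dual_obj (dual K) a"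
  by (induction a) (auto simp: dual_obj_def)

section \<open>Functors on diagrams given by the values of the vertices\<close>

primrec diag_value :: "('y, 'w) kind \<Rightarrow> ('x \<Rightarrow> 'y) \<Rightarrow> ('v \<Rightarrow> (('y, 'w) diag set \<Rightarrow>\<^sub>0 qring)) \<Rightarrow>
    ('x, 'v) diag \<Rightarrow> (('y, 'w) diag set \<Rightarrow>\<^sub>0 qring)" where
  "diag_value K l \<phi> (Strands a) = single (iclass K (Strands (map l a))) 1"
| "diag_value K l \<phi> (Cap x) = single (iclass K (Cap (l x))) 1"
| "diag_value K l \<phi> (Cup x) = single (iclass K (Cup (l x))) 1"
| "diag_value K l \<phi> (Vert v) = \<phi> v"
| "diag_value K l \<phi> (d \<cdot> e) = bilinear_ext (stack_class K) (diag_value K l \<phi> d) (diag_value K l \<phi> e)"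
| "diag_value K l \<phi> (d \<otimes> e) = bilinear_ext (juxt_class K) (diag_value K l \<phi> d) (diag_value K l \<phi> e)"

locale diag_functor = dom: diag_category K UNIV UNIV + cod: diag_category K' Os B
  for K :: "('x, 'v) kind" and K' :: "('y, 'w) kind" and Os B +
  fixes l :: "'x \<Rightarrow> 'y" and \<phi> :: "'v \<Rightarrow> (('y, 'w) diag set \<Rightarrow>\<^sub>0 qring)"
  assumes letter_dual: "l (dual K x) = dual K' (l x)"
    and letters_Os: "map l a \<in> Os"
    and Cap_B: "Cap (l x) \<in> B"
    and Cup_B: "Cup (l x) \<in> B"
    and vertex_keys: "supp (\<phi> v) \<subseteq> cod.classes B (map l (vsrc K v)) (map l (vtgt K v))"
    and vertex_turns: "(d, e) \<in> turns K \<Longrightarrow> diag_value K' l \<phi> d = diag_value K' l \<phi> e"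
begin

abbreviation val where "val \<equiv> diag_value K' l \<phi>"

lemma keys_val:
  "wf_diag K d \<Longrightarrow> supp (val d) \<subseteq> cod.classes B (map l (src K d)) (map l (tgt K d))"
proof (induction d)
  case (Strands a)
  then show ?case using cod.iclass_classes[of "Strands (map l a)"] cod.B_strands letters_Os by simp
next
  case (Cap x)
  then show ?case using cod.iclass_classes[of "Cap (l x)"] Cap_B by (simp add: letter_dual)
next
  case (Cup x)
  then show ?case using cod.iclass_classes[of "Cup (l x)"] Cup_B by (simp add: letter_dual)
next
  case (Vert v)
  then show ?case using vertex_keys by simp
next
  case (Stack d e)
  then show ?case using cod.keys_stack_lin[of "val e" _ _ "val d"] by simp
next
  case (Juxt d e)
  then show ?case using cod.keys_juxt_lin by simp
qed

text \<open>All rules other than \<open>turn\<close> hold for linear combinations in the target by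
  the laws proved above; \<open>turn\<close> is the hypothesis \<open>vertex_turns\<close>. This is
  what has to be verified when crossings are replaced by webs.\<close>

lemma val_isotopic: "isotopic K d e \<Longrightarrow> val d = val e"
proof (induction rule: isotopic.induct)
  case (stack_assoc d e f)
  then show ?case
    using cod.stack_lin_assoc[OF keys_val[of f], of "val e" "map l (tgt K e)" "val d" "map l (tgt K d)"]
      keys_val[of e] keys_val[of d] by simp
next
  case (stack_top d)
  then show ?case using cod.stack_lin_strands(1)[OF keys_val] by simp
next
  case (stack_bottom d)
  then show ?case using cod.stack_lin_strands(2)[OF keys_val] by simp
next
  case (juxt_assoc d e f)
  then show ?case
    using cod.juxt_lin_assoc[OF keys_val[of f], of "val e" "map l (src K e)" "map l (tgt K e)"
        "val d" "map l (src K d)" "map l (tgt K d)"] keys_val[of e] keys_val[of d] by simp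
next
  case (juxt_left d)
  then show ?case using cod.juxt_lin_strands(1)[OF keys_val] by simp
next
  case (juxt_right d)
  then show ?case using cod.juxt_lin_strands(2)[OF keys_val] by simp
next
  case (strands a b)
  then show ?case using cod.iclass_eq[OF isotopic.strands] by (simp add: cod.juxt_lin_single)
next
  case (interchange d e d' e')
  then show ?case
    using cod.lin_interchange[OF keys_val[of e] _ keys_val[of e'], of "val d" "map l (tgt K d)"
        "val d'" "map l (tgt K d')"] keys_val[of d] keys_val[of d'] by simp
next
  case (zigzag_left x)
  then show ?case using cod.iclass_eq[OF isotopic.zigzag_left, of "l x"]
    by (simp add: cod.juxt_lin_single cod.stack_lin_single letter_dual cod.dual_dual)
next
  case (zigzag_right x)
  then show ?case using cod.iclass_eq[OF isotopic.zigzag_right, of "l x"]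
    by (simp add: cod.juxt_lin_single cod.stack_lin_single letter_dual cod.dual_dual)
qed (use vertex_turns in auto)

text \<open>\<open>SOME\<close> picks a diagram in the isotopy class, harmless by
  \<open>val_isotopic\<close>.\<close>

definition lin_val :: "(('x, 'v) diag set \<Rightarrow>\<^sub>0 qring) \<Rightarrow> (('y, 'w) diag set \<Rightarrow>\<^sub>0 qring)" where
  "lin_val = linear_ext (\<lambda>A. val (SOME d. d \<in> A))"

lemma val_some: "wf_diag K d \<Longrightarrow> val (SOME e. e \<in> iclass K d) = val d"
  using val_isotopic[of d "SOME e. e \<in> iclass K d"] someI[of "\<lambda>e. e \<in> iclass K d", OF dom.iclass_self]
  by (simp add: iclass_def)

lemma lin_val_single: "wf_diag K d \<Longrightarrow> lin_val (single (iclass K d) r) = smult r (val d)"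
  by (simp add: lin_val_def linear_ext_single val_some)

lemma additive_lin_val: "additive \<psi> \<Longrightarrow> additive (\<lambda>f. lin_val (\<psi> f))"
  using additive_linear_ext unfolding lin_val_def additive_def by metis

lemma keys_lin_val:
  "supp f \<subseteq> dom.classes UNIV a b \<Longrightarrow> supp (lin_val f) \<subseteq> cod.classes B (map l a) (map l b)"
  unfolding lin_val_def linear_ext_def
proof (intro keys_sum_subset order_trans[OF keys_smult])
  fix A assume "supp f \<subseteq> dom.classes UNIV a b" "A \<in> supp f"
  then obtain d where "A = iclass K d" "wf_diag K d" "src K d = a" "tgt K d = b"
    by (auto simp: dom.classes_def)
  then show "supp (val (SOME d. d \<in> A)) \<subseteq> cod.classes B (map l a) (map l b)"
    using keys_val by (auto simp: val_some)
qed

lemma lin_val_stack: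
  assumes f: "supp f \<subseteq> dom.classes UNIV a b" and g: "supp g \<subseteq> dom.classes UNIV b c"
  shows "lin_val (dom.stack_lin g f) = cod.stack_lin (lin_val g) (lin_val f)"
  apply (rule additive_eqI[OF _ _ f, of "\<lambda>f. lin_val (dom.stack_lin g f)"], (intro additive_lin_val additive_bilinear_ext)+)
  apply (rule additive_eqI[OF _ _ g, of "\<lambda>g. lin_val (dom.stack_lin g _)"], (intro additive_lin_val additive_bilinear_ext)+)
  by (auto simp: dom.classes_def dom.stack_lin_single lin_val_single bilinear_ext_smult smult_smult mult.commute)

lemma lin_val_juxt:
  assumes f: "supp f \<subseteq> dom.classes UNIV a b" and g: "supp g \<subseteq> dom.classes UNIV c d"
  shows "lin_val (dom.juxt_lin g f) = cod.juxt_lin (lin_val g) (lin_val f)"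
  apply (rule additive_eqI[OF _ _ f, of "\<lambda>f. lin_val (dom.juxt_lin g f)"], (intro additive_lin_val additive_bilinear_ext)+)
  apply (rule additive_eqI[OF _ _ g, of "\<lambda>g. lin_val (dom.juxt_lin g _)"], (intro additive_lin_val additive_bilinear_ext)+)
  by (auto simp: dom.classes_def dom.juxt_lin_single lin_val_single bilinear_ext_smult smult_smult mult.commute)

definition dfunctor :: "('x, ('x, 'v) lin, 'y, ('y, 'w) lin) func" where
  "dfunctor = \<lparr>fobj = map l, fmor = restrict (\<lambda>(a, b, f). (map l a, map l b, lin_val f)) (Mor dom.D)\<rparr>"

lemma dfunctor_apply:
  "(a, b, f) \<in> Hom dom.D a b \<Longrightarrow> fmor dfunctor (a, b, f) = (map l a, map l b, lin_val f)"
  using dom.MorI[of "(a, b, f)" a b] by (simp add: dfunctor_def)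

lemma dfunctor_lin_diag:
  "wf_diag K d \<Longrightarrow> fmor dfunctor (lin_diag K d) = (map l (src K d), map l (tgt K d), val d)"
  using dom.lin_diag_Hom[of d] dfunctor_apply
  by (simp add: lin_diag_def lin_comb_def lin_val_single smult_one)

lemma lin_val_add: "lin_val (f + g) = lin_val f + lin_val g"
  by (simp add: lin_val_def linear_ext_add)

lemma lin_val_smult: "lin_val (smult r f) = smult r (lin_val f)"
  by (simp add: lin_val_def linear_ext_smult)

lemma dfunctor_linear: "linear_monoidal_functor dom.D cod.D dfunctor"
  unfolding linear_monoidal_functor_def
proof (intro conjI ballI allI)
  have o: "fobj dfunctor = map l" by (simp add: dfunctor_def)
  have H: "fmor dfunctor F \<in> Hom cod.D (map l a) (map l b)" if "F \<in> Hom dom.D a b" for F a b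
    using that dfunctor_apply[of a b] keys_lin_val letters_Os
    by (auto simp: dom.diag_cat_Hom cod.diag_cat_Hom)
  fix F G a b c r
  show "fobj dfunctor \<in> Obj dom.D \<rightarrow>\<^sub>E Obj cod.D"
    by (simp add: o dom.diag_cat_simps cod.diag_cat_simps letters_Os PiE_iff)
  show "fmor dfunctor \<in> extensional (Mor dom.D)" by (simp add: dfunctor_def)
  show "F \<in> Hom dom.D a b \<Longrightarrow> fmor dfunctor F \<in> Hom cod.D (fobj dfunctor a) (fobj dfunctor b)"
    using H by (simp add: o)
  show "fmor dfunctor (idm dom.D a) = idm cod.D (fobj dfunctor a)"
    by (simp add: o dom.diag_cat_simps cod.diag_cat_simps dfunctor_lin_diag)
      (simp add: lin_diag_def lin_comb_def)
  show "fmor dfunctor (cmp dom.D G F) = cmp cod.D (fmor dfunctor G) (fmor dfunctor F)"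
    if "F \<in> Hom dom.D a b" "G \<in> Hom dom.D b c"
    using that dom.cmp_Hom[OF that]
    by (auto simp: dom.diag_cat_Hom dom.diag_cat_simps cod.diag_cat_simps dfunctor_apply lin_val_stack)
  show "fmor dfunctor (lcat.add dom.D F G) = lcat.add cod.D (fmor dfunctor F) (fmor dfunctor G)"
    if "F \<in> Hom dom.D a b" "G \<in> Hom dom.D a b"
    using that dom.add_Hom[OF that]
    by (auto simp: dom.diag_cat_Hom dom.diag_cat_simps cod.diag_cat_simps dfunctor_apply lin_val_add)
  show "fmor dfunctor (scl dom.D r F) = scl cod.D r (fmor dfunctor F)" if M: "F \<in> Mor dom.D"
  proof -
    obtain a b where F: "F \<in> Hom dom.D a b" using M dom.Mor_iff by blast
    show ?thesis using F dom.scl_Hom[OF F]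
      by (auto simp: dom.diag_cat_Hom dom.diag_cat_simps cod.diag_cat_simps dfunctor_apply lin_val_smult)
  qed
  show "fobj dfunctor [] = []" "fobj dfunctor (a @ b) = fobj dfunctor a @ fobj dfunctor b" by (simp_all add: o)
  show "fmor dfunctor (tns dom.D F G) = tns cod.D (fmor dfunctor F) (fmor dfunctor G)"
    if M: "F \<in> Mor dom.D" "G \<in> Mor dom.D"
  proof -
    obtain a b where F: "F \<in> Hom dom.D a b" using M dom.Mor_iff by blast
    obtain c d where G: "G \<in> Hom dom.D c d" using M dom.Mor_iff by blast
    show ?thesis using F G dom.tns_Hom[OF F G]
      by (auto simp: dom.diag_cat_Hom dom.diag_cat_simps cod.diag_cat_simps dfunctor_apply lin_val_juxt)
  qed
qed

lemma dfunctor_obj: "fobj dfunctor = map l"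
  by (simp add: dfunctor_def)

text \<open>\<open>ev\<close> and \<open>coev\<close> of a sequence are nested caps and cups, and
  the nests correspond because \<open>l\<close> respects duals letter by letter. This gives the
  rigidity of the functor.\<close>

lemma val_caps: "val (caps (dual K) a) = single (iclass K' (caps (dual K') (map l a))) 1"
  using wf_caps[of K'] by (induction a) (simp_all add: cod.juxt_lin_single cod.stack_lin_single letter_dual dual_obj_def)

lemma val_cups: "val (cups (dual K) a) = single (iclass K' (cups (dual K') (map l a))) 1"
  using wf_cups[of K'] by (induction a) (simp_all add: cod.juxt_lin_single cod.stack_lin_single letter_dual dual_obj_def)

end

section \<open>Functors are determined by caps, cups and vertices\<close>

lemma (in diag_kind) diag_cat_UNIV: "diag_category K UNIV UNIV"
  by unfold_locales simp_all

text \<open>Agreement is demanded only at the vertices that occur in \<open>d\<close>. For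
  uniqueness the two functors are known at first to agree on half of the crossings, and this lemma
  is applied to a diagram containing only such a crossing.\<close>

lemma (in diag_kind) diag_functors_agree:
  assumes F: "linear_monoidal_functor (diag_cat K UNIV UNIV) E F"
    and G: "linear_monoidal_functor (diag_cat K UNIV UNIV) E G"
    and obj: "\<And>a. fobj F a = fobj G a"
    and Cap: "\<And>x. fmor F (lin_diag K (Cap x)) = fmor G (lin_diag K (Cap x))"
    and Cup: "\<And>x. fmor F (lin_diag K (Cup x)) = fmor G (lin_diag K (Cup x))"
  shows "wf_diag K d \<Longrightarrow>
    (\<And>v. v \<in> set2_diag d \<Longrightarrow> fmor F (lin_diag K (Vert v)) = fmor G (lin_diag K (Vert v))) \<Longrightarrow>
    fmor F (lin_diag K d) = fmor G (lin_diag K d)"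
proof (induction d)
  interpret D: diag_category K UNIV UNIV by (rule diag_cat_UNIV)
  note FD = linear_functorD[OF F] and GD = linear_functorD[OF G]
  have O: "Obj D.D = UNIV" by (simp add: D.diag_cat_simps)
  have H: "lin_diag K d \<in> Hom D.D (src K d) (tgt K d)" if "wf_diag K d" for d
    using D.lin_diag_Hom that by simp
  {
    case (Strands a)
    then show ?case using FD(3)[of a] GD(3)[of a] by (simp add: D.diag_cat_simps obj)
  next
    case (Stack d e)
    then have "lin_diag K d \<in> Hom D.D (tgt K e) (tgt K d)" "lin_diag K e \<in> Hom D.D (src K e) (tgt K e)"
      using H[of d] H[of e] by auto
    then show ?case
      using Stack FD(4)[of "src K e" "tgt K e" "tgt K d"] GD(4)[of "src K e" "tgt K e" "tgt K d"]
      by (simp add: D.lin_diag_stack[symmetric] O)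
  next
    case (Juxt d e)
    then have "lin_diag K d \<in> Mor D.D" "lin_diag K e \<in> Mor D.D"
      using D.MorI[OF H] by auto
    then show ?case using Juxt FD(9) GD(9) by (simp add: D.lin_diag_juxt[symmetric])
  }
qed (use Cap Cup in simp_all)

text \<open>Every morphism is a finite sum of multiples of diagrams; the induction runs over partial
  sums inside one Hom set.\<close>

lemma (in diag_kind) diag_functors_eqI:
  assumes E: "linear_tensor_cat E"
    and F: "linear_monoidal_functor (diag_cat K UNIV UNIV) E F"
    and G: "linear_monoidal_functor (diag_cat K UNIV UNIV) E G"
    and obj: "\<And>a. fobj F a = fobj G a"
    and Cap: "\<And>x. fmor F (lin_diag K (Cap x)) = fmor G (lin_diag K (Cap x))"
    and Cup: "\<And>x. fmor F (lin_diag K (Cup x)) = fmor G (lin_diag K (Cup x))"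
    and Vert: "\<And>v. fmor F (lin_diag K (Vert v)) = fmor G (lin_diag K (Vert v))"
    and f: "f \<in> Mor (diag_cat K UNIV UNIV)"
  shows "fmor F f = fmor G f"
proof -
  interpret E: linear_tensor_cat E by (rule E)
  interpret D: diag_category K UNIV UNIV by (rule diag_cat_UNIV)
  note FD = linear_functorD[OF F] and GD = linear_functorD[OF G]
  have O: "Obj D.D = UNIV" by (simp add: D.diag_cat_simps)
  have H: "lin_diag K d \<in> Hom D.D (src K d) (tgt K d)" if "wf_diag K d" for d
    using D.lin_diag_Hom that by simp
  have agree: "wf_diag K d \<Longrightarrow> fmor F (lin_diag K d) = fmor G (lin_diag K d)" for d
    by (rule diag_functors_agree[OF F G obj Cap Cup _ Vert])
  have sums: "finite A \<Longrightarrow> A \<subseteq> classes UNIV a b \<Longrightarrow>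
      fmor F (a, b, \<Sum>x\<in>A. single x (c x)) = fmor G (a, b, \<Sum>x\<in>A. single x (c x))"
    for A a b c
  proof (induction A rule: finite_induct)
    case empty
    have z: "(a, b, 0) \<in> Hom D.D a b" by (simp add: D.diag_cat_Hom)
    \<comment> \<open>The zero morphism is its own multiple by 0, so both functors send it to the
      zero of the same Hom set.\<close>
    have "scl D.D 0 (a, b, 0) = (a, b, 0)" by (simp add: D.diag_cat_simps smult_zero)
    then have "fmor F (a, b, 0) = scl E 0 (fmor F (a, b, 0))" "fmor G (a, b, 0) = scl E 0 (fmor G (a, b, 0))"
      using FD(6)[OF D.MorI[OF z]] GD(6)[OF D.MorI[OF z]] by metis+
    moreover have "fmor F (a, b, 0) \<in> Hom E (fobj F a) (fobj F b)" "fmor G (a, b, 0) \<in> Hom E (fobj F a) (fobj F b)"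
      using FD(2)[OF _ _ z] GD(2)[OF _ _ z] O obj by auto
    ultimately show ?case
      using E.scl_zero_eq[of "fmor F (a, b, 0)" "fobj F a" "fobj F b" "fmor G (a, b, 0)"] by simp
  next
    case (insert x A)
    obtain d where d: "x = iclass K d" "wf_diag K d" "src K d = a" "tgt K d = b"
      using insert.prems by (auto simp: classes_def)
    let ?s = "(a, b, \<Sum>x\<in>A. single x (c x))"
    have 1: "?s \<in> Hom D.D a b"
      using insert.prems by (auto simp: D.diag_cat_Hom intro!: keys_sum_subset split: if_splits)
    have 2: "scl D.D (c x) (lin_diag K d) \<in> Hom D.D a b" "lin_diag K d \<in> Mor D.D"
      using H[OF d(2)] D.scl_Hom D.MorI d by auto
    have 3: "(a, b, \<Sum>x\<in>insert x A. single x (c x)) = lcat.add D.D (scl D.D (c x) (lin_diag K d)) ?s"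
      using insert.hyps d by (simp add: lin_diag_def lin_comb_def D.diag_cat_simps smult_single)
    show ?case unfolding 3 using insert 1 2 agree[OF d(2)] O FD(5)[OF _ _ 2(1) 1] GD(5)[OF _ _ 2(1) 1]
        FD(6)[OF 2(2)] GD(6)[OF 2(2)] by simp
  qed
  obtain a b f' where f': "f = (a, b, f')" "supp f' \<subseteq> classes UNIV a b"
    using f D.Mor_iff D.diag_cat_Hom by auto
  show ?thesis unfolding f'(1) using sums[OF finite_keys f'(2), of "lookup f'"]
    by (simp flip: poly_mapping_sum_singles)
qed

section \<open>Composites of functors and the projection to a quotient\<close>

lemma func_comp_linear:
  assumes C: "linear_tensor_cat C" and D: "linear_tensor_cat D"
    and F: "linear_monoidal_functor C D F" and G: "linear_monoidal_functor D E G"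
    and O: "[] \<in> Obj C" "\<And>a b. a \<in> Obj C \<Longrightarrow> b \<in> Obj C \<Longrightarrow> a @ b \<in> Obj C"
  shows "linear_monoidal_functor C E (func_comp C G F)"
proof -
  interpret C: linear_tensor_cat C by (rule C)
  interpret D: linear_tensor_cat D by (rule D)
  note FD = linear_functorD[OF F] and GD = linear_functorD[OF G]
  let ?H = "func_comp C G F"
  have o: "fobj ?H a = fobj G (fobj F a)" if "a \<in> Obj C" for a
    using that by (simp add: func_comp_def)
  have m: "fmor ?H f = fmor G (fmor F f)" if "f \<in> Hom C a b" for f a b
    using that C.MorI by (simp add: func_comp_def)
  have F2: "fmor F f \<in> Hom D (fobj F a) (fobj F b)" if "f \<in> Hom C a b" for f a b
    using FD(2) that C.Hom_Obj by blast
  show ?thesis unfolding linear_monoidal_functor_def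
  proof (intro conjI ballI allI)
    show "fobj ?H \<in> Obj C \<rightarrow>\<^sub>E Obj E" using FD(1) GD(1) by (auto simp: func_comp_def PiE_iff)
    show "fmor ?H \<in> extensional (Mor C)" by (simp add: func_comp_def)
    show "fobj ?H [] = []" using O o FD(7) GD(7) by simp
    fix a b assume ab: "a \<in> Obj C" "b \<in> Obj C"
    show "fobj ?H (a @ b) = fobj ?H a @ fobj ?H b" using ab O o FD(1,8) GD(8) by simp
    show "fmor ?H (idm C a) = idm E (fobj ?H a)"
      using ab m[OF C.idm_Hom] o FD(1,3) GD(3) by simp
    fix f assume f: "f \<in> Hom C a b"
    show "fmor ?H f \<in> Hom E (fobj ?H a) (fobj ?H b)" using ab f m o F2 GD(2) FD(1) by simp
    show "fmor ?H (lcat.add C f g) = lcat.add E (fmor ?H f) (fmor ?H g)" if g: "g \<in> Hom C a b" for g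
      using m[OF C.add_Hom[OF f g]] m[OF f] m[OF g] FD(5)[OF ab f g] GD(5)[OF _ _ F2[OF f] F2[OF g]] FD(1) ab
      by simp
    show "fmor ?H (cmp C g f) = cmp E (fmor ?H g) (fmor ?H f)" if c: "c \<in> Obj C" and g: "g \<in> Hom C b c" for c g
      using m[OF C.cmp_Hom[OF f g]] m[OF f] m[OF g] FD(4)[OF ab c f g] GD(4)[OF _ _ _ F2[OF f] F2[OF g]] FD(1) ab c
      by simp
  next
    fix f r assume "f \<in> Mor C"
    then obtain a b where f: "f \<in> Hom C a b" using C.Mor_iff by blast
    show "fmor ?H (scl C r f) = scl E r (fmor ?H f)"
      using m[OF C.scl_Hom[OF f]] m[OF f] FD(6)[OF C.MorI[OF f]] GD(6)[OF D.MorI[OF F2[OF f]]] by simp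
  next
    fix f g assume "f \<in> Mor C" "g \<in> Mor C"
    then obtain a b c d where f: "f \<in> Hom C a b" and g: "g \<in> Hom C c d" using C.Mor_iff by metis
    show "fmor ?H (tns C f g) = tns E (fmor ?H f) (fmor ?H g)"
      using m[OF C.tns_Hom[OF f g]] m[OF f] m[OF g] FD(9)[OF C.MorI[OF f] C.MorI[OF g]]
        GD(9)[OF D.MorI[OF F2[OF f]] D.MorI[OF F2[OF g]]] by simp
  qed
qed

lemma (in tensor_ideal_of) quotient_functor_linear:
  assumes O: "[] \<in> Obj C" "\<And>a b. a \<in> Obj C \<Longrightarrow> b \<in> Obj C \<Longrightarrow> a @ b \<in> Obj C"
  shows "linear_monoidal_functor C Q (quotient_functor C I)"
proof -
  let ?H = "quotient_functor C I"
  have o: "fobj ?H a = a" if "a \<in> Obj C" for a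
    using that by (simp add: quotient_functor_def)
  have m: "fmor ?H f = coset C I f" if "f \<in> Hom C a b" for f a b
    using that MorI by (simp add: quotient_functor_def)
  show ?thesis unfolding linear_monoidal_functor_def
  proof (intro conjI ballI allI)
    show "fobj ?H \<in> Obj C \<rightarrow>\<^sub>E Obj Q" by (auto simp: quotient_functor_def quotient_simps)
    show "fmor ?H \<in> extensional (Mor C)" by (simp add: quotient_functor_def)
    show "fobj ?H [] = []" using O o by simp
    fix a b assume ab: "a \<in> Obj C" "b \<in> Obj C"
    show "fobj ?H (a @ b) = fobj ?H a @ fobj ?H b" using ab O o by simp
    show "fmor ?H (idm C a) = idm Q (fobj ?H a)"
      using ab m[OF idm_Hom] o by (simp add: quotient_simps)
    fix f assume f: "f \<in> Hom C a b"
    show "fmor ?H f \<in> Hom Q (fobj ?H a) (fobj ?H b)" using ab f m o coset_Hom by simp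
    show "fmor ?H (lcat.add C f g) = lcat.add Q (fmor ?H f) (fmor ?H g)" if g: "g \<in> Hom C a b" for g
      using m[OF add_Hom[OF f g]] m[OF f] m[OF g] quotient_add[OF g f] by simp
    show "fmor ?H (cmp C g f) = cmp Q (fmor ?H g) (fmor ?H f)" if g: "g \<in> Hom C b c" for c g
      using m[OF cmp_Hom[OF f g]] m[OF f] m[OF g] quotient_cmp[OF f g] by simp
  next
    fix f r assume "f \<in> Mor C"
    then obtain a b where f: "f \<in> Hom C a b" using Mor_iff by blast
    show "fmor ?H (scl C r f) = scl Q r (fmor ?H f)"
      using m[OF scl_Hom[OF f]] m[OF f] quotient_scl[OF f] by simp
  next
    fix f g assume "f \<in> Mor C" "g \<in> Mor C"
    then obtain a b c d where f: "f \<in> Hom C a b" and g: "g \<in> Hom C c d" using Mor_iff by metis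
    show "fmor ?H (tns C f g) = tns Q (fmor ?H f) (fmor ?H g)"
      using m[OF tns_Hom[OF f g]] m[OF f] m[OF g] quotient_tns[OF g f] by simp
  qed
qed

section \<open>Deciding isotopies by layers\<close>

context diag_kind
begin

lemma src_tgt: "isotopic K d e \<Longrightarrow> src K e = src K d" "isotopic K d e \<Longrightarrow> tgt K e = tgt K d"
  using isotopic_wf by auto

lemmas [trans] = isotopic.trans

lemma juxt_cong_left: "wf_diag K e \<Longrightarrow> isotopic K d d' \<Longrightarrow> isotopic K (d \<otimes> e) (d' \<otimes> e)"
  by (intro isotopic.juxt isotopic.refl)

lemma juxt_cong_right: "wf_diag K d \<Longrightarrow> isotopic K e e' \<Longrightarrow> isotopic K (d \<otimes> e) (d \<otimes> e')"
  by (intro isotopic.juxt isotopic.refl)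

lemma stack_cong_left: "wf_diag K (d \<cdot> e) \<Longrightarrow> isotopic K d d' \<Longrightarrow> isotopic K (d \<cdot> e) (d' \<cdot> e)"
  by (intro isotopic.stack isotopic.refl) auto

lemma stack_cong_right: "wf_diag K (d \<cdot> e) \<Longrightarrow> isotopic K e e' \<Longrightarrow> isotopic K (d \<cdot> e) (d \<cdot> e')"
  by (intro isotopic.stack isotopic.refl) auto

lemma whisker_left:
  assumes "wf_diag K (d \<cdot> e)"
  shows "isotopic K ((Strands a \<otimes> d) \<cdot> (Strands a \<otimes> e)) (Strands a \<otimes> (d \<cdot> e))"
proof -
  have "isotopic K ((Strands a \<otimes> d) \<cdot> (Strands a \<otimes> e)) ((Strands a \<cdot> Strands a) \<otimes> (d \<cdot> e))"
    using assms by (intro isotopic.sym[OF isotopic.interchange]) auto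
  also have "isotopic K \<dots> (Strands a \<otimes> (d \<cdot> e))"
    using assms isotopic.stack_top[of K "Strands a"] by (intro juxt_cong_left) auto
  finally show ?thesis .
qed

lemma whisker_right:
  assumes "wf_diag K (d \<cdot> e)"
  shows "isotopic K ((d \<otimes> Strands a) \<cdot> (e \<otimes> Strands a)) ((d \<cdot> e) \<otimes> Strands a)"
proof -
  have "isotopic K ((d \<otimes> Strands a) \<cdot> (e \<otimes> Strands a)) ((d \<cdot> e) \<otimes> (Strands a \<cdot> Strands a))"
    using assms by (intro isotopic.sym[OF isotopic.interchange]) auto
  also have "isotopic K \<dots> ((d \<cdot> e) \<otimes> Strands a)"
    using assms isotopic.stack_top[of K "Strands a"] by (intro juxt_cong_right) auto
  finally show ?thesis .
qed

lemma stack_left_right: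
  assumes "wf_diag K d" "wf_diag K e" "e' = Strands (tgt K e)" "d' = Strands (src K d)"
  shows "isotopic K ((d \<otimes> e') \<cdot> (d' \<otimes> e)) (d \<otimes> e)"
proof -
  have "isotopic K ((d \<otimes> e') \<cdot> (d' \<otimes> e)) ((d \<cdot> d') \<otimes> (e' \<cdot> e))"
    using assms by (intro isotopic.sym[OF isotopic.interchange]) auto
  also have "isotopic K \<dots> (d \<otimes> e)"
    unfolding assms(3,4) using assms(1,2) by (intro isotopic.juxt isotopic.stack_top isotopic.stack_bottom)
  finally show ?thesis .
qed

lemma stack_right_left:
  assumes "wf_diag K d" "wf_diag K e" "e' = Strands (src K e)" "d' = Strands (tgt K d)"
  shows "isotopic K ((d' \<otimes> e) \<cdot> (d \<otimes> e')) (d \<otimes> e)"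
proof -
  have "isotopic K ((d' \<otimes> e) \<cdot> (d \<otimes> e')) ((d' \<cdot> d) \<otimes> (e \<cdot> e'))"
    using assms by (intro isotopic.sym[OF isotopic.interchange]) auto
  also have "isotopic K \<dots> (d \<otimes> e)"
    unfolding assms(3,4) using assms(1,2) by (intro isotopic.juxt isotopic.stack_top isotopic.stack_bottom)
  finally show ?thesis .
qed

lemma split_strands: "wf_diag K e \<Longrightarrow> isotopic K (Strands (a @ b) \<otimes> e) (Strands a \<otimes> Strands b \<otimes> e)"
  using isotopic.trans[OF juxt_cong_left[OF _ isotopic.sym[OF isotopic.strands]] isotopic.juxt_assoc] by simp

text \<open>Both relative heights of two pieces separated by the strands \<open>c\<close> are
  isotopic to the same flat juxtaposition. Together with \<open>distant_lower_left\<close> this lets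
  the pieces slide past each other.\<close>

lemma distant_upper_left:
  assumes g: "wf_diag K g" and h: "wf_diag K h"
  shows "isotopic K ((Strands a \<otimes> g \<otimes> Strands (c @ tgt K h @ b)) \<cdot> (Strands (a @ src K g @ c) \<otimes> h \<otimes> Strands b))
    (Strands a \<otimes> g \<otimes> Strands c \<otimes> h \<otimes> Strands b)" (is "isotopic K (?u \<cdot> ?l) _")
proof -
  have u: "isotopic K ?u (Strands a \<otimes> g \<otimes> Strands c \<otimes> Strands (tgt K h @ b))"
    using g by (intro juxt_cong_right isotopic.sym[OF isotopic.strands]) auto
  have "isotopic K ?l (Strands a \<otimes> Strands (src K g @ c) \<otimes> h \<otimes> Strands b)"
    using h by (intro split_strands) auto
  also have "isotopic K \<dots> (Strands a \<otimes> Strands (src K g) \<otimes> Strands c \<otimes> h \<otimes> Strands b)"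
    using h by (intro juxt_cong_right split_strands) auto
  finally have l: "isotopic K ?l (Strands a \<otimes> Strands (src K g) \<otimes> Strands c \<otimes> h \<otimes> Strands b)" .
  have "isotopic K (?u \<cdot> ?l) ((Strands a \<otimes> g \<otimes> Strands c \<otimes> Strands (tgt K h @ b)) \<cdot>
      (Strands a \<otimes> Strands (src K g) \<otimes> Strands c \<otimes> h \<otimes> Strands b))"
    using u l by (intro isotopic.stack) auto
  also have "isotopic K \<dots> (Strands a \<otimes> ((g \<otimes> Strands c \<otimes> Strands (tgt K h @ b)) \<cdot>
      (Strands (src K g) \<otimes> Strands c \<otimes> h \<otimes> Strands b)))"
    using g h by (intro whisker_left) auto
  also have "isotopic K \<dots> (Strands a \<otimes> ((g \<otimes> Strands (c @ tgt K h @ b)) \<cdot>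
      (Strands (src K g) \<otimes> Strands c \<otimes> h \<otimes> Strands b)))"
    using g h by (intro juxt_cong_right stack_cong_left isotopic.strands) auto
  also have "isotopic K \<dots> (Strands a \<otimes> g \<otimes> Strands c \<otimes> h \<otimes> Strands b)"
    using g h by (intro juxt_cong_right stack_left_right) auto
  finally show ?thesis .
qed

lemma distant_lower_left:
  assumes g: "wf_diag K g" and h: "wf_diag K h"
  shows "isotopic K ((Strands (a @ tgt K g @ c) \<otimes> h \<otimes> Strands b) \<cdot> (Strands a \<otimes> g \<otimes> Strands (c @ src K h @ b)))
    (Strands a \<otimes> g \<otimes> Strands c \<otimes> h \<otimes> Strands b)" (is "isotopic K (?u \<cdot> ?l) _")
proof -
  have l: "isotopic K ?l (Strands a \<otimes> g \<otimes> Strands c \<otimes> Strands (src K h @ b))"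
    using g by (intro juxt_cong_right isotopic.sym[OF isotopic.strands]) auto
  have "isotopic K ?u (Strands a \<otimes> Strands (tgt K g @ c) \<otimes> h \<otimes> Strands b)"
    using h by (intro split_strands) auto
  also have "isotopic K \<dots> (Strands a \<otimes> Strands (tgt K g) \<otimes> Strands c \<otimes> h \<otimes> Strands b)"
    using h by (intro juxt_cong_right split_strands) auto
  finally have u: "isotopic K ?u (Strands a \<otimes> Strands (tgt K g) \<otimes> Strands c \<otimes> h \<otimes> Strands b)" .
  have "isotopic K (?u \<cdot> ?l) ((Strands a \<otimes> Strands (tgt K g) \<otimes> Strands c \<otimes> h \<otimes> Strands b) \<cdot>
      (Strands a \<otimes> g \<otimes> Strands c \<otimes> Strands (src K h @ b)))"
    using u l by (intro isotopic.stack) auto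
  also have "isotopic K \<dots> (Strands a \<otimes> ((Strands (tgt K g) \<otimes> Strands c \<otimes> h \<otimes> Strands b) \<cdot>
      (g \<otimes> Strands c \<otimes> Strands (src K h @ b))))"
    using g h by (intro whisker_left) auto
  also have "isotopic K \<dots> (Strands a \<otimes> ((Strands (tgt K g) \<otimes> Strands c \<otimes> h \<otimes> Strands b) \<cdot>
      (g \<otimes> Strands (c @ src K h @ b))))"
    using g h by (intro juxt_cong_right stack_cong_right isotopic.strands) auto
  also have "isotopic K \<dots> (Strands a \<otimes> g \<otimes> Strands c \<otimes> h \<otimes> Strands b)"
    using g h by (intro juxt_cong_right stack_right_left) auto
  finally show ?thesis .
qed

text \<open>Cancels a zigzag between further strands. In the layers \<open>u\<close> and
  \<open>l\<close> the vertical strand of the zigzag is counted among the strands beside it, so they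
  match the zigzag only up to \<open>absorb_left\<close> and \<open>absorb_right\<close>.\<close>

lemma whisker_both:
  assumes d: "isotopic K (d \<cdot> e) (Strands c)" "wf_diag K (d \<cdot> e)"
    and u: "isotopic K u (Strands a \<otimes> d \<otimes> Strands b)" and l: "isotopic K l (Strands a \<otimes> e \<otimes> Strands b)"
  shows "isotopic K (u \<cdot> l) (Strands (a @ c @ b))"
proof -
  have "isotopic K (u \<cdot> l) ((Strands a \<otimes> d \<otimes> Strands b) \<cdot> (Strands a \<otimes> e \<otimes> Strands b))"
    using u l d(2) src_tgt[OF u] src_tgt[OF l] by (intro isotopic.stack) auto
  also have "isotopic K \<dots> (Strands a \<otimes> ((d \<otimes> Strands b) \<cdot> (e \<otimes> Strands b)))"
    using d(2) by (intro whisker_left) auto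
  also have "isotopic K \<dots> (Strands a \<otimes> ((d \<cdot> e) \<otimes> Strands b))"
    using d(2) by (intro juxt_cong_right whisker_right) auto
  also have "isotopic K \<dots> (Strands a \<otimes> (Strands c \<otimes> Strands b))"
    using d(1) by (intro juxt_cong_right juxt_cong_left) auto
  also have "isotopic K \<dots> (Strands a \<otimes> Strands (c @ b))"
    by (intro juxt_cong_right isotopic.strands) auto
  also have "isotopic K \<dots> (Strands (a @ c @ b))" by (rule isotopic.strands)
  finally show ?thesis .
qed

lemma absorb_right:
  assumes "wf_diag K g"
  shows "isotopic K (Strands a \<otimes> g \<otimes> Strands (c @ b)) (Strands a \<otimes> (g \<otimes> Strands c) \<otimes> Strands b)"
proof (intro juxt_cong_right)
  have "isotopic K (g \<otimes> Strands (c @ b)) (g \<otimes> Strands c \<otimes> Strands b)"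
    using assms by (intro juxt_cong_right isotopic.sym[OF isotopic.strands])
  also have "isotopic K \<dots> ((g \<otimes> Strands c) \<otimes> Strands b)"
    using assms by (intro isotopic.sym[OF isotopic.juxt_assoc]) auto
  finally show "isotopic K (g \<otimes> Strands (c @ b)) ((g \<otimes> Strands c) \<otimes> Strands b)" .
qed simp

lemma absorb_left:
  assumes "wf_diag K g"
  shows "isotopic K (Strands (a @ c) \<otimes> g \<otimes> Strands b) (Strands a \<otimes> (Strands c \<otimes> g) \<otimes> Strands b)"
proof -
  have "isotopic K (Strands (a @ c) \<otimes> g \<otimes> Strands b) (Strands a \<otimes> Strands c \<otimes> g \<otimes> Strands b)"
    using assms by (intro split_strands) auto
  also have "isotopic K \<dots> (Strands a \<otimes> (Strands c \<otimes> g) \<otimes> Strands b)"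
    using assms by (intro juxt_cong_right isotopic.sym[OF isotopic.juxt_assoc]) auto
  finally show ?thesis .
qed

lemma cancel_left:
  "isotopic K ((Strands a \<otimes> Cap x \<otimes> Strands (x # b)) \<cdot> (Strands (a @ [x]) \<otimes> Cup (dual K x) \<otimes> Strands b))
     (Strands (a @ x # b))"
  using whisker_both[OF isotopic.zigzag_left[of K x] _ absorb_right[of _ a "[x]" b] absorb_left[of _ a "[x]" b]]
  by (simp add: dual_dual)

lemma cancel_right:
  "isotopic K ((Strands (a @ [x]) \<otimes> Cap (dual K x) \<otimes> Strands b) \<cdot> (Strands a \<otimes> Cup x \<otimes> Strands (x # b)))
     (Strands (a @ x # b))"
  using whisker_both[OF isotopic.zigzag_right[of K x] _ absorb_left[of _ a "[x]" b] absorb_right[of _ a "[x]" b]]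
  by (simp add: dual_dual)

end

type_synonym ('x, 'v) layer = "'x list \<times> ('x, 'v) diag \<times> 'x list"

text \<open>Topmost layer first; each layer is a single cap, cup or vertex between vertical strands.\<close>

primrec layers :: "('x, 'v) kind \<Rightarrow> ('x, 'v) diag \<Rightarrow> ('x, 'v) layer list" where
  "layers K (Strands a) = []"
| "layers K (Cap x) = [([], Cap x, [])]"
| "layers K (Cup x) = [([], Cup x, [])]"
| "layers K (Vert v) = [([], Vert v, [])]"
| "layers K (d \<cdot> e) = layers K d @ layers K e"
| "layers K (d \<otimes> e) = map (\<lambda>(a, g, b). (a, g, b @ tgt K e)) (layers K d) @
     map (\<lambda>(a, g, b). (src K d @ a, g, b)) (layers K e)"

fun unlayer :: "'x list \<Rightarrow> ('x, 'v) layer list \<Rightarrow> ('x, 'v) diag" where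
  "unlayer c [] = Strands c"
| "unlayer c ((a, g, b) # L) = (Strands a \<otimes> g \<otimes> Strands b) \<cdot> unlayer c L"

text \<open>
  Interchanges two adjacent layers if one lies beside the other, and removes a cap above a cup that
  share exactly one strand. In a well-formed diagram the positions determine the labels, so that
  only lengths are compared.
\<close>

definition exchange :: "('x, 'v) kind \<Rightarrow> ('x, 'v) layer \<Rightarrow> ('x, 'v) layer \<Rightarrow> ('x, 'v) layer list" where
  "exchange K = (\<lambda>(a, g, b) (a', h, b').
     if length a + length (src K g) \<le> length a' then
       (let c = drop (length a + length (src K g)) a' in
        [(a @ tgt K g @ c, h, b'), (a, g, c @ src K h @ b')])
     else if length a' + length (tgt K h) \<le> length a then
       (let c = drop (length a' + length (tgt K h)) a in
        [(a', h, c @ tgt K g @ b), (a' @ src K h @ c, g, b)])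
     else if (\<exists>x. g = Cap x) \<and> (\<exists>x. h = Cup x) \<and> length a \<noteq> length a' then []
     else [(a, g, b), (a', h, b')])"

text \<open>The number counts layers from 0 at the top, so that a list of numbers records an
  isotopy. After a cancellation the numbers refer to the shorter list; a number out of range changes
  nothing.\<close>

fun move :: "('x, 'v) kind \<Rightarrow> nat \<Rightarrow> ('x, 'v) layer list \<Rightarrow> ('x, 'v) layer list" where
  "move K 0 (l # m # L) = exchange K l m @ L"
| "move K (Suc i) (l # L) = l # move K i L"
| "move K i L = L"

context diag_kind
begin

lemma src_unlayer: "wf_diag K (unlayer c L) \<Longrightarrow> src K (unlayer c L) = c"
  by (induction L) auto

lemma unlayer_append:
  "wf_diag K (unlayer (tgt K (unlayer c M)) L) \<Longrightarrow> wf_diag K (unlayer c M) \<Longrightarrow>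
     isotopic K (unlayer c (L @ M)) (unlayer (tgt K (unlayer c M)) L \<cdot> unlayer c M)"
proof (induction L)
  case Nil
  then show ?case by (auto intro: isotopic.sym[OF isotopic.stack_top])
next
  case (Cons l L)
  obtain a g b where l: "l = (a, g, b)" by (cases l) auto
  let ?c = "tgt K (unlayer c M)"
  have w: "wf_diag K (unlayer ?c L)" using Cons.prems by (simp add: l)
  note IH = Cons.IH[OF w Cons.prems(2)]
  have "isotopic K (unlayer c ((l # L) @ M)) ((Strands a \<otimes> g \<otimes> Strands b) \<cdot> (unlayer ?c L \<cdot> unlayer c M))"
    using Cons.prems IH src_tgt[OF IH] isotopic_wf[OF IH] by (auto simp: l intro!: stack_cong_right)
  also have "isotopic K \<dots> (unlayer ?c (l # L) \<cdot> unlayer c M)"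
    using Cons.prems src_unlayer[OF w] by (auto simp: l intro!: isotopic.sym[OF isotopic.stack_assoc])
  finally show ?case .
qed

lemma unlayer_whisker_right:
  "wf_diag K (unlayer c L) \<Longrightarrow>
     isotopic K (unlayer c L \<otimes> Strands r) (unlayer (c @ r) (map (\<lambda>(a, g, b). (a, g, b @ r)) L))"
proof (induction L)
  case Nil
  then show ?case by (simp add: isotopic.strands)
next
  case (Cons l L)
  obtain a g b where l: "l = (a, g, b)" by (cases l) auto
  let ?g = "Strands a \<otimes> g \<otimes> Strands b"
  have w: "wf_diag K (unlayer c L)" "wf_diag K g" using Cons.prems by (simp_all add: l)
  note IH = Cons.IH[OF w(1)]
  have g: "isotopic K (?g \<otimes> Strands r) (Strands a \<otimes> g \<otimes> Strands (b @ r))"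
  proof -
    have "isotopic K (?g \<otimes> Strands r) (Strands a \<otimes> (g \<otimes> Strands b) \<otimes> Strands r)"
      using w by (intro isotopic.juxt_assoc) auto
    also have "isotopic K \<dots> (Strands a \<otimes> g \<otimes> Strands b \<otimes> Strands r)"
      using w by (intro juxt_cong_right isotopic.juxt_assoc) auto
    also have "isotopic K \<dots> (Strands a \<otimes> g \<otimes> Strands (b @ r))"
      using w by (intro juxt_cong_right isotopic.strands) auto
    finally show ?thesis .
  qed
  have "isotopic K (unlayer c (l # L) \<otimes> Strands r) ((?g \<otimes> Strands r) \<cdot> (unlayer c L \<otimes> Strands r))"
    using Cons.prems by (auto simp: l intro!: isotopic.sym[OF whisker_right])
  also have "isotopic K \<dots> ((Strands a \<otimes> g \<otimes> Strands (b @ r)) \<cdot>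
      unlayer (c @ r) (map (\<lambda>(a, g, b). (a, g, b @ r)) L))"
    using Cons.prems by (intro isotopic.stack[OF g IH]) (auto simp: l)
  finally show ?case by (simp add: l)
qed

lemma unlayer_whisker_left:
  "wf_diag K (unlayer c L) \<Longrightarrow>
     isotopic K (Strands r \<otimes> unlayer c L) (unlayer (r @ c) (map (\<lambda>(a, g, b). (r @ a, g, b)) L))"
proof (induction L)
  case Nil
  then show ?case by (simp add: isotopic.strands)
next
  case (Cons l L)
  obtain a g b where l: "l = (a, g, b)" by (cases l) auto
  let ?g = "Strands a \<otimes> g \<otimes> Strands b"
  have w: "wf_diag K (unlayer c L)" "wf_diag K g" using Cons.prems by (simp_all add: l)
  note IH = Cons.IH[OF w(1)]
  have g: "isotopic K (Strands r \<otimes> ?g) (Strands (r @ a) \<otimes> g \<otimes> Strands b)"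
    using w by (intro isotopic.sym[OF split_strands]) auto
  have "isotopic K (Strands r \<otimes> unlayer c (l # L)) ((Strands r \<otimes> ?g) \<cdot> (Strands r \<otimes> unlayer c L))"
    using Cons.prems by (auto simp: l intro!: isotopic.sym[OF whisker_left])
  also have "isotopic K \<dots> ((Strands (r @ a) \<otimes> g \<otimes> Strands b) \<cdot>
      unlayer (r @ c) (map (\<lambda>(a, g, b). (r @ a, g, b)) L))"
    using Cons.prems by (intro isotopic.stack[OF g IH]) (auto simp: l)
  finally show ?case by (simp add: l)
qed

lemma unlayer_single:
  assumes "wf_diag K g" shows "isotopic K g (unlayer (src K g) [([], g, [])])"
proof -
  have "isotopic K (Strands [] \<otimes> g \<otimes> Strands []) g"
    using assms isotopic.trans[OF isotopic.juxt_left isotopic.juxt_right, of K g] by simp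
  from isotopic.sym[OF this] have "isotopic K g (Strands [] \<otimes> g \<otimes> Strands [])" .
  also have "isotopic K \<dots> ((Strands [] \<otimes> g \<otimes> Strands []) \<cdot> Strands (src K g))"
    using assms isotopic.stack_bottom[of K "Strands [] \<otimes> g \<otimes> Strands []"] by (auto intro: isotopic.sym)
  finally show ?thesis by simp
qed

text \<open>The case with content is juxtaposition: the left factor is lifted above the right one by
  \<open>stack_left_right\<close>, as in the definition of \<open>layers\<close>.\<close>

lemma isotopic_unlayer: "wf_diag K d \<Longrightarrow> isotopic K d (unlayer (src K d) (layers K d))"
proof (induction d)
  case (Strands a)
  then show ?case by (simp add: isotopic.refl)
next
  case (Stack d e)
  then have d: "isotopic K d (unlayer (tgt K e) (layers K d))" and e: "isotopic K e (unlayer (src K e) (layers K e))"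
    by auto
  have "isotopic K (d \<cdot> e) (unlayer (tgt K e) (layers K d) \<cdot> unlayer (src K e) (layers K e))"
    using d e Stack.prems by (intro isotopic.stack) auto
  also have "isotopic K \<dots> (unlayer (src K e) (layers K d @ layers K e))"
    using isotopic_wf[OF d] isotopic_wf[OF e] unlayer_append[of "src K e" "layers K e" "layers K d"]
    by (auto intro: isotopic.sym)
  finally show ?case by simp
next
  case (Juxt d e)
  let ?U = "\<lambda>d. unlayer (src K d) (layers K d)"
  let ?r = "map (\<lambda>(a, g, b). (a, g, b @ tgt K e)) (layers K d)"
  let ?l = "map (\<lambda>(a, g, b). (src K d @ a, g, b)) (layers K e)"
  have d: "isotopic K d (?U d)" and e: "isotopic K e (?U e)" using Juxt by auto
  have r: "isotopic K (d \<otimes> Strands (tgt K e)) (unlayer (src K d @ tgt K e) ?r)"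
    using isotopic.trans[OF juxt_cong_left[OF _ d] unlayer_whisker_right] isotopic_wf[OF d] by simp
  have l: "isotopic K (Strands (src K d) \<otimes> e) (unlayer (src K d @ src K e) ?l)"
    using isotopic.trans[OF juxt_cong_right[OF _ e] unlayer_whisker_left] isotopic_wf[OF e] by simp
  have t: "tgt K (unlayer (src K d @ src K e) ?l) = src K d @ tgt K e" using src_tgt(2)[OF l] by simp
  have "isotopic K (d \<otimes> e) ((d \<otimes> Strands (tgt K e)) \<cdot> (Strands (src K d) \<otimes> e))"
    using Juxt.prems by (intro isotopic.sym[OF stack_left_right]) auto
  also have "isotopic K \<dots> (unlayer (src K d @ tgt K e) ?r \<cdot> unlayer (src K d @ src K e) ?l)"
    using r l by (intro isotopic.stack) auto
  also have "isotopic K \<dots> (unlayer (src K d @ src K e) (?r @ ?l))"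
    using isotopic_wf[OF r] isotopic_wf[OF l] unlayer_append[of "src K d @ src K e" ?l ?r] t
    by (auto intro: isotopic.sym)
  finally show ?case by simp
next
  case (Cap x)
  then show ?case using unlayer_single[of "Cap x"] by simp
next
  case (Cup x)
  then show ?case using unlayer_single[of "Cup x"] by simp
next
  case (Vert v)
  then show ?case using unlayer_single[of "Vert v"] by simp
qed

text \<open>Well-formedness equates the boundaries of the two layers as lists of labels, which turns
  the comparisons of lengths in \<open>exchange\<close> into the decompositions required for sliding
  and for cancelling.\<close>

lemma isotopic_exchange:
  assumes "wf_diag K (unlayer c (l # m # L))"
  shows "isotopic K (unlayer c (l # m # L)) (unlayer c (exchange K l m @ L))"
proof -
  obtain a g b a' h b' where l: "l = (a, g, b)" and m: "m = (a', h, b')" by (cases l, cases m) auto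
  let ?U = "unlayer c L"
  have w: "wf_diag K g" "wf_diag K h" "wf_diag K ?U" "a @ src K g @ b = a' @ tgt K h @ b'"
    "a' @ src K h @ b' = tgt K ?U" using assms by (auto simp: l m)
  \<comment> \<open>An isotopy of the two upper layers alone extends to the whole list.\<close>
  have *: "isotopic K (unlayer c (l # m # L)) (unlayer c ((e, p, f) # (e', p', f') # L))"
    if "isotopic K ((Strands a \<otimes> g \<otimes> Strands b) \<cdot> (Strands a' \<otimes> h \<otimes> Strands b'))
          ((Strands e \<otimes> p \<otimes> Strands f) \<cdot> (Strands e' \<otimes> p' \<otimes> Strands f'))" (is "isotopic K ?A (?B \<cdot> ?B')")
    for e p f e' p' f'
  proof -
    have "isotopic K (unlayer c (l # m # L)) (?A \<cdot> ?U)"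
      using assms by (auto simp: l m intro!: isotopic.sym[OF isotopic.stack_assoc])
    also have "isotopic K \<dots> ((?B \<cdot> ?B') \<cdot> ?U)" using that w by (intro stack_cong_left) auto
    also have "isotopic K \<dots> (?B \<cdot> ?B' \<cdot> ?U)"
      using isotopic_wf[OF that] w by (intro isotopic.stack_assoc) auto
    finally show ?thesis by simp
  qed
  consider (left) "length a + length (src K g) \<le> length a'"
    | (right) "\<not> length a + length (src K g) \<le> length a'" "length a' + length (tgt K h) \<le> length a"
    | (cancel) x y where "\<not> length a + length (src K g) \<le> length a'" "\<not> length a' + length (tgt K h) \<le> length a"
        "g = Cap x" "h = Cup y" "length a \<noteq> length a'"
    | (none) "\<not> length a + length (src K g) \<le> length a'" "\<not> length a' + length (tgt K h) \<le> length a"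
        "\<not> ((\<exists>x. g = Cap x) \<and> (\<exists>x. h = Cup x) \<and> length a \<noteq> length a')"
    by blast
  then show ?thesis
  proof cases
    case left
    \<comment> \<open>The strands lying between the two pieces.\<close>
    define e where "e = drop (length a + length (src K g)) a'"
    have "a' = take (length (a @ src K g)) a' @ e" by (simp add: e_def)
    moreover have "take (length (a @ src K g)) a' = a @ src K g"
      using w(4) left by (metis append_eq_append_conv_if append.assoc length_append)
    ultimately have a': "a' = a @ src K g @ e" by simp
    have b: "b = e @ tgt K h @ b'" using w(4) unfolding a' by simp
    have x: "exchange K l m = [(a @ tgt K g @ e, h, b'), (a, g, e @ src K h @ b')]"
      using left by (simp add: exchange_def l m e_def Let_def)
    show ?thesis unfolding x append.simps
      using isotopic.trans[OF distant_upper_left isotopic.sym[OF distant_lower_left]] w a' b by (intro *) auto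
  next
    case right
    define e where "e = drop (length a' + length (tgt K h)) a"
    have "a = take (length (a' @ tgt K h)) a @ e" by (simp add: e_def)
    moreover have "take (length (a' @ tgt K h)) a = a' @ tgt K h"
      using w(4) right by (metis append_eq_append_conv_if append.assoc length_append)
    ultimately have a: "a = a' @ tgt K h @ e" by simp
    have b': "b' = e @ src K g @ b" using w(4) unfolding a by simp
    have x: "exchange K l m = [(a', h, e @ tgt K g @ b), (a' @ src K h @ e, g, b)]"
      using right by (simp add: exchange_def l m e_def Let_def)
    show ?thesis unfolding x append.simps
      using isotopic.trans[OF distant_lower_left isotopic.sym[OF distant_upper_left]] w a b' by (intro *) auto
  next
    case (cancel x y)
    have x: "exchange K l m = []" using cancel by (simp add: exchange_def l m)
    \<comment> \<open>Both the cap and the cup occupy two strands. Neither lies beside the other and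
      their positions differ, so the positions differ by exactly one and one strand is
      shared.\<close>
    have "length a' = Suc (length a) \<or> length a = Suc (length a')" using cancel by auto
    then have "isotopic K ((Strands a \<otimes> g \<otimes> Strands b) \<cdot> (Strands a' \<otimes> h \<otimes> Strands b')) (Strands (tgt K ?U))"
    proof
      assume len: "length a' = Suc (length a)"
      have "a' = take (length a) a' @ drop (length a) a'" by simp
      also have "take (length a) a' = a" using w(4) len by (auto simp: append_eq_append_conv_if)
      finally obtain z where a': "a' = a @ [z]" using len by (cases "drop (length a) a'") auto
      have "z = x" "y = dual K x" "b = x # b'" using w(4) by (auto simp: a' cancel dual_dual)
      then show ?thesis using cancel_left[of a x b'] w(5) by (simp add: a' cancel)
    next
      assume len: "length a = Suc (length a')"
      have "a = take (length a') a @ drop (length a') a" by simp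
      also have "take (length a') a = a'" using w(4) len by (auto simp: append_eq_append_conv_if)
      finally obtain z where a: "a = a' @ [z]" using len by (cases "drop (length a') a") auto
      have "z = y" "x = dual K y" "b' = y # b" using w(4) by (auto simp: a cancel dual_dual)
      then show ?thesis using cancel_right[of a' y b] w(5) by (simp add: a cancel)
    qed
    note A = this
    have "isotopic K (unlayer c (l # m # L)) (((Strands a \<otimes> g \<otimes> Strands b) \<cdot> (Strands a' \<otimes> h \<otimes> Strands b')) \<cdot> ?U)"
      using assms by (auto simp: l m intro!: isotopic.sym[OF isotopic.stack_assoc])
    also have "isotopic K \<dots> (Strands (tgt K ?U) \<cdot> ?U)" using A w by (intro stack_cong_left) auto
    also have "isotopic K \<dots> ?U" using w by (intro isotopic.stack_top)
    finally show ?thesis by (simp add: x)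
  next
    case none
    then have "exchange K l m = [l, m]" by (simp add: exchange_def l m)
    then show ?thesis using assms by (simp add: isotopic.refl)
  qed
qed

lemma isotopic_move: "wf_diag K (unlayer c L) \<Longrightarrow> isotopic K (unlayer c L) (unlayer c (move K i L))"
proof (induction i arbitrary: L)
  case 0
  then show ?case
    \<comment> \<open>\<open>remdups_adj.cases\<close> is borrowed for its split into no layer, one
      layer, and at least two.\<close>
    by (cases L rule: remdups_adj.cases) (auto simp: isotopic.refl simp del: unlayer.simps intro: isotopic_exchange)
next
  case (Suc i)
  show ?case
  proof (cases L)
    case (Cons l M)
    then show ?thesis
      using Suc by (cases l) (auto intro!: isotopic.stack isotopic.refl)
  qed (use Suc.prems in \<open>simp add: isotopic.refl\<close>)
qed

text \<open>The lists \<open>is\<close> and \<open>js\<close> are certificates, performed from left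
  to right: they bring both diagrams to the same list of layers, and the equality is checked by
  evaluation. Empty lists express that the diagrams differ only in bracketing and trivial
  strands.\<close>

lemma isotopic_by_moves:
  assumes "wf_diag K d" "wf_diag K e" "src K d = src K e"
    and "fold (move K) is (layers K d) = fold (move K) js (layers K e)"
  shows "isotopic K d e"
proof -
  have *: "wf_diag K (unlayer c L) \<Longrightarrow> isotopic K (unlayer c L) (unlayer c (fold (move K) is L))" for c L "is"
  proof (induction "is" arbitrary: L)
    case (Cons i "is")
    show ?case
      using isotopic.trans[OF isotopic_move[OF Cons.prems] Cons.IH] isotopic_wf[OF isotopic_move[OF Cons.prems]]
      by simp
  qed (simp add: isotopic.refl)
  have **: "isotopic K d (unlayer (src K d) (fold (move K) is (layers K d)))" if "wf_diag K d" for d "is"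
    using isotopic.trans[OF isotopic_unlayer *] isotopic_wf[OF isotopic_unlayer] that by blast
  show ?thesis
    using **[OF assms(1), of "is"] isotopic.sym[OF **[OF assms(2), of js]]
    unfolding assms(3,4) by (rule isotopic.trans)
qed

end

section \<open>Isotopies of tangles and webs\<close>

lemma flip_flip [simp]: "flip (flip x) = x"
  by (cases x) simp_all

lemma flip_edge_simp [simp]: "flip_edge (x, i) = (flip x, i)"
  by (simp add: flip_edge_def)

lemma tangle_kind_simps [simp]:
  "dual tangle_kind = flip" "vsrc tangle_kind (Crossing s x y) = [x, y]"
  "vtgt tangle_kind (Crossing s x y) = [y, x]"
  by (simp_all add: tangle_kind_def)

lemma web_kind_simps [simp]:
  "dual web_kind = flip_edge" "vsrc web_kind (Join x) = [(x, One), (x, One)]"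
  "vsrc web_kind (Fork x) = [(x, Two)]" "vtgt web_kind (Join x) = [(x, Two)]"
  "vtgt web_kind (Fork x) = [(x, One), (x, One)]"
  by (simp_all add: web_kind_def)

lemma tangle_turns: "isotopic tangle_kind (quarter_turn flip x y (X s x y)) (X (\<not> s) y (flip x))"
  by (rule isotopic.turn) (auto simp: tangle_kind_def)

lemma half_turn_Join:
  "isotopic web_kind (half_turn flip_edge [(x, One), (x, One)] [(x, Two)] (Vert (Join x))) (Vert (Fork (flip x)))"
  by (rule isotopic.turn) (auto simp: web_kind_def)

lemma half_turn_Fork:
  "isotopic web_kind (half_turn flip_edge [(x, Two)] [(x, One), (x, One)] (Vert (Fork x))) (Vert (Join (flip x)))"
  by (rule isotopic.turn) (auto simp: web_kind_def)

interpretation tangle: diag_category tangle_kind UNIV UNIV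
  by unfold_locales (auto simp: tangle_kind_def quarter_turn_def)

lemma web_turns_wf:
  assumes "(d, e) \<in> turns web_kind"
  shows "wf_diag web_kind d \<and> wf_diag web_kind e \<and> src web_kind d = src web_kind e \<and> tgt web_kind d = tgt web_kind e"
proof -
  from assms consider
      (J) x where "d = half_turn flip_edge [(x, One), (x, One)] [(x, Two)] (Vert (Join x))" "e = Vert (Fork (flip x))"
    | (F) x where "d = half_turn flip_edge [(x, Two)] [(x, One), (x, One)] (Vert (Fork x))" "e = Vert (Join (flip x))"
    by (auto simp: web_kind_def)
  then show ?thesis by cases (simp_all add: half_turn_def dual_obj_def Let_def)
qed

interpretation web: diag_category web_kind "range (map (\<lambda>x. (x, One)))" webs
  rewrites "diag_cat web_kind (range (map (\<lambda>x. (x, One)))) webs = TrPD"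
proof -
  show "diag_category web_kind (range (map (\<lambda>x. (x, One)))) webs"
  proof
    show "dual web_kind (dual web_kind x) = x" for x by (cases x) simp
    fix a b :: "edge list" and d e :: "(edge, vertex) diag"
    assume a: "a \<in> range (map (\<lambda>x. (x, One)))"
    then obtain a' where a': "a = map (\<lambda>x. (x, One)) a'" by blast
    then show "Strands a \<in> webs" using webs.intros(1)[of a'] by (simp add: strands1_def)
    assume "b \<in> range (map (\<lambda>x. (x, One)))"
    then obtain b' where "b = map (\<lambda>x. (x, One)) b'" by blast
    then have "a @ b = map (\<lambda>x. (x, One)) (a' @ b')" using a' by simp
    then show "a @ b \<in> range (map (\<lambda>x. (x, One)))" by (rule range_eqI)
  qed (fact web_turns_wf webs.intros)+
qed (simp add: TrPD_def)

text \<open>Bending both ends of the strand labelled \<open>x\<close> makes one side of a third move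
  into the opposite side of another: the two crossings of this strand appear quarter turned, and the
  cap of the upper turn cancels against the cup of the lower one.\<close>

lemma rotate_reidemeister3_left:
  "isotopic tangle_kind
    ((quarter_turn flip x z (X t x z) \<otimes> Strands [y]) \<cdot> (Strands [z] \<otimes> quarter_turn flip x y (X s x y)) \<cdot>
       (X u y z \<otimes> Strands [flip x]))
    ((Strands [flip x, z, y] \<otimes> Cap x) \<cdot>
      (Strands [flip x] \<otimes> ((Strands [z] \<otimes> X s x y) \<cdot> (X t x z \<otimes> Strands [y]) \<cdot> (Strands [x] \<otimes> X u y z)) \<otimes>
        Strands [flip x]) \<cdot> (Cup (flip x) \<otimes> Strands [y, z, flip x]))"
  by (rule tangle.isotopic_by_moves[of _ _ "[2, 1, 0, 3, 2, 1, 4, 3, 2]" "[3]"])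
    (simp_all add: quarter_turn_def exchange_def Let_def numeral_eq_Suc)

lemma rotate_reidemeister3_right:
  "isotopic tangle_kind
    ((Strands [flip x] \<otimes> X u y z) \<cdot> (quarter_turn flip x y (X s x y) \<otimes> Strands [z]) \<cdot>
       (Strands [y] \<otimes> quarter_turn flip x z (X t x z)))
    ((Strands [flip x, z, y] \<otimes> Cap x) \<cdot>
      (Strands [flip x] \<otimes> ((X u y z \<otimes> Strands [x]) \<cdot> (Strands [y] \<otimes> X t x z) \<cdot> (X s x y \<otimes> Strands [z])) \<otimes>
        Strands [flip x]) \<cdot> (Cup (flip x) \<otimes> Strands [y, z, flip x]))"
  by (rule tangle.isotopic_by_moves[of _ _ "[3, 2, 1, 4, 3, 2, 5, 4, 3]" "[0]"])
    (simp_all add: quarter_turn_def exchange_def Let_def numeral_eq_Suc)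

abbreviation turn1 :: "ori \<Rightarrow> ori \<Rightarrow> (edge, vertex) diag \<Rightarrow> (edge, vertex) diag" where
  "turn1 x y \<equiv> quarter_turn flip_edge (x, One) (y, One)"

text \<open>In the stack of the two half turned vertices the 2-labelled edge forms a zigzag.
  Straightening it leaves \<open>S\<close> turned as a whole, while each vertex separately is
  subject to a rotation move.\<close>

lemma half_turn_S: "isotopic web_kind (turn1 x (flip x) (turn1 x x (S x))) (S (flip x))"
proof -
  let ?J = "half_turn flip_edge [(x, One), (x, One)] [(x, Two)] (Vert (Join x))"
  let ?F = "half_turn flip_edge [(x, Two)] [(x, One), (x, One)] (Vert (Fork x))"
  have "isotopic web_kind (turn1 x (flip x) (turn1 x x (S x))) (?J \<cdot> ?F)"
    by (rule web.isotopic_by_moves[of _ _ "[]" "[3, 2, 1, 0, 4, 3, 2, 1, 5, 4, 3, 2, 6, 5, 4, 3]"])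
      (simp_all add: quarter_turn_def half_turn_def dual_obj_def S_def exchange_def Let_def numeral_eq_Suc)
  also have "isotopic web_kind (?J \<cdot> ?F) (S (flip x))"
    unfolding S_def using half_turn_Join half_turn_Fork
    by (rule isotopic.stack) (simp add: half_turn_def dual_obj_def Let_def)
  finally show ?thesis .
qed

lemma half_turn_strands: "isotopic web_kind (turn1 x (flip x) (turn1 x x (strands1 [x, x]))) (strands1 [flip x, flip x])"
  by (rule web.isotopic_by_moves[of _ _ "[1, 0, 0]" "[]"])
    (simp_all add: quarter_turn_def strands1_def exchange_def Let_def numeral_eq_Suc)

text \<open>Explains why the identity term of a crossing becomes a cup above a cap when the strands
  are antiparallel.\<close>

lemma quarter_turn_strands: "isotopic web_kind (turn1 x x (strands1 [x, x])) (cup1 (flip x) \<cdot> cap1 x)"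
  by (rule web.isotopic_by_moves[of _ _ "[]" "[0]"])
    (simp_all add: quarter_turn_def strands1_def exchange_def Let_def numeral_eq_Suc)

text \<open>The graph \<open>S\<close> lying on its side, which replaces \<open>S\<close> in the
  crossings of antiparallel strands.\<close>

definition T :: "ori \<Rightarrow> (edge, vertex) diag" where
  "T x = turn1 x x (S x)"

definition left_closure :: "ori \<Rightarrow> (edge, vertex) diag" where
  "left_closure x =
     (cap1 (flip x) \<otimes> strands1 [x]) \<cdot> (strands1 [flip x] \<otimes> S x) \<cdot> (cup1 (flip x) \<otimes> strands1 [x])"

definition right_closure :: "ori \<Rightarrow> (edge, vertex) diag" where
  "right_closure x =
     (strands1 [x] \<otimes> cap1 x) \<cdot> (S x \<otimes> strands1 [flip x]) \<cdot> (strands1 [x] \<otimes> cup1 x)"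

definition square :: "ori \<Rightarrow> (edge, vertex) diag" where
  "square x = (strands1 [x] \<otimes> cap1 x \<otimes> strands1 [flip x]) \<cdot> (S x \<otimes> S (flip x)) \<cdot>
     (strands1 [x] \<otimes> cup1 x \<otimes> strands1 [flip x])"

text \<open>The same rotation by 90 degrees as \<open>quarter_turn\<close>, in the form that fits
  diagrams from \<open>flip x, x\<close> to itself, such as \<open>square (flip x)\<close>.\<close>

definition rotate_square :: "ori \<Rightarrow> (edge, vertex) diag \<Rightarrow> (edge, vertex) diag" where
  "rotate_square x d = (strands1 [x, flip x] \<otimes> cap1 x) \<cdot> (strands1 [x] \<otimes> d \<otimes> strands1 [flip x]) \<cdot>
     (cup1 x \<otimes> strands1 [x, flip x])"

lemma quarter_turn_cong:
  "isotopic web_kind d e \<Longrightarrow> src web_kind d = [(x, One), (y, One)] \<Longrightarrow> tgt web_kind d = [(y, One), (x, One)] \<Longrightarrow>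
     isotopic web_kind (turn1 x y d) (turn1 x y e)"
  unfolding quarter_turn_def
  by (frule web.isotopic_wf) (rule isotopic.stack isotopic.juxt isotopic.refl | assumption | simp)+

text \<open>Relation (3) closes \<open>S\<close> on the left. As half a turn carries
  \<open>S (flip x)\<close> to \<open>S x\<close>, a closure on the right is the half turn of a
  closure on the left with the opposite orientation.\<close>

lemma right_closure_eq:
  "isotopic web_kind (right_closure x)
     ((strands1 [x] \<otimes> cap1 (flip x)) \<cdot> (strands1 [x] \<otimes> left_closure (flip x) \<otimes> strands1 [x]) \<cdot> (cup1 x \<otimes> strands1 [x]))"
proof -
  have *: "isotopic web_kind (S x) (turn1 (flip x) x (turn1 (flip x) (flip x) (S (flip x))))"
    using isotopic.sym[OF half_turn_S[of "flip x"]] by simp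
  have "isotopic web_kind (right_closure x) ((strands1 [x] \<otimes> cap1 x) \<cdot>
      (turn1 (flip x) x (turn1 (flip x) (flip x) (S (flip x))) \<otimes> strands1 [flip x]) \<cdot> (strands1 [x] \<otimes> cup1 x))"
    unfolding right_closure_def
    by (rule isotopic.stack isotopic.juxt isotopic.refl * | simp add: strands1_def S_def quarter_turn_def)+
  also have "isotopic web_kind \<dots> ((strands1 [x] \<otimes> cap1 (flip x)) \<cdot>
      (strands1 [x] \<otimes> left_closure (flip x) \<otimes> strands1 [x]) \<cdot> (cup1 x \<otimes> strands1 [x]))"
    by (rule web.isotopic_by_moves[of _ _ "[6, 5, 4, 3, 2, 1]" "[0]"])
      (simp_all add: quarter_turn_def left_closure_def strands1_def S_def exchange_def Let_def numeral_eq_Suc)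
  finally show ?thesis .
qed

lemma half_turn_strand:
  "isotopic web_kind ((strands1 [x] \<otimes> cap1 (flip x)) \<cdot> (strands1 [x] \<otimes> strands1 [flip x] \<otimes> strands1 [x]) \<cdot>
     (cup1 x \<otimes> strands1 [x])) (strands1 [x])"
  by (rule web.isotopic_by_moves[of _ _ "[0]" "[]"]) (simp_all add: strands1_def exchange_def Let_def numeral_eq_Suc)

lemma curl_strands:
  "isotopic web_kind ((strands1 [x] \<otimes> cap1 x) \<cdot> (strands1 [x, x] \<otimes> strands1 [flip x]) \<cdot> (strands1 [x] \<otimes> cup1 x))
     (strands1 [x] \<otimes> (cap1 x \<cdot> cup1 x))"
  "isotopic web_kind ((cap1 (flip x) \<otimes> strands1 [x]) \<cdot> (strands1 [flip x] \<otimes> strands1 [x, x]) \<cdot> (cup1 (flip x) \<otimes> strands1 [x]))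
     ((cap1 (flip x) \<cdot> cup1 (flip x)) \<otimes> strands1 [x])"
  by (rule web.isotopic_by_moves[of _ _ "[]" "[]"], simp_all add: strands1_def)+

text \<open>Two sideways copies of \<open>S\<close> on top of each other bound the square face of
  relation (4), seen after a quarter turn; this is how (4) enters the cancellation of antiparallel
  crossings.\<close>

lemma T_T: "isotopic web_kind (T (flip x) \<cdot> T x) (rotate_square x (square (flip x)))"
  by (rule web.isotopic_by_moves[of _ _ "[]" "[0, 1, 2, 6, 5, 4, 3]"])
    (simp_all add: T_def S_def quarter_turn_def rotate_square_def square_def strands1_def exchange_def Let_def numeral_eq_Suc)

text \<open>The rotation exchanges the two webs on the right of relation (4), so the coefficients 1
  and [n-2] trade places.\<close>

lemma rotate_square_cup_cap:
  "isotopic web_kind (rotate_square x (cup1 (flip x) \<cdot> cap1 (flip x))) (strands1 [x, flip x])"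
  by (rule web.isotopic_by_moves[of _ _ "[0, 0]" "[]"])
    (simp_all add: rotate_square_def strands1_def exchange_def Let_def numeral_eq_Suc)

lemma rotate_square_strands:
  "isotopic web_kind (rotate_square x (strands1 [flip x] \<otimes> strands1 [x])) (cup1 x \<cdot> cap1 x)"
  by (rule web.isotopic_by_moves[of _ _ "[]" "[0]"])
    (simp_all add: rotate_square_def strands1_def exchange_def Let_def numeral_eq_Suc)

text \<open>Joining two ends of the sideways graph closes \<open>S\<close> up along one strand, on
  the left under a cap and on the right above a cup (\<open>T_cup\<close>). This produces the
  factors [n-1] of the mixed products.\<close>

lemma cap_T: "isotopic web_kind (cap1 (flip x) \<cdot> T x) (cap1 x \<cdot> (left_closure x \<otimes> strands1 [flip x]))"
  by (rule web.isotopic_by_moves[of _ _ "[]" "[0]"])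
    (simp_all add: T_def S_def quarter_turn_def left_closure_def strands1_def exchange_def Let_def numeral_eq_Suc)

lemma T_cup: "isotopic web_kind (T x \<cdot> cup1 x) ((strands1 [flip x] \<otimes> right_closure x) \<cdot> cup1 (flip x))"
  by (rule web.isotopic_by_moves[of _ _ "[]" "[3]"])
    (simp_all add: T_def S_def quarter_turn_def right_closure_def strands1_def exchange_def Let_def numeral_eq_Suc)

section \<open>From tangles to linear combinations of webs\<close>

abbreviation edges1 :: "ori list \<Rightarrow> edge list" where
  "edges1 \<equiv> map (\<lambda>x. (x, One))"

definition is_web :: "ori list \<Rightarrow> ori list \<Rightarrow> (edge, vertex) diag \<Rightarrow> bool" where
  "is_web a b d \<longleftrightarrow> d \<in> webs \<and> wf_diag web_kind d \<and> src web_kind d = edges1 a \<and> tgt web_kind d = edges1 b"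

lemma is_web_strands1 [simp]: "is_web a a (strands1 a)"
  by (simp add: is_web_def webs.intros) (simp add: strands1_def)

lemma is_web_cap1 [simp]: "is_web [x, flip x] [] (cap1 x)"
  by (simp add: is_web_def webs.intros)

lemma is_web_cup1 [simp]: "is_web [] [x, flip x] (cup1 x)"
  by (simp add: is_web_def webs.intros)

lemma is_web_S [simp]: "is_web [x, x] [x, x] (S x)"
  by (simp add: is_web_def webs.intros) (simp add: S_def)

lemma is_web_stack: "is_web b c d \<Longrightarrow> is_web a b e \<Longrightarrow> is_web a c (d \<cdot> e)"
  by (simp add: is_web_def webs.intros)

lemma is_web_juxt: "is_web a b d \<Longrightarrow> is_web a' b' e \<Longrightarrow> is_web (a @ a') (b @ b') (d \<otimes> e)"
  by (simp add: is_web_def webs.intros)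

lemma turn1_def': "turn1 x y d =
   (strands1 [flip x, y] \<otimes> cap1 x) \<cdot> (strands1 [flip x] \<otimes> d \<otimes> strands1 [flip x]) \<cdot>
     (cup1 (flip x) \<otimes> strands1 [y, flip x])"
  by (simp add: quarter_turn_def strands1_def)

lemma is_web_turn1: "is_web [x, y] [y, x] d \<Longrightarrow> is_web [y, flip x] [flip x, y] (turn1 x y d)"
  by (auto simp: turn1_def' is_web_def webs.intros) (simp_all add: strands1_def)

lemma is_web_T [simp]: "is_web [x, flip x] [flip x, x] (T x)"
  unfolding T_def using is_web_turn1[OF is_web_S] by simp

abbreviation V :: "(edge, vertex) diag \<Rightarrow> ((edge, vertex) diag set \<Rightarrow>\<^sub>0 qring)" where
  "V \<equiv> web.class_single"

definition comb :: "(qring \<times> (edge, vertex) diag) list \<Rightarrow> ((edge, vertex) diag set \<Rightarrow>\<^sub>0 qring)" where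
  "comb cs = (\<Sum>(c, d)\<leftarrow>cs. single (iclass web_kind d) c)"

lemma web_comb_eq: "web_comb a b cs = (edges1 a, edges1 b, comb cs)"
  by (simp add: web_comb_def lin_comb_def comb_def)

lemma comb_simps [simp]:
  "comb [] = 0" "comb ((c, d) # cs) = smult c (V d) + comb cs"
  by (simp_all add: comb_def web.class_single_def smult_single)

lemma keys_comb:
  assumes "\<And>c d. (c, d) \<in> set cs \<Longrightarrow> is_web a b d"
  shows "supp (comb cs) \<subseteq> web.classes webs (edges1 a) (edges1 b)"
  unfolding comb_def
proof (rule keys_sum_list_subset)
  fix p assume "p \<in> set cs"
  then show "supp (case p of (c, d) \<Rightarrow> single (iclass web_kind d) c)
      \<subseteq> web.classes webs (edges1 a) (edges1 b)"
    using assms[of "fst p" "snd p"] web.iclass_classes[of "snd p"]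
    by (auto simp: is_web_def split: prod.splits if_splits)
qed

text \<open>The turned diagram is a context in which the original occurs once, so its value is
  additive in the value of the original.\<close>

lemma diag_value_quarter_turn:
  assumes d: "diag_value web_kind (\<lambda>x. (x, One)) \<phi> d = comb cs"
    and cs: "\<And>c e. (c, e) \<in> set cs \<Longrightarrow> is_web [x, y] [y, x] e"
  shows "diag_value web_kind (\<lambda>x. (x, One)) \<phi> (quarter_turn flip x y d) = comb (turn_comb x y cs)"
proof -
  let ?s = "\<lambda>d. single (iclass web_kind d) 1"
  let ?r = "\<lambda>f. web.stack_lin (web.juxt_lin (?s (strands1 [flip x, y])) (?s (cap1 x)))
    (web.stack_lin (web.juxt_lin (?s (strands1 [flip x])) (web.juxt_lin f (?s (strands1 [flip x]))))
      (web.juxt_lin (?s (cup1 (flip x))) (?s (strands1 [y, flip x]))))"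
  have r: "additive ?r" by (intro additive_bilinear_ext)
  have "?r (single (iclass web_kind e) c) = single (iclass web_kind (turn1 x y e)) c"
    if "(c, e) \<in> set cs" for c e
    using cs[OF that] unfolding turn1_def' is_web_def
    by (simp add: web.stack_lin_single web.juxt_lin_single strands1_def)
  then have "?r (comb cs) = comb (turn_comb x y cs)"
    unfolding comb_def additive_sum_list[OF r] turn_comb_def
    by (auto simp: comp_def split_def intro!: arg_cong[of _ _ sum_list])
  then show ?thesis by (simp add: quarter_turn_def d strands1_def)
qed

lemma V_isotopic: "isotopic web_kind d e \<Longrightarrow> V d = V e"
  by (simp add: web.class_single_def web.iclass_eq)

lemma sigma_is_web: "(c, d) \<in> set (sigma n s x y) \<Longrightarrow> is_web [x, y] [y, x] d"
proof (induction n s x y arbitrary: c d rule: sigma.induct)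
  case (1 n s)
  then show ?case by (auto simp: sigma_up_def split: if_splits)
qed (auto simp: turn_comb_def sigma_up_def split: if_splits
    intro!: is_web_turn1[of Up Up, simplified] is_web_turn1[of Up Dn, simplified] is_web_turn1[of Dn Dn, simplified])

lemma half_turn1_class:
  "V (turn1 Up Dn (turn1 Up Up (strands1 [Up, Up]))) = V (strands1 [Dn, Dn])"
  "V (turn1 Up Dn (turn1 Up Up (S Up))) = V (S Dn)"
  using V_isotopic[OF half_turn_strands[of Up]] V_isotopic[OF half_turn_S[of Up]] by simp_all

lemma turn1_cong:
  "isotopic web_kind d e \<Longrightarrow> is_web [x, y] [y, x] d \<Longrightarrow> isotopic web_kind (turn1 x y d) (turn1 x y e)"
  by (rule quarter_turn_cong) (auto simp: is_web_def)

lemma three_quarter_turn: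
  assumes "isotopic web_kind (turn1 Up Dn (turn1 Up Up d)) e" "is_web [Up, Up] [Up, Up] d"
  shows "isotopic web_kind (turn1 Dn Dn (turn1 Up Dn (turn1 Up Up d))) (turn1 Dn Dn e)"
  using turn1_cong[OF assms(1), of Dn Dn] is_web_turn1[of Up Dn "turn1 Up Up d"]
    is_web_turn1[OF assms(2)] by simp

text \<open>Two half turns, the first of which may be replaced by its known result \<open>e\<close>
  inside the second.\<close>

lemma full_turn:
  assumes "isotopic web_kind (turn1 Up Dn (turn1 Up Up d)) e" "isotopic web_kind (turn1 Dn Up (turn1 Dn Dn e)) d"
    and "is_web [Up, Up] [Up, Up] d"
  shows "isotopic web_kind (turn1 Dn Up (turn1 Dn Dn (turn1 Up Dn (turn1 Up Up d)))) d"
proof -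
  have w: "is_web [Dn, Dn] [Dn, Dn] (turn1 Up Dn (turn1 Up Up d))"
    using is_web_turn1[of Up Dn "turn1 Up Up d"] is_web_turn1[OF assms(3)] by simp
  have "isotopic web_kind (turn1 Dn Up (turn1 Dn Dn (turn1 Up Dn (turn1 Up Up d)))) (turn1 Dn Up (turn1 Dn Dn e))"
    using is_web_turn1[OF w] by (intro turn1_cong[of _ _ Dn Up] three_quarter_turn assms) simp
  then show ?thesis using assms(2) by (rule isotopic.trans)
qed

definition crossing_value :: "nat \<Rightarrow> crossing \<Rightarrow> ((edge, vertex) diag set \<Rightarrow>\<^sub>0 qring)" where
  "crossing_value n v = (case v of Crossing s x y \<Rightarrow> comb (sigma n s x y))"

text \<open>\<open>sigma\<close> defines the orientations by successive quarter turns starting from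
  \<open>Up Up\<close>, so three of the four cases hold by definition. The last, from
  \<open>Dn Up\<close> back to \<open>Up Up\<close>, says that a full turn changes neither
  \<open>S\<close> nor two strands.\<close>

lemma crossing_value_turn:
  "comb (turn_comb x y (sigma n s x y)) = comb (sigma n (\<not> s) y (flip x))"
proof (cases x; cases y)
  assume xy: "x = Dn" "y = Up"
  have "V (turn1 Dn Up (turn1 Dn Dn (turn1 Up Dn (turn1 Up Up (S Up))))) = V (S Up)"
    using full_turn half_turn_S[of Up] half_turn_S[of Dn] by (intro V_isotopic) simp
  moreover have "V (turn1 Dn Up (turn1 Dn Dn (turn1 Up Dn (turn1 Up Up (strands1 [Up, Up]))))) =
      V (strands1 [Up, Up])"
    using full_turn half_turn_strands[of Up] half_turn_strands[of Dn] by (intro V_isotopic) simp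
  ultimately show ?thesis by (simp add: xy turn_comb_def sigma_up_def)
qed simp_all

interpretation webs: diag_functor tangle_kind web_kind "range edges1" webs "\<lambda>x. (x, One)" "crossing_value n"
  rewrites "diag_cat web_kind (range edges1) webs = TrPD" for n
proof -
  show "diag_functor tangle_kind web_kind (range edges1) webs (\<lambda>x. (x, One)) (crossing_value n)"
  proof
    fix x a v and d e :: "(ori, crossing) diag"
    show "(dual tangle_kind x, One) = dual web_kind (x, One)" by simp
    show "edges1 a \<in> range edges1" by simp
    show "cap1 x \<in> webs" "cup1 x \<in> webs" by (rule webs.intros)+
    show "supp (crossing_value n v) \<subseteq>
        web.classes webs (edges1 (vsrc tangle_kind v)) (edges1 (vtgt tangle_kind v))"
    proof (cases v)
      case (Crossing s x y)
      show ?thesis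
        using keys_comb[OF sigma_is_web[of _ _ n s x y]] by (simp add: Crossing crossing_value_def)
    qed
    assume "(d, e) \<in> turns tangle_kind"
    then obtain s x y where d: "d = quarter_turn flip x y (X s x y)" "e = X (\<not> s) y (flip x)"
      by (auto simp: tangle_kind_def)
    have "diag_value web_kind (\<lambda>x. (x, One)) (crossing_value n) d = comb (turn_comb x y (sigma n s x y))"
      unfolding d by (rule diag_value_quarter_turn) (simp_all add: crossing_value_def sigma_is_web)
    then show "diag_value web_kind (\<lambda>x. (x, One)) (crossing_value n) d =
        diag_value web_kind (\<lambda>x. (x, One)) (crossing_value n) e"
      by (simp add: d crossing_value_turn crossing_value_def)
  qed
qed (simp add: TrPD_def)

section \<open>Quantum integers\<close>

text \<open>In the fraction field the case distinction of \<open>qpow\<close> becomes a single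
  integer power, whose exponent laws then carry over.\<close>

lemma Rep_qpow: "Rep_qring (qpow k) = qX powi k"
proof -
  have "Rep_qring (q ^ m) = qX ^ m" "Rep_qring (q_inv ^ m) = inverse qX ^ m" for m
    by (induction m) (simp_all add: one_qring.rep_eq times_qring.rep_eq q.rep_eq q_inv.rep_eq
        del: mult_fract inverse_fract)
  then show ?thesis by (simp add: qpow_def power_int_def del: inverse_fract)
qed

lemma qpow_add: "qpow (i + j) = qpow i * qpow j"
  using qX_nonzero
  by (simp add: Rep_qring_inject[symmetric] times_qring.rep_eq Rep_qpow power_int_add)

lemma qpow_simps: "qpow 0 = 1" "qpow 1 = q" "qpow (- 1) = q_inv"
  by (simp_all add: qpow_def)

lemma q_q_inv: "q * q_inv = 1"
  using qpow_add[of 1 "- 1"] by (simp add: qpow_simps)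

lemma q_cancel: "q * (q_inv * r) = r"
  using q_q_inv by (simp flip: mult.assoc)

lemma qdiff: "(q - q_inv) * qdiff_inv = 1"
  by transfer (use qX_diff_nonzero in \<open>simp del: mult_fract inverse_fract diff_fract\<close>)

lemma qpow_minus: "qpow k * qpow (- k) = 1"
  using qpow_add[of k "- k"] by (simp add: qpow_simps)

lemma qpow_diff: "qpow (k - 1) = qpow k * q_inv" "qpow (1 - k) = q * qpow (- k)"
  "qpow (k - 2) = qpow k * q_inv * q_inv" "qpow (2 - k) = q * q * qpow (- k)"
  using qpow_add[of k "- 1"] qpow_add[of 1 "- k"] qpow_add[of "k - 1" "- 1"] qpow_add[of 1 "1 - k"]
  by (simp_all add: qpow_simps)

lemma qint_recursion: "qint k + qint (k - 2) = (q + q_inv) * qint (k - 1)"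
  by (simp add: qint_def qpow_diff algebra_simps q_cancel)

text \<open>The leading power is factored out of both crossings: each is
  \<open>sigma_coeff n s\<close> times the difference of \<open>sigma_ratio s\<close> id and
  \<open>S\<close>. The ratios of the two signs are inverse to each other, and so are the leading
  powers.\<close>

definition sigma_coeff :: "nat \<Rightarrow> bool \<Rightarrow> qring" where
  "sigma_coeff n s = qpow (if s then int n else - int n)"

definition sigma_ratio :: "bool \<Rightarrow> qring" where
  "sigma_ratio s = (if s then q_inv else q)"

lemma sigma_ratio_simps:
  "sigma_ratio s + sigma_ratio (\<not> s) = q + q_inv" "sigma_ratio s * sigma_ratio (\<not> s) = 1"
  using q_q_inv by (auto simp: sigma_ratio_def algebra_simps)

lemma sigma_coeff_inverse: "sigma_coeff n s * sigma_coeff n (\<not> s) = 1"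
  using qpow_minus[of "int n"] by (auto simp: sigma_coeff_def mult.commute)

text \<open>[n]/q - [n-1] = q^{-n} and q [n] - [n-1] = q^n, in both cases the inverse of the leading
  power of the crossing.\<close>

lemma curl_coeff: "sigma_coeff n s * (sigma_ratio s * qint (int n) - qint (int n - 1)) = 1"
proof -
  let ?P = "qpow (int n)" and ?M = "qpow (- int n)"
  have "sigma_coeff n s * (sigma_ratio s * qint (int n) - qint (int n - 1)) = (?P * ?M) * ((q - q_inv) * qdiff_inv)"
    by (cases s) (simp_all add: sigma_coeff_def sigma_ratio_def qint_def qpow_diff algebra_simps)
  then show ?thesis by (simp add: qpow_minus qdiff)
qed

lemma comb_sigma_parallel:
  "comb (sigma n s x x) = smult (sigma_ratio s * sigma_coeff n s) (V (strands1 [x, x])) +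
     smult (- sigma_coeff n s) (V (S x))"
  by (cases x; cases s) (simp_all add: sigma_up_def sigma_ratio_def sigma_coeff_def qpow_diff mult.commute
      turn_comb_def half_turn1_class)

text \<open>The sign is negated because this crossing is one or three quarter turns away from two
  upward strands. For \<open>x = Dn\<close> the first two of the three carry the terms to their
  downward versions, and the last one lays them on the side.\<close>

lemma comb_sigma_antiparallel:
  "comb (sigma n s x (flip x)) =
     smult (sigma_ratio (\<not> s) * sigma_coeff n (\<not> s)) (V (cup1 (flip x) \<cdot> cap1 x)) +
     smult (- sigma_coeff n (\<not> s)) (V (T x))"
proof (cases x)
  case Up
  show ?thesis
    using V_isotopic[OF quarter_turn_strands[of Up]]
    by (cases s) (simp_all add: Up sigma_up_def sigma_ratio_def sigma_coeff_def qpow_diff mult.commute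
        turn_comb_def T_def)
next
  case Dn
  have "V (turn1 Dn Dn (turn1 Up Dn (turn1 Up Up (S Up)))) = V (T Dn)"
    unfolding T_def using half_turn_S[of Up] by (intro V_isotopic three_quarter_turn) simp_all
  moreover have "V (turn1 Dn Dn (turn1 Up Dn (turn1 Up Up (strands1 [Up, Up])))) =
      V (cup1 Up \<cdot> cap1 Dn)"
    using isotopic.trans[OF three_quarter_turn quarter_turn_strands[of Dn]] half_turn_strands[of Up]
    by (intro V_isotopic) simp
  ultimately show ?thesis
    by (cases s) (simp_all add: Dn sigma_up_def sigma_ratio_def sigma_coeff_def qpow_diff mult.commute turn_comb_def)
qed

section \<open>Calculations in MOY\<close>

lemma web_simps [simp]:
  "wf_diag web_kind (strands1 a)" "src web_kind (strands1 a) = edges1 a" "tgt web_kind (strands1 a) = edges1 a"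
  "wf_diag web_kind (S x)" "src web_kind (S x) = edges1 [x, x]" "tgt web_kind (S x) = edges1 [x, x]"
  "wf_diag web_kind (T x)" "src web_kind (T x) = edges1 [x, flip x]" "tgt web_kind (T x) = edges1 [flip x, x]"
  using is_web_strands1[of a] is_web_S[of x] is_web_T[of x] by (simp_all add: is_web_def)

lemma web_comb_Hom:
  assumes "\<And>c d. (c, d) \<in> set cs \<Longrightarrow> is_web a b d"
  shows "web_comb a b cs \<in> Hom TrPD (edges1 a) (edges1 b)"
  using keys_comb[OF assms] by (auto simp: web_comb_eq web.diag_cat_Hom)

lemma is_webI:
  "d \<in> webs \<Longrightarrow> wf_diag web_kind d \<Longrightarrow> src web_kind d = edges1 a \<Longrightarrow> tgt web_kind d = edges1 b \<Longrightarrow> is_web a b d"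
  by (simp add: is_web_def)

lemma moy_relations_Mor: "moy_relations n x \<subseteq> Mor TrPD"
  unfolding moy_relations_def Let_def
  by (intro subsetI, elim insertE emptyE)
    (auto intro!: web.MorI[OF web_comb_Hom] is_webI webs.intros)

interpretation moy: tensor_ideal_of TrPD "moy_relations n Up \<union> moy_relations n Dn"
  rewrites "tensor_ideal_of.I TrPD (moy_relations n Up \<union> moy_relations n Dn) = moy_ideal n" for n
proof -
  show 1: "tensor_ideal_of TrPD (moy_relations n Up \<union> moy_relations n Dn)"
    by unfold_locales (simp add: moy_relations_Mor)
  show "tensor_ideal_of.I TrPD (moy_relations n Up \<union> moy_relations n Dn) = moy_ideal n"
    by (simp add: tensor_ideal_of.I_def[OF 1] moy_ideal_def)
qed

lemma V_stack: "wf_diag web_kind (d \<cdot> e) \<Longrightarrow> web.stack_lin (V d) (V e) = V (d \<cdot> e)"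
  by (simp add: web.class_single_def web.stack_lin_single)

lemma V_juxt: "wf_diag web_kind (d \<otimes> e) \<Longrightarrow> web.juxt_lin (V d) (V e) = V (d \<otimes> e)"
  by (simp add: web.class_single_def web.juxt_lin_single)

definition web_lin :: "ori list \<Rightarrow> ori list \<Rightarrow> ((edge, vertex) diag set \<Rightarrow>\<^sub>0 qring) \<Rightarrow> bool" where
  "web_lin a b f \<longleftrightarrow> supp f \<subseteq> web.classes webs (edges1 a) (edges1 b)"

text \<open>Equality in \<open>MOY\<close> as a congruence on combinations of webs. Membership in
  the Hom set is built in, so that it propagates through calculations.\<close>

definition moy_eq :: "nat \<Rightarrow> ori list \<Rightarrow> ori list \<Rightarrow> ((edge, vertex) diag set \<Rightarrow>\<^sub>0 qring) \<Rightarrow>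
    ((edge, vertex) diag set \<Rightarrow>\<^sub>0 qring) \<Rightarrow> bool" where
  "moy_eq n a b f g \<longleftrightarrow> web_lin a b f \<and> web_lin a b g \<and>
     coset TrPD (moy_ideal n) (edges1 a, edges1 b, f) = coset TrPD (moy_ideal n) (edges1 a, edges1 b, g)"

lemma TrPD_Hom: "web_lin a b f \<Longrightarrow> (edges1 a, edges1 b, f) \<in> Hom TrPD (edges1 a) (edges1 b)"
  by (simp add: web.diag_cat_Hom web_lin_def)

lemma web_lin_V: "is_web a b d \<Longrightarrow> web_lin a b (V d)"
  using web.iclass_classes[of d] by (simp add: is_web_def web.class_single_def web_lin_def)

lemma web_lin_intros:
  "web_lin a b f \<Longrightarrow> web_lin a b (smult r f)" "web_lin a b f \<Longrightarrow> web_lin a b g \<Longrightarrow> web_lin a b (f + g)"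
  "web_lin b c f \<Longrightarrow> web_lin a b g \<Longrightarrow> web_lin a c (web.stack_lin f g)"
  "web_lin a b f \<Longrightarrow> web_lin a' b' g \<Longrightarrow> web_lin (a @ a') (b @ b') (web.juxt_lin f g)"
  unfolding web_lin_def map_append
  by (rule subset_trans[OF keys_smult] keys_add_subset web.keys_stack_lin web.keys_juxt_lin; assumption)+

lemma moy_eq_refl: "web_lin a b f \<Longrightarrow> moy_eq n a b f f"
  by (simp add: moy_eq_def)

lemma moy_eq_V: "is_web a b d \<Longrightarrow> moy_eq n a b (V d) (V d)"
  by (intro moy_eq_refl web_lin_V)

lemma moy_eq_sym: "moy_eq n a b f g \<Longrightarrow> moy_eq n a b g f"
  by (simp add: moy_eq_def)

lemma moy_eq_trans [trans]: "moy_eq n a b f g \<Longrightarrow> moy_eq n a b g h \<Longrightarrow> moy_eq n a b f h"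
  by (simp add: moy_eq_def)

lemma moy_eq_Hom:
  assumes "moy_eq n a b f g"
  shows "(edges1 a, edges1 b, f) \<in> Hom TrPD (edges1 a) (edges1 b)" "(edges1 a, edges1 b, g) \<in> Hom TrPD (edges1 a) (edges1 b)"
  using assms by (simp_all add: moy_eq_def TrPD_Hom)

lemma moy_eq_add:
  assumes "moy_eq n a b f g" "moy_eq n a b f' g'"
  shows "moy_eq n a b (f + f') (g + g')"
proof -
  note H = moy_eq_Hom[OF assms(1)] moy_eq_Hom[OF assms(2)]
  show ?thesis
    using moy.coset_add_cong[OF H(3,4) H(1,2), of n] assms
    by (simp add: moy_eq_def web.diag_cat_simps web_lin_intros)
qed

lemma moy_eq_smult: "moy_eq n a b f g \<Longrightarrow> moy_eq n a b (smult r f) (smult r g)"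
  using moy.coset_scl_cong[OF moy_eq_Hom[of n a b f g], of n r]
  by (simp add: moy_eq_def web.diag_cat_simps web_lin_intros)

lemma moy_eq_stack:
  assumes "moy_eq n b c f g" "moy_eq n a b f' g'"
  shows "moy_eq n a c (web.stack_lin f f') (web.stack_lin g g')"
proof -
  note H = moy_eq_Hom[OF assms(1)] moy_eq_Hom[OF assms(2)]
  show ?thesis
    using moy.coset_cmp_cong[OF H(3,4) H(1,2), of n] assms
    by (auto simp: moy_eq_def web.diag_cat_simps intro: web_lin_intros)
qed

lemma moy_eq_juxt:
  assumes "moy_eq n a b f g" "moy_eq n a' b' f' g'"
  shows "moy_eq n (a @ a') (b @ b') (web.juxt_lin f f') (web.juxt_lin g g')"
proof -
  note H = moy_eq_Hom[OF assms(1)] moy_eq_Hom[OF assms(2)]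
  show ?thesis
    using moy.coset_tns_cong[OF H(3,4) H(1,2), of n] assms
    by (auto simp: moy_eq_def web.diag_cat_simps intro: web_lin_intros)
qed

lemma moy_eq_relation:
  assumes r: "web_comb a b cs \<in> moy_relations n x" and f: "web_lin a b f" and g: "web_lin a b g"
    and cs: "comb cs = f + smult (- 1) g"
  shows "moy_eq n a b f g"
proof -
  have "web_comb a b cs \<in> moy_ideal n"
    unfolding moy_ideal_def using r by (cases x) (auto intro: tensor_ideal.gen)
  then show ?thesis
    using f g cs moy.coset_eq_iff[OF TrPD_Hom[OF f] TrPD_Hom[OF g], of n]
    by (simp add: moy_eq_def web.sub_def web_comb_eq web.diag_cat_simps)
qed

lemmas is_web_simps = is_web_def webs.intros

lemma smult_neg: "smult (- 1) (smult r f) = smult (- r) f"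
  by (simp add: smult_smult)

lemma circle: "moy_eq n [] [] (V (cap1 x \<cdot> cup1 x)) (smult (qint (int n)) (V (strands1 [])))"
  by (rule moy_eq_relation[of _ _ "[(1, cap1 x \<cdot> cup1 x), (- qint (int n), strands1 [])]" _ x])
    (auto simp: moy_relations_def Let_def smult_one smult_neg is_web_simps intro!: web_lin_intros web_lin_V)

lemma S_S: "moy_eq n [x, x] [x, x] (V (S x \<cdot> S x)) (smult (q + q_inv) (V (S x)))"
  by (rule moy_eq_relation[of _ _ "[(1, S x \<cdot> S x), (- (q + q_inv), S x)]" _ x])
    (auto simp: moy_relations_def Let_def smult_one smult_neg is_web_simps intro!: web_lin_intros web_lin_V)

lemma is_web_closures [simp]:
  "is_web [x] [x] (left_closure x)" "is_web [x] [x] (right_closure x)"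
  "is_web [x, flip x] [x, flip x] (square x)"
  by (simp_all add: left_closure_def right_closure_def square_def is_web_simps)

lemma square_simps [simp]: "square x \<in> webs" "wf_diag web_kind (square x)"
  "src web_kind (square x) = edges1 [x, flip x]" "tgt web_kind (square x) = edges1 [x, flip x]"
  using is_web_closures(3)[of x] by (simp_all add: is_web_def)

lemma left_closure: "moy_eq n [x] [x] (V (left_closure x)) (smult (qint (int n - 1)) (V (strands1 [x])))"
  by (rule moy_eq_relation[of _ _ "[(1, left_closure x), (- qint (int n - 1), strands1 [x])]" _ x])
    (auto simp: moy_relations_def Let_def smult_one smult_neg left_closure_def[symmetric] intro!: web_lin_intros web_lin_V)

lemma square: "moy_eq n [x, flip x] [x, flip x] (V (square x))
    (V (cup1 x \<cdot> cap1 x) + smult (qint (int n - 2)) (V (strands1 [x] \<otimes> strands1 [flip x])))"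
  by (rule moy_eq_relation[of _ _ "[(1, square x), (- 1, cup1 x \<cdot> cap1 x),
        (- qint (int n - 2), strands1 [x] \<otimes> strands1 [flip x])]" _ x])
    (auto simp: moy_relations_def Let_def smult_one smult_neg smult_add square_def[symmetric] is_web_simps
      intro!: web_lin_intros web_lin_V)

lemma S_braid:
  fixes x defines "A \<equiv> S x \<otimes> strands1 [x]" and "B \<equiv> strands1 [x] \<otimes> S x"
  shows "moy_eq n [x, x, x] [x, x, x] (V (A \<cdot> B \<cdot> A)) (V (B \<cdot> A \<cdot> B) + V A + smult (- 1) (V B))"
  by (rule moy_eq_relation[of _ _ "[(1, A \<cdot> B \<cdot> A), (1, B), (- 1, B \<cdot> A \<cdot> B), (- 1, A)]" _ x])
    (auto simp: A_def B_def moy_relations_def Let_def smult_one smult_smult smult_add is_web_simps add_ac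
      intro!: web_lin_intros web_lin_V)

text \<open>A context with one hole: \<open>f\<close> between vertical strands, with
  \<open>u\<close> above and \<open>v\<close> below. It is linear in \<open>f\<close>, so a whole
  relation can be rotated term by term.\<close>

definition plug :: "(edge, vertex) diag \<Rightarrow> ori list \<Rightarrow> ori list \<Rightarrow> (edge, vertex) diag \<Rightarrow>
    ((edge, vertex) diag set \<Rightarrow>\<^sub>0 qring) \<Rightarrow> ((edge, vertex) diag set \<Rightarrow>\<^sub>0 qring)" where
  "plug u l r v f = web.stack_lin (V u)
     (web.stack_lin (web.juxt_lin (V (strands1 l)) (web.juxt_lin f (V (strands1 r)))) (V v))"

lemma plug_linear: "plug u l r v (f + g) = plug u l r v f + plug u l r v g"
  "plug u l r v (smult c f) = smult c (plug u l r v f)"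
  by (simp_all add: plug_def bilinear_ext_add bilinear_ext_smult)

lemma plug_V:
  "is_web b c d \<Longrightarrow> is_web (l @ c @ r) c' u \<Longrightarrow> is_web a' (l @ b @ r) v \<Longrightarrow>
     plug u l r v (V d) = V (u \<cdot> (strands1 l \<otimes> d \<otimes> strands1 r) \<cdot> v)"
  by (simp add: plug_def is_web_def V_stack V_juxt)

lemma moy_eq_plug:
  assumes "moy_eq n b c f g" "is_web (l @ c @ r) c' u" "is_web a' (l @ b @ r) v"
  shows "moy_eq n a' c' (plug u l r v f) (plug u l r v g)"
  unfolding plug_def using assms
  by (intro moy_eq_stack[where b = "l @ c @ r"] moy_eq_stack[where b = "l @ b @ r"] moy_eq_juxt moy_eq_V is_web_strands1)

lemma right_closure: "moy_eq n [x] [x] (V (right_closure x)) (smult (qint (int n - 1)) (V (strands1 [x])))"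
proof -
  let ?p = "plug (strands1 [x] \<otimes> cap1 (flip x)) [x] [x] (cup1 x \<otimes> strands1 [x])"
  have u: "is_web ([x] @ [flip x] @ [x]) [x] (strands1 [x] \<otimes> cap1 (flip x))"
    "is_web [x] ([x] @ [flip x] @ [x]) (cup1 x \<otimes> strands1 [x])" by (simp_all add: is_web_simps)
  have "moy_eq n [x] [x] (?p (V (left_closure (flip x)))) (?p (smult (qint (int n - 1)) (V (strands1 [flip x]))))"
    by (rule moy_eq_plug[OF left_closure u])
  then show ?thesis
    unfolding plug_linear plug_V[OF is_web_closures(1) u] plug_V[OF is_web_strands1 u]
    by (simp add: V_isotopic[OF right_closure_eq] V_isotopic[OF half_turn_strand])
qed

text \<open>Relation (4) for the opposite orientation, placed into the rotating context. After the
  rotation the factor [n-2] belongs to the cup above the cap.\<close>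

lemma rotated_square: "moy_eq n [x, flip x] [x, flip x] (V (T (flip x) \<cdot> T x))
    (V (strands1 [x, flip x]) + smult (qint (int n - 2)) (V (cup1 x \<cdot> cap1 x)))"
proof -
  let ?p = "plug (strands1 [x, flip x] \<otimes> cap1 x) [x] [flip x] (cup1 x \<otimes> strands1 [x, flip x])"
  have u: "is_web ([x] @ [flip x, x] @ [flip x]) [x, flip x] (strands1 [x, flip x] \<otimes> cap1 x)"
    "is_web [x, flip x] ([x] @ [flip x, x] @ [flip x]) (cup1 x \<otimes> strands1 [x, flip x])"
    by (simp_all add: is_web_simps)
  have p: "?p (V d) = V (rotate_square x d)" if "is_web [flip x, x] [flip x, x] d" for d
    unfolding plug_V[OF that u] rotate_square_def ..
  have w: "is_web [flip x, x] [flip x, x] (cup1 (flip x) \<cdot> cap1 (flip x))"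
    "is_web [flip x, x] [flip x, x] (strands1 [flip x] \<otimes> strands1 [x])"
    "is_web [flip x, x] [flip x, x] (square (flip x))"
    using is_web_closures(3)[of "flip x"] by (simp_all add: is_web_simps)
  have "moy_eq n [x, flip x] [x, flip x] (?p (V (square (flip x))))
      (?p (V (cup1 (flip x) \<cdot> cap1 (flip x)) + smult (qint (int n - 2)) (V (strands1 [flip x] \<otimes> strands1 [x]))))"
    by (rule moy_eq_plug[OF square[of n "flip x", unfolded flip_flip] u])
  then show ?thesis
    unfolding plug_linear p[OF w(1)] p[OF w(2)] p[OF w(3)] V_isotopic[OF T_T, symmetric]
      V_isotopic[OF rotate_square_cup_cap] V_isotopic[OF rotate_square_strands] .
qed

section \<open>The Reidemeister moves\<close>

abbreviation tval :: "nat \<Rightarrow> (ori, crossing) diag \<Rightarrow> ((edge, vertex) diag set \<Rightarrow>\<^sub>0 qring)" where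
  "tval n \<equiv> diag_value web_kind (\<lambda>x. (x, One)) (crossing_value n)"

lemma tval_simps:
  "tval n (Strands a) = V (strands1 a)" "tval n (Cap x) = V (cap1 x)" "tval n (Cup x) = V (cup1 x)"
  "tval n (d \<cdot> e) = web.stack_lin (tval n d) (tval n e)" "tval n (d \<otimes> e) = web.juxt_lin (tval n d) (tval n e)"
  "tval n (X s x y) = comb (sigma n s x y)"
  by (simp_all add: web.class_single_def strands1_def crossing_value_def)

text \<open>From here on values are computed by \<open>tval_simps\<close> in terms of
  \<open>V\<close> and \<open>comb\<close>, where the defining equations would yield raw isotopy
  classes.\<close>

declare diag_value.simps [simp del]

lemmas V_lin = bilinear_ext_add bilinear_ext_smult smult_add smult_smult V_stack V_juxt

text \<open>\<open>d\<close> stands for the closure of two strands, which is a strand beside a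
  circle, and \<open>e\<close> for the closure of \<open>S\<close>.\<close>

lemma curl_value:
  assumes "moy_eq n [x] [x] (V d) (smult (qint (int n)) (V (strands1 [x])))"
    and "moy_eq n [x] [x] (V e) (smult (qint (int n - 1)) (V (strands1 [x])))"
  shows "moy_eq n [x] [x] (smult (sigma_ratio s * sigma_coeff n s) (V d) + smult (- sigma_coeff n s) (V e))
     (tval n (Strands [x]))"
proof -
  have "smult (sigma_ratio s * sigma_coeff n s) (smult (qint (int n)) (V (strands1 [x]))) +
      smult (- sigma_coeff n s) (smult (qint (int n - 1)) (V (strands1 [x]))) =
      smult (sigma_coeff n s * (sigma_ratio s * qint (int n) - qint (int n - 1))) (V (strands1 [x]))"
    by (simp add: smult_smult algebra_simps flip: smult_plus)
  also have "\<dots> = tval n (Strands [x])" by (simp add: curl_coeff smult_one tval_simps)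
  finally show ?thesis using moy_eq_add[OF moy_eq_smult moy_eq_smult, OF assms] by metis
qed

lemma curl_right:
  "moy_eq n [x] [x] (tval n ((Strands [x] \<otimes> Cap x) \<cdot> (X s x x \<otimes> Strands [flip x]) \<cdot> (Strands [x] \<otimes> Cup x)))
     (tval n (Strands [x]))"
proof -
  have "moy_eq n [x] [x] (V (strands1 [x] \<otimes> (cap1 x \<cdot> cup1 x))) (smult (qint (int n)) (V (strands1 [x])))"
    using moy_eq_juxt[OF moy_eq_V[OF is_web_strands1[of "[x]"]] circle[of n x]]
      V_isotopic[OF isotopic.juxt_right[of web_kind "strands1 [x]"]] by (simp add: V_lin) (simp add: strands1_def)
  from curl_value[OF this right_closure, of s] show ?thesis
    by (simp add: tval_simps comb_sigma_parallel V_lin right_closure_def V_isotopic[OF curl_strands(1)])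
qed

lemma curl_left:
  "moy_eq n [x] [x]
     (tval n ((Cap (flip x) \<otimes> Strands [x]) \<cdot> (Strands [flip x] \<otimes> X s x x) \<cdot> (Cup (flip x) \<otimes> Strands [x])))
     (tval n (Strands [x]))"
proof -
  have "moy_eq n [x] [x] (V ((cap1 (flip x) \<cdot> cup1 (flip x)) \<otimes> strands1 [x])) (smult (qint (int n)) (V (strands1 [x])))"
    using moy_eq_juxt[OF circle[of n "flip x"] moy_eq_V[OF is_web_strands1[of "[x]"]]]
      V_isotopic[OF isotopic.juxt_left[of web_kind "strands1 [x]"]] by (simp add: V_lin) (simp add: strands1_def)
  from curl_value[OF this left_closure, of s] show ?thesis
    by (simp add: tval_simps comb_sigma_parallel V_lin left_closure_def V_isotopic[OF curl_strands(2)])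
qed

lemma V_strands_stack:
  "wf_diag web_kind d \<Longrightarrow> tgt web_kind d = edges1 a \<Longrightarrow> V (strands1 a \<cdot> d) = V d"
  "wf_diag web_kind d \<Longrightarrow> src web_kind d = edges1 a \<Longrightarrow> V (d \<cdot> strands1 a) = V d"
  using V_isotopic[OF isotopic.stack_top[of web_kind d]] V_isotopic[OF isotopic.stack_bottom[of web_kind d]]
  by (simp_all add: strands1_def)

text \<open>Up to leading powers this is the product (p' id - S) (p id - S) with p p' = 1 and p + p'
  = q + 1/q; the second equation makes the terms in \<open>S\<close> cancel against S^2.\<close>

lemma cancel_parallel:
  "moy_eq n [x, x] [x, x] (tval n (X (\<not> s) x x \<cdot> X s x x)) (tval n (Strands [x, x]))"
proof -
  let ?b = "sigma_coeff n s" and ?p = "sigma_ratio s" and ?b' = "sigma_coeff n (\<not> s)" and ?p' = "sigma_ratio (\<not> s)"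
  let ?I = "strands1 [x, x]"
  have 1: "tval n (X (\<not> s) x x \<cdot> X s x x) =
      smult (?p' * ?b' * (?p * ?b)) (V ?I) + smult (- (?p' * ?b' * ?b)) (V (S x)) +
      (smult (- (?b' * (?p * ?b))) (V (S x)) + smult (?b' * ?b) (V (S x \<cdot> S x)))"
    by (simp add: tval_simps comb_sigma_parallel V_lin V_strands_stack ac_simps)
  have 2: "moy_eq n [x, x] [x, x] (tval n (X (\<not> s) x x \<cdot> X s x x))
      (smult (?p' * ?b' * (?p * ?b)) (V ?I) + smult (- (?p' * ?b' * ?b)) (V (S x)) +
      (smult (- (?b' * (?p * ?b))) (V (S x)) + smult (?b' * ?b) (smult (q + q_inv) (V (S x)))))"
    unfolding 1 by (intro moy_eq_add moy_eq_smult S_S moy_eq_V) simp_all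
  have "smult (?p' * ?b' * (?p * ?b)) (V ?I) + smult (- (?p' * ?b' * ?b)) (V (S x)) +
      (smult (- (?b' * (?p * ?b))) (V (S x)) + smult (?b' * ?b) (smult (q + q_inv) (V (S x)))) =
      smult (?p * ?p' * (?b * ?b')) (V ?I) +
      smult (?b * ?b' * (q + q_inv - (?p + ?p'))) (V (S x))"
    by (rule poly_mapping_eqI) (simp add: lookup_add lookup_smult algebra_simps)
  also have "\<dots> = tval n (Strands [x, x])"
    by (simp add: sigma_ratio_simps sigma_coeff_inverse smult_one smult_zero tval_simps)
  finally show ?thesis using 2 by simp
qed

text \<open>Of the four products, cup and cap twice enclose a circle, the two mixed ones contain a
  closure of \<open>S\<close>, and \<open>T\<close> twice is the rotated square. The strands survive
  with coefficient 1, and a cup above a cap has coefficient [n] - (q + 1/q) [n-1] + [n-2] =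
  0.\<close>

lemma cancel_antiparallel:
  "moy_eq n [x, flip x] [x, flip x] (tval n (X (\<not> s) (flip x) x \<cdot> X s x (flip x))) (tval n (Strands [x, flip x]))"
proof -
  let ?b = "sigma_coeff n s" and ?p = "sigma_ratio s" and ?b' = "sigma_coeff n (\<not> s)" and ?p' = "sigma_ratio (\<not> s)"
  let ?y = "flip x" and ?n = "qint (int n)" and ?n1 = "qint (int n - 1)" and ?n2 = "qint (int n - 2)"
  let ?I = "strands1 [x]" and ?J = "strands1 [flip x]"
  let ?u = "cup1 x \<cdot> cap1 x"
  have s: "tval n (X s x ?y) = smult (?p' * ?b') (V (cup1 ?y \<cdot> cap1 x)) + smult (- ?b') (V (T x))"
    by (simp add: tval_simps comb_sigma_antiparallel)
  have s': "tval n (X (\<not> s) ?y x) = smult (?p * ?b) (V (cup1 x \<cdot> cap1 ?y)) + smult (- ?b) (V (T ?y))"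
    using comb_sigma_antiparallel[of n "\<not> s" ?y] by (simp add: tval_simps)
  have c: "V (cap1 x \<cdot> (?I \<otimes> ?J)) = V (cap1 x)" "V ((?I \<otimes> ?J) \<cdot> cup1 x) = V (cup1 x)"
    by (rule V_isotopic, rule web.isotopic_by_moves[of _ _ "[]" "[]"], simp_all add: strands1_def)+
  have 1: "moy_eq n [x, ?y] [x, ?y] (V ((cup1 x \<cdot> cap1 ?y) \<cdot> (cup1 ?y \<cdot> cap1 x))) (smult ?n (V ?u))"
  proof -
    have "isotopic web_kind ((cup1 x \<cdot> cap1 ?y) \<cdot> (cup1 ?y \<cdot> cap1 x)) (cup1 x \<cdot> (cap1 ?y \<cdot> cup1 ?y) \<cdot> cap1 x)"
      by (rule web.isotopic_by_moves[of _ _ "[]" "[]"]) simp_all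
    then have "V ((cup1 x \<cdot> cap1 ?y) \<cdot> (cup1 ?y \<cdot> cap1 x)) =
        web.stack_lin (V (cup1 x)) (web.stack_lin (V (cap1 ?y \<cdot> cup1 ?y)) (V (cap1 x)))"
      using V_isotopic by (simp add: V_stack)
    also have "moy_eq n [x, ?y] [x, ?y] \<dots>
        (web.stack_lin (V (cup1 x)) (web.stack_lin (smult ?n (V (strands1 []))) (V (cap1 x))))"
      using circle[of n ?y] by (intro moy_eq_stack[where b = "[]"] moy_eq_V) simp_all
    finally show ?thesis by (simp add: V_lin V_strands_stack)
  qed
  have 2: "moy_eq n [x, ?y] [x, ?y] (V ((cup1 x \<cdot> cap1 ?y) \<cdot> T x)) (smult ?n1 (V ?u))"
  proof -
    have "isotopic web_kind ((cup1 x \<cdot> cap1 ?y) \<cdot> T x) (cup1 x \<cdot> cap1 ?y \<cdot> T x)"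
      by (rule isotopic.stack_assoc) simp
    then have "V ((cup1 x \<cdot> cap1 ?y) \<cdot> T x) = web.stack_lin (V (cup1 x)) (V (cap1 ?y \<cdot> T x))"
      using V_isotopic by (simp add: V_stack)
    also have "\<dots> = web.stack_lin (V (cup1 x)) (web.stack_lin (V (cap1 x)) (web.juxt_lin (V (left_closure x)) (V ?J)))"
      using is_web_closures(1)[of x] by (simp add: V_isotopic[OF cap_T] V_stack V_juxt is_web_def)
    also have "moy_eq n [x, ?y] [x, ?y] \<dots>
        (web.stack_lin (V (cup1 x)) (web.stack_lin (V (cap1 x)) (web.juxt_lin (smult ?n1 (V ?I)) (V ?J))))"
      using moy_eq_juxt[OF left_closure[of n x] moy_eq_V[OF is_web_strands1[of "[?y]"]]]
      by (intro moy_eq_stack[where b = "[]"] moy_eq_stack[where b = "[x, ?y]"] moy_eq_V) simp_all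
    finally show ?thesis by (simp add: V_lin c)
  qed
  have 3: "moy_eq n [x, ?y] [x, ?y] (V (T ?y \<cdot> (cup1 ?y \<cdot> cap1 x))) (smult ?n1 (V ?u))"
  proof -
    have "isotopic web_kind ((T ?y \<cdot> cup1 ?y) \<cdot> cap1 x) (T ?y \<cdot> cup1 ?y \<cdot> cap1 x)"
      by (rule isotopic.stack_assoc) simp
    then have "V (T ?y \<cdot> cup1 ?y \<cdot> cap1 x) = web.stack_lin (V (T ?y \<cdot> cup1 ?y)) (V (cap1 x))"
      using V_isotopic by (simp add: V_stack)
    also have "\<dots> = web.stack_lin (web.stack_lin (web.juxt_lin (V ?I) (V (right_closure ?y))) (V (cup1 x))) (V (cap1 x))"
      using V_isotopic[OF T_cup[of ?y]] is_web_closures(2)[of ?y] by (simp add: V_stack V_juxt is_web_def)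
    also have "moy_eq n [x, ?y] [x, ?y] \<dots>
        (web.stack_lin (web.stack_lin (web.juxt_lin (V ?I) (smult ?n1 (V ?J))) (V (cup1 x))) (V (cap1 x)))"
      using moy_eq_juxt[OF moy_eq_V[OF is_web_strands1[of "[x]"]] right_closure[of n ?y]]
      by (intro moy_eq_stack[where b = "[]"] moy_eq_stack[where b = "[x, ?y]"] moy_eq_V) simp_all
    finally show ?thesis by (simp add: V_lin c)
  qed
  have 4: "moy_eq n [x, ?y] [x, ?y] (V (T ?y \<cdot> T x)) (V (strands1 [x, ?y]) + smult ?n2 (V ?u))"
    by (rule rotated_square)
  have 5: "tval n (X (\<not> s) ?y x \<cdot> X s x ?y) =
      smult (?p * ?b * (?p' * ?b')) (V ((cup1 x \<cdot> cap1 ?y) \<cdot> (cup1 ?y \<cdot> cap1 x))) +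
      smult (- (?p * ?b * ?b')) (V ((cup1 x \<cdot> cap1 ?y) \<cdot> T x)) +
      smult (- (?b * (?p' * ?b'))) (V (T ?y \<cdot> (cup1 ?y \<cdot> cap1 x))) + smult (?b * ?b') (V (T ?y \<cdot> T x))"
    unfolding tval_simps(4) s s' by (simp add: V_lin ac_simps)
  have 6: "moy_eq n [x, ?y] [x, ?y] (tval n (X (\<not> s) ?y x \<cdot> X s x ?y))
      (smult (?p * ?b * (?p' * ?b')) (smult ?n (V ?u)) +
      smult (- (?p * ?b * ?b')) (smult ?n1 (V ?u)) +
      smult (- (?b * (?p' * ?b'))) (smult ?n1 (V ?u)) +
      smult (?b * ?b') (V (strands1 [x, ?y]) + smult ?n2 (V ?u)))"
    unfolding 5 by (intro moy_eq_add moy_eq_smult 1 2 3 4)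
  have "smult (?p * ?b * (?p' * ?b')) (smult ?n (V ?u)) + smult (- (?p * ?b * ?b')) (smult ?n1 (V ?u)) +
      smult (- (?b * (?p' * ?b'))) (smult ?n1 (V ?u)) + smult (?b * ?b') (V (strands1 [x, ?y]) + smult ?n2 (V ?u)) =
      smult (?b * ?b') (V (strands1 [x, ?y])) +
      smult (?b * ?b' * (?p * ?p' * ?n - (?p + ?p') * ?n1 + ?n2)) (V ?u)" (is "?L = _")
    by (rule poly_mapping_eqI) (simp add: lookup_add lookup_smult algebra_simps)
  also have "?p * ?p' * ?n - (?p + ?p') * ?n1 + ?n2 = 0"
    using qint_recursion[of "int n"] by (simp add: sigma_ratio_simps algebra_simps)
  also have "smult (?b * ?b') (V (strands1 [x, ?y])) + smult (?b * ?b' * 0) (V ?u) = tval n (Strands [x, ?y])"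
    by (simp add: sigma_coeff_inverse smult_one smult_zero tval_simps(1))
  finally have "?L = tval n (Strands [x, ?y])" .
  from 6[unfolded this] show ?thesis .
qed

text \<open>As (q + 1/q) p_t = p_t^2 + 1, the left side equals - (p_t - p_s) (p_t - p_u). For truth
  values the hypothesis says that t is s or u.\<close>

lemma sigma_ratio_braid:
  assumes "s = u \<longrightarrow> t = s"
  shows "sigma_ratio u * sigma_ratio t + sigma_ratio t * sigma_ratio s - sigma_ratio s * sigma_ratio u -
     (q + q_inv) * sigma_ratio t + 1 = 0"
  using assms q_q_inv by (cases s; cases t; cases u) (simp_all add: sigma_ratio_def algebra_simps)

text \<open>Both sides are expanded into products of A and B, the copies of \<open>S\<close> on the
  first two and on the last two strands. Relations (2) and (5) reduce the squares and ABA, after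
  which only a multiple of A - B remains to be compared.\<close>

lemma braid_parallel:
  assumes stu: "s = u \<longrightarrow> t = s"
  shows "moy_eq n [x, x, x] [x, x, x]
     (tval n ((X u x x \<otimes> Strands [x]) \<cdot> (Strands [x] \<otimes> X t x x) \<cdot> (X s x x \<otimes> Strands [x])))
     (tval n ((Strands [x] \<otimes> X s x x) \<cdot> (X t x x \<otimes> Strands [x]) \<cdot> (Strands [x] \<otimes> X u x x)))"
proof -
  let ?I = "strands1 [x]" and ?E = "strands1 [x, x, x]"
  define A where "A = S x \<otimes> ?I"
  define B where "B = ?I \<otimes> S x"
  have AB: "wf_diag web_kind A" "src web_kind A = edges1 [x, x, x]" "tgt web_kind A = edges1 [x, x, x]"
    "wf_diag web_kind B" "src web_kind B = edges1 [x, x, x]" "tgt web_kind B = edges1 [x, x, x]"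
    by (simp_all add: A_def B_def)
  have w: "is_web [x, x, x] [x, x, x] A" "is_web [x, x, x] [x, x, x] B"
    using is_web_juxt[OF is_web_S[of x] is_web_strands1[of "[x]"]] is_web_juxt[OF is_web_strands1[of "[x]"] is_web_S[of x]]
    by (simp_all add: A_def B_def)
  have E: "V (strands1 [x, x] \<otimes> ?I) = V ?E" "V (?I \<otimes> strands1 [x, x]) = V ?E"
    using V_isotopic[OF isotopic.strands[of web_kind "edges1 [x, x]" "edges1 [x]"]]
      V_isotopic[OF isotopic.strands[of web_kind "edges1 [x]" "edges1 [x, x]"]] by (simp_all add: strands1_def)
  let ?b = "sigma_coeff n" and ?p = "sigma_ratio"
  have xa: "tval n (X s x x \<otimes> Strands [x]) = smult (?p s * ?b s) (V ?E) + smult (- ?b s) (V A)"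
    and xb: "tval n (Strands [x] \<otimes> X s x x) = smult (?p s * ?b s) (V ?E) + smult (- ?b s) (V B)" for s
    by (simp_all add: tval_simps comb_sigma_parallel V_lin E A_def B_def)
  have AA: "moy_eq n [x, x, x] [x, x, x] (V (A \<cdot> A)) (smult (q + q_inv) (V A))"
  proof -
    have "isotopic web_kind (A \<cdot> A) ((S x \<cdot> S x) \<otimes> ?I)"
      unfolding A_def strands1_def by (rule web.whisker_right) simp
    then have "V (A \<cdot> A) = web.juxt_lin (V (S x \<cdot> S x)) (V ?I)" using V_isotopic by (simp add: V_juxt)
    then show ?thesis
      using moy_eq_juxt[OF S_S[of n x] moy_eq_V[OF is_web_strands1[of "[x]"]]] by (simp add: V_lin A_def)
  qed
  have BB: "moy_eq n [x, x, x] [x, x, x] (V (B \<cdot> B)) (smult (q + q_inv) (V B))"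
  proof -
    have "isotopic web_kind (B \<cdot> B) (?I \<otimes> (S x \<cdot> S x))"
      unfolding B_def strands1_def by (rule web.whisker_left) simp
    then have "V (B \<cdot> B) = web.juxt_lin (V ?I) (V (S x \<cdot> S x))" using V_isotopic by (simp add: V_juxt)
    then show ?thesis
      using moy_eq_juxt[OF moy_eq_V[OF is_web_strands1[of "[x]"]] S_S[of n x]] by (simp add: V_lin B_def)
  qed
  define c where "c = ?b u * ?b t * ?b s"
  \<comment> \<open>The common shape of both expansions: \<open>M\<close> is the generator that
    occurs twice on the side in question, \<open>N\<close> the other one, \<open>f\<close> the
    square of \<open>M\<close> and \<open>g\<close> the cubic term.\<close>
  let ?f = "\<lambda>M N f g. smult (c * ?p u * ?p t * ?p s) (V ?E) + smult (- c * ?p t * (?p u + ?p s)) (V M) +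
    smult (- c * ?p u * ?p s) (V N) + smult (c * ?p t) f + smult (c * ?p u) (V (B \<cdot> A)) +
    smult (c * ?p s) (V (A \<cdot> B)) + smult (- c) g"
  let ?BAB = "V (B \<cdot> A \<cdot> B)"
  have l: "tval n ((X u x x \<otimes> Strands [x]) \<cdot> (Strands [x] \<otimes> X t x x) \<cdot> (X s x x \<otimes> Strands [x])) =
      ?f A B (V (A \<cdot> A)) (V (A \<cdot> B \<cdot> A))"
    and r: "tval n ((Strands [x] \<otimes> X s x x) \<cdot> (X t x x \<otimes> Strands [x]) \<cdot> (Strands [x] \<otimes> X u x x)) =
      ?f B A (V (B \<cdot> B)) ?BAB"
    by (rule poly_mapping_eqI,
        simp add: tval_simps(4) xa xb V_lin V_strands_stack AB c_def lookup_add lookup_smult algebra_simps)+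
  have step1: "moy_eq n [x, x, x] [x, x, x] (?f A B (V (A \<cdot> A)) (V (A \<cdot> B \<cdot> A)))
      (?f A B (smult (q + q_inv) (V A)) (?BAB + V A + smult (- 1) (V B)))"
    using S_braid[of n x]
    by (intro moy_eq_add moy_eq_smult AA moy_eq_V is_web_stack[OF w(1,2)] is_web_stack[OF w(2,1)] w is_web_strands1)
      (simp_all add: A_def B_def)
  have step2: "?f A B (smult (q + q_inv) (V A)) (?BAB + V A + smult (- 1) (V B)) =
      ?f B A (smult (q + q_inv) (V B)) ?BAB" (is "?L = ?R")
  proof (rule poly_mapping_eqI)
    fix k
    \<comment> \<open>The coefficients of A and B differ by opposite amounts, both governed by the
      identity for the ratios.\<close>
    have "lookup ?L k - lookup ?R k =
        - c * (?p u * ?p t + ?p t * ?p s - ?p s * ?p u - (q + q_inv) * ?p t + 1) *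
          (lookup (V A) k - lookup (V B) k)"
      by (simp add: lookup_add lookup_smult algebra_simps)
    then show "lookup ?L k = lookup ?R k"
      by (simp add: sigma_ratio_braid[OF stu])
  qed
  have step3: "moy_eq n [x, x, x] [x, x, x] (?f B A (smult (q + q_inv) (V B)) ?BAB) (?f B A (V (B \<cdot> B)) ?BAB)"
    by (intro moy_eq_add moy_eq_smult moy_eq_sym[OF BB] moy_eq_V is_web_stack[OF w(1,2)] is_web_stack[OF w(2,1)] w
        is_web_stack[OF w(2) is_web_stack[OF w(1,2)]] is_web_strands1)
  show ?thesis unfolding l r by (rule moy_eq_trans[OF step1[unfolded step2] step3])
qed

section \<open>Tangles with equal images in \<open>MOY\<close>, and the third Reidemeister move for
  all orientations\<close>

definition tangle_eq :: "nat \<Rightarrow> (ori, crossing) diag \<Rightarrow> (ori, crossing) diag \<Rightarrow> bool" where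
  "tangle_eq n d e \<longleftrightarrow> wf_diag tangle_kind d \<and> wf_diag tangle_kind e \<and>
     src tangle_kind d = src tangle_kind e \<and> tgt tangle_kind d = tgt tangle_kind e \<and>
     moy_eq n (src tangle_kind d) (tgt tangle_kind d) (tval n d) (tval n e)"

lemma web_lin_tval: "wf_diag tangle_kind d \<Longrightarrow> web_lin (src tangle_kind d) (tgt tangle_kind d) (tval n d)"
  using webs.keys_val by (simp add: web_lin_def)

lemma tangle_eq_isotopic: "isotopic tangle_kind d e \<Longrightarrow> tangle_eq n d e"
  using tangle.isotopic_wf[of d e] webs.val_isotopic[of d e n] moy_eq_refl[OF web_lin_tval[of d], of n n]
  by (simp add: tangle_eq_def)

lemma tangle_eq_sym: "tangle_eq n d e \<Longrightarrow> tangle_eq n e d"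
  by (auto simp: tangle_eq_def intro: moy_eq_sym)

lemma tangle_eq_trans [trans]: "tangle_eq n d e \<Longrightarrow> tangle_eq n e f \<Longrightarrow> tangle_eq n d f"
  by (auto simp: tangle_eq_def intro: moy_eq_trans)

lemma tangle_eq_refl: "wf_diag tangle_kind d \<Longrightarrow> tangle_eq n d d"
  by (rule tangle_eq_isotopic[OF isotopic.refl])

lemma tangle_eq_stack:
  "tangle_eq n d d' \<Longrightarrow> tangle_eq n e e' \<Longrightarrow> src tangle_kind d = tgt tangle_kind e \<Longrightarrow>
     tangle_eq n (d \<cdot> e) (d' \<cdot> e')"
  by (auto simp: tangle_eq_def tval_simps(4) intro: moy_eq_stack)

lemma tangle_eq_juxt: "tangle_eq n d d' \<Longrightarrow> tangle_eq n e e' \<Longrightarrow> tangle_eq n (d \<otimes> e) (d' \<otimes> e')"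
  by (auto simp: tangle_eq_def tval_simps(5) intro: moy_eq_juxt)

lemma reidemeister2: "tangle_eq n (X (\<not> s) y x \<cdot> X s x y) (Strands [x, y])"
proof (cases "y = x")
  case True
  then show ?thesis using cancel_parallel by (simp add: tangle_eq_def)
next
  case False
  then have "y = flip x" by (cases x; cases y) simp_all
  then show ?thesis using cancel_antiparallel by (simp add: tangle_eq_def)
qed

lemma reidemeister2_whiskered:
  assumes "tangle_eq n (d \<cdot> e) (Strands b)" "wf_diag tangle_kind (d \<cdot> e)"
  shows "tangle_eq n ((d \<otimes> Strands c) \<cdot> (e \<otimes> Strands c)) (Strands (b @ c))"
    and "tangle_eq n ((Strands c \<otimes> d) \<cdot> (Strands c \<otimes> e)) (Strands (c @ b))"
proof -
  have "tangle_eq n ((d \<otimes> Strands c) \<cdot> (e \<otimes> Strands c)) ((d \<cdot> e) \<otimes> Strands c)"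
    by (rule tangle_eq_isotopic[OF tangle.whisker_right[OF assms(2)]])
  also have "tangle_eq n \<dots> (Strands b \<otimes> Strands c)"
    by (rule tangle_eq_juxt[OF assms(1)]) (simp add: tangle_eq_refl)
  also have "tangle_eq n \<dots> (Strands (b @ c))" by (rule tangle_eq_isotopic[OF isotopic.strands])
  finally show "tangle_eq n ((d \<otimes> Strands c) \<cdot> (e \<otimes> Strands c)) (Strands (b @ c))" .
  have "tangle_eq n ((Strands c \<otimes> d) \<cdot> (Strands c \<otimes> e)) (Strands c \<otimes> (d \<cdot> e))"
    by (rule tangle_eq_isotopic[OF tangle.whisker_left[OF assms(2)]])
  also have "tangle_eq n \<dots> (Strands c \<otimes> Strands b)"
    by (rule tangle_eq_juxt[OF _ assms(1)]) (simp add: tangle_eq_refl)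
  also have "tangle_eq n \<dots> (Strands (c @ b))" by (rule tangle_eq_isotopic[OF isotopic.strands])
  finally show "tangle_eq n ((Strands c \<otimes> d) \<cdot> (Strands c \<otimes> e)) (Strands (c @ b))" .
qed

text \<open>From m a = b k one gets k a' = b' m by multiplying with a left inverse of b on top and a
  right inverse of a below.\<close>

lemma tangle_eq_conjugate:
  assumes e: "tangle_eq n (m \<cdot> a) (b \<cdot> k)"
    and b: "tangle_eq n (b' \<cdot> b) (Strands (src tangle_kind b))" and a: "tangle_eq n (a \<cdot> a') (Strands (tgt tangle_kind a))"
  shows "tangle_eq n (k \<cdot> a') (b' \<cdot> m)"
proof -
  note w = e[unfolded tangle_eq_def] b[unfolded tangle_eq_def] a[unfolded tangle_eq_def]
  have "tangle_eq n (k \<cdot> a') (Strands (src tangle_kind b) \<cdot> (k \<cdot> a'))"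
    using w isotopic.stack_top[of tangle_kind "k \<cdot> a'"] by (intro tangle_eq_sym[OF tangle_eq_isotopic]) auto
  also have "tangle_eq n \<dots> ((b' \<cdot> b) \<cdot> (k \<cdot> a'))"
    using w by (intro tangle_eq_stack tangle_eq_sym[OF b] tangle_eq_refl) auto
  also have "tangle_eq n \<dots> (b' \<cdot> ((b \<cdot> k) \<cdot> a'))"
    \<comment> \<open>Reassociation leaves the list of layers unchanged, hence the empty move
      lists.\<close>
    using w by (intro tangle_eq_isotopic tangle.isotopic_by_moves[of _ _ "[]" "[]"]) auto
  also have "tangle_eq n \<dots> (b' \<cdot> ((m \<cdot> a) \<cdot> a'))"
    using w by (intro tangle_eq_stack tangle_eq_sym[OF e] tangle_eq_refl) auto
  also have "tangle_eq n \<dots> ((b' \<cdot> m) \<cdot> (a \<cdot> a'))"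
    using w by (intro tangle_eq_isotopic tangle.isotopic_by_moves[of _ _ "[]" "[]"]) auto
  also have "tangle_eq n \<dots> ((b' \<cdot> m) \<cdot> Strands (tgt tangle_kind a))"
    using w by (intro tangle_eq_stack a tangle_eq_refl) auto
  also have "tangle_eq n \<dots> (b' \<cdot> m)"
    using w isotopic.stack_bottom[of tangle_kind "b' \<cdot> m"] by (intro tangle_eq_isotopic) auto
  finally show ?thesis .
qed

definition braid_relation :: "nat \<Rightarrow> bool \<Rightarrow> bool \<Rightarrow> bool \<Rightarrow> ori \<Rightarrow> ori \<Rightarrow> ori \<Rightarrow> bool" where
  "braid_relation n s t u x y z \<longleftrightarrow> tangle_eq n
     ((X u y z \<otimes> Strands [x]) \<cdot> (Strands [y] \<otimes> X t x z) \<cdot> (X s x y \<otimes> Strands [z]))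
     ((Strands [z] \<otimes> X s x y) \<cdot> (X t x z \<otimes> Strands [y]) \<cdot> (Strands [x] \<otimes> X u y z))"

text \<open>Bending both ends of the first strand makes it the last strand with reversed direction.
  Its two crossings are quarter turned, which negates their signs, and the two sides of the move
  change places.\<close>

lemma braid_relation_rotate:
  assumes "braid_relation n s t u x y z"
  shows "braid_relation n u (\<not> s) (\<not> t) y z (flip x)"
proof -
  let ?r = "\<lambda>d. (Strands [flip x, z, y] \<otimes> Cap x) \<cdot> (Strands [flip x] \<otimes> d \<otimes> Strands [flip x]) \<cdot>
    (Cup (flip x) \<otimes> Strands [y, z, flip x])"
  have q: "tangle_eq n (X (\<not> s) y (flip x)) (quarter_turn flip x y (X s x y))" for s y
    by (rule tangle_eq_sym[OF tangle_eq_isotopic[OF tangle_turns]])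
  have r: "tangle_eq n (?r d) (?r e)"
    if "tangle_eq n d e" "src tangle_kind d = [x, y, z]" "tgt tangle_kind d = [z, y, x]" for d e
    using that(2,3) by (intro tangle_eq_stack tangle_eq_juxt that(1) tangle_eq_refl) simp_all
  have "tangle_eq n
      ((X (\<not> t) z (flip x) \<otimes> Strands [y]) \<cdot> (Strands [z] \<otimes> X (\<not> s) y (flip x)) \<cdot> (X u y z \<otimes> Strands [flip x]))
      ((quarter_turn flip x z (X t x z) \<otimes> Strands [y]) \<cdot> (Strands [z] \<otimes> quarter_turn flip x y (X s x y)) \<cdot>
       (X u y z \<otimes> Strands [flip x]))"
    by (intro tangle_eq_stack tangle_eq_juxt q tangle_eq_refl) simp_all
  also note tangle_eq_isotopic[OF rotate_reidemeister3_left]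
  also have "tangle_eq n (?r ((Strands [z] \<otimes> X s x y) \<cdot> (X t x z \<otimes> Strands [y]) \<cdot> (Strands [x] \<otimes> X u y z)))
      (?r ((X u y z \<otimes> Strands [x]) \<cdot> (Strands [y] \<otimes> X t x z) \<cdot> (X s x y \<otimes> Strands [z])))"
    by (rule r[OF tangle_eq_sym[OF assms[unfolded braid_relation_def]]]) simp_all
  also note tangle_eq_sym[OF tangle_eq_isotopic[OF rotate_reidemeister3_right]]
  also have "tangle_eq n ((Strands [flip x] \<otimes> X u y z) \<cdot> (quarter_turn flip x y (X s x y) \<otimes> Strands [z]) \<cdot>
       (Strands [y] \<otimes> quarter_turn flip x z (X t x z)))
      ((Strands [flip x] \<otimes> X u y z) \<cdot> (X (\<not> s) y (flip x) \<otimes> Strands [z]) \<cdot> (Strands [y] \<otimes> X (\<not> t) z (flip x)))"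
    by (intro tangle_eq_stack tangle_eq_juxt tangle_eq_sym[OF q] tangle_eq_refl) (simp_all add: quarter_turn_def)
  finally show ?thesis unfolding braid_relation_def .
qed

text \<open>The crossing of the first two strands stands at the bottom of one side and at the top of
  the other. Multiplying by its inverse at both ends carries it across, which gives the move for
  these strands in the other order.\<close>

lemma braid_relation_swap_left:
  assumes "braid_relation n s t u x y z"
  shows "braid_relation n (\<not> s) u t y x z"
proof -
  let ?p = "X u y z \<otimes> Strands [x]" and ?q = "Strands [y] \<otimes> X t x z" and ?r = "X s x y \<otimes> Strands [z]"
    and ?p' = "Strands [z] \<otimes> X s x y" and ?q' = "X t x z \<otimes> Strands [y]" and ?r' = "Strands [x] \<otimes> X u y z"
    and ?a = "X (\<not> s) y x \<otimes> Strands [z]" and ?b = "Strands [z] \<otimes> X (\<not> s) y x"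
  have "tangle_eq n ((?p \<cdot> ?q) \<cdot> ?r) (?p \<cdot> ?q \<cdot> ?r)"
    by (intro tangle_eq_isotopic isotopic.stack_assoc) simp
  also note assms[unfolded braid_relation_def]
  finally have e: "tangle_eq n ((?p \<cdot> ?q) \<cdot> ?r) (?p' \<cdot> ?q' \<cdot> ?r')" .
  have b: "tangle_eq n (?b \<cdot> ?p') (Strands (src tangle_kind ?p'))"
    using reidemeister2_whiskered(2)[OF reidemeister2[of n s y x], of "[z]"] by simp
  have a: "tangle_eq n (?r \<cdot> ?a) (Strands (tgt tangle_kind ?r))"
    using reidemeister2_whiskered(1)[OF reidemeister2[of n "\<not> s" x y], of "[z]"] by simp
  have "tangle_eq n (?q' \<cdot> ?r' \<cdot> ?a) ((?q' \<cdot> ?r') \<cdot> ?a)"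
    by (intro tangle_eq_sym[OF tangle_eq_isotopic[OF isotopic.stack_assoc]]) simp
  also note tangle_eq_conjugate[OF e b a]
  finally show ?thesis unfolding braid_relation_def .
qed

lemma braid_relation_swap_right:
  assumes "braid_relation n s t u x y z"
  shows "braid_relation n t s (\<not> u) x z y"
proof -
  let ?p = "X u y z \<otimes> Strands [x]" and ?q = "Strands [y] \<otimes> X t x z" and ?r = "X s x y \<otimes> Strands [z]"
    and ?p' = "Strands [z] \<otimes> X s x y" and ?q' = "X t x z \<otimes> Strands [y]" and ?r' = "Strands [x] \<otimes> X u y z"
    and ?a = "Strands [x] \<otimes> X (\<not> u) z y" and ?b = "X (\<not> u) z y \<otimes> Strands [x]"
  have "tangle_eq n ((?p' \<cdot> ?q') \<cdot> ?r') (?p' \<cdot> ?q' \<cdot> ?r')"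
    by (intro tangle_eq_isotopic isotopic.stack_assoc) simp
  also note tangle_eq_sym[OF assms[unfolded braid_relation_def]]
  finally have e: "tangle_eq n ((?p' \<cdot> ?q') \<cdot> ?r') (?p \<cdot> ?q \<cdot> ?r)" .
  have b: "tangle_eq n (?b \<cdot> ?p) (Strands (src tangle_kind ?p))"
    using reidemeister2_whiskered(1)[OF reidemeister2[of n u z y], of "[x]"] by simp
  have a: "tangle_eq n (?r' \<cdot> ?a) (Strands (tgt tangle_kind ?r'))"
    using reidemeister2_whiskered(2)[OF reidemeister2[of n "\<not> u" y z], of "[x]"] by simp
  have "tangle_eq n (?q \<cdot> ?r \<cdot> ?a) ((?q \<cdot> ?r) \<cdot> ?a)"
    by (intro tangle_eq_sym[OF tangle_eq_isotopic[OF isotopic.stack_assoc]]) simp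
  also note tangle_eq_conjugate[OF e b a]
  finally show ?thesis unfolding braid_relation_def by (rule tangle_eq_sym)
qed

text \<open>Rotating the parallel case reverses the last strand, and two swaps then carry the odd
  strand to the middle and to the front. Among three orientations two always agree, so this covers
  everything. The height condition on the signs is preserved at each stage.\<close>

lemma braid_relation_all:
  assumes "s = u \<longrightarrow> t = s" shows "braid_relation n s t u x y z"
proof -
  have 0: "braid_relation n s t u x x x" if "s = u \<longrightarrow> t = s" for s t u x
    using braid_parallel[OF that] by (simp add: braid_relation_def tangle_eq_def)
  have 1: "braid_relation n s t u x x (flip x)" if "s = u \<longrightarrow> t = s" for s t u x
    using braid_relation_rotate[OF 0[of "\<not> t" s "\<not> u" x]] that by auto
  have 2: "braid_relation n s t u x (flip x) x" if "s = u \<longrightarrow> t = s" for s t u x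
    using braid_relation_swap_right[OF 1[of t "\<not> u" s x]] that by auto
  have 3: "braid_relation n s t u (flip x) x x" if "s = u \<longrightarrow> t = s" for s t u x
    using braid_relation_swap_left[OF 2[of "\<not> s" t u x]] that by auto
  show ?thesis
    using 0[OF assms, of x] 1[OF assms, of x] 2[OF assms, of x] 3[OF assms, of y]
    by (cases x; cases y; cases z) simp_all
qed

lemma reidemeister_tangle_eq: "(d, e) \<in> reidemeister \<Longrightarrow> tangle_eq n d e"
  unfolding reidemeister_def
  by (elim UnE CollectE exE conjE Pair_inject)
    (simp_all add: reidemeister2 braid_relation_all[unfolded braid_relation_def],
     simp_all add: tangle_eq_def curl_right curl_left)

section \<open>The functor from tangles to MOY\<close>

lemma (in tensor_ideal_of) scl_zero_ideal:
  assumes f: "f \<in> I" "f \<in> Hom C a b" shows "scl Q 0 (coset C I f) = coset C I f"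
proof -
  have "sub (scl C 0 f) f \<in> I"
    using f unfolding sub_def I_def
    by (intro tensor_ideal.add[of _ _ _ _ a b] tensor_ideal.scl scl_Hom) simp_all
  then show ?thesis
    by (simp add: quotient_scl[OF f(2)] coset_eq_iff[OF scl_Hom[OF f(2)] f(2)])
qed

definition reidemeister_generators :: "(ori, crossing) lin set" where
  "reidemeister_generators =
     {lin_comb tangle_kind (src tangle_kind d) (tgt tangle_kind d) [(1, d), (-1, e)] | d e. (d, e) \<in> reidemeister}"

lemma tangle_lin_comb_Hom:
  assumes "\<And>c d. (c, d) \<in> set cs \<Longrightarrow> wf_diag tangle_kind d \<and> src tangle_kind d = a \<and> tgt tangle_kind d = b"
  shows "lin_comb tangle_kind a b cs \<in> Hom tangle_diag_cat a b"
proof -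
  have "supp (case p of (c, d) \<Rightarrow> single (iclass tangle_kind d) c)
      \<subseteq> tangle.classes UNIV a b" if "p \<in> set cs" for p
    using that assms[of "fst p" "snd p"] tangle.iclass_classes[of "snd p"]
    by (auto split: prod.splits if_splits)
  then show ?thesis unfolding tangle.diag_cat_Hom lin_comb_def by (simp add: keys_sum_list_subset)
qed

interpretation td: tensor_ideal_of tangle_diag_cat reidemeister_generators
  rewrites "tensor_ideal_of.I tangle_diag_cat reidemeister_generators = reidemeister_ideal"
    and "quotient tangle_diag_cat reidemeister_ideal = TD"
    and "coset tangle_diag_cat reidemeister_ideal = td_class"
proof -
  show 1: "tensor_ideal_of tangle_diag_cat reidemeister_generators"
  proof
    show "reidemeister_generators \<subseteq> Mor tangle_diag_cat"
    proof
      fix g assume "g \<in> reidemeister_generators"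
      then obtain d e where g: "g = lin_comb tangle_kind (src tangle_kind d) (tgt tangle_kind d) [(1, d), (-1, e)]"
        and de: "(d, e) \<in> reidemeister" unfolding reidemeister_generators_def by blast
      \<comment> \<open>Any value of \<open>n\<close> would do: the fact is used for well-formedness
        and equality of the boundaries.\<close>
      have "tangle_eq 0 d e" by (rule reidemeister_tangle_eq[OF de])
      then show "g \<in> Mor tangle_diag_cat"
        unfolding g tangle_eq_def by (intro tangle.MorI[OF tangle_lin_comb_Hom]) auto
    qed
  qed
  show "tensor_ideal_of.I tangle_diag_cat reidemeister_generators = reidemeister_ideal"
    unfolding reidemeister_ideal_def reidemeister_generators_def[symmetric] by (rule tensor_ideal_of.I_def[OF 1])
qed (simp_all add: TD_def td_class_def)

definition jones_generators :: "nat \<Rightarrow> (ori, crossing) lin set set" where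
  "jones_generators n =
     {td_class (lin_comb tangle_kind [Up, Up] [Up, Up]
        [(qpow (- int n), X True Up Up), (- qpow (int n), X False Up Up),
         (- (q_inv - q), Strands [Up, Up])])} \<union>
      {td_class (lin_comb tangle_kind [] [] [(1, Cap x \<cdot> Cup x), (- qint (int n), Strands [])])
        | x. True}"

lemma skein_Hom: "lin_comb tangle_kind [Up, Up] [Up, Up]
    [(qpow (- int n), X True Up Up), (- qpow (int n), X False Up Up), (- (q_inv - q), Strands [Up, Up])]
    \<in> Hom tangle_diag_cat [Up, Up] [Up, Up]"
  by (rule tangle_lin_comb_Hom) auto

lemma unknot_Hom: "lin_comb tangle_kind [] [] [(1, Cap x \<cdot> Cup x), (- qint (int n), Strands [])]
    \<in> Hom tangle_diag_cat [] []"
  by (rule tangle_lin_comb_Hom) auto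

interpretation jones: tensor_ideal_of TD "jones_generators n"
  rewrites "tensor_ideal_of.I TD (jones_generators n) = jones_ideal n"
    and "quotient TD (jones_ideal n) = Jones n" for n
proof -
  show 1: "tensor_ideal_of TD (jones_generators n)"
  proof (rule tensor_ideal_of.intro[OF td.quot.linear_tensor_cat_axioms])
    show "tensor_ideal_of_axioms TD (jones_generators n)"
      using td.quot.MorI[OF td.coset_Hom[OF skein_Hom]] td.quot.MorI[OF td.coset_Hom[OF unknot_Hom]]
      by unfold_locales (auto simp: jones_generators_def)
  qed
  show "tensor_ideal_of.I TD (jones_generators n) = jones_ideal n"
    unfolding jones_ideal_def jones_generators_def[symmetric] by (rule tensor_ideal_of.I_def[OF 1])
qed (simp add: Jones_def)

lemma moy_quotient: "quotient TrPD (moy_ideal n) = MOY n"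
  by (simp add: MOY_def)

lemma MOY_linear: "linear_tensor_cat (MOY n)"
  using moy.quot.linear_tensor_cat_axioms[of n] by (simp add: moy_quotient)

text \<open>Defined on diagrams before the Reidemeister moves are imposed, so that these become
  generators to be killed.\<close>

definition tangle_functor :: "nat \<Rightarrow> (ori, (ori, crossing) lin, edge, (edge, vertex) lin set) func" where
  "tangle_functor n = func_comp tangle_diag_cat (quotient_functor TrPD (moy_ideal n)) (webs.dfunctor n)"

lemma tangle_functor_linear: "linear_monoidal_functor tangle_diag_cat (MOY n) (tangle_functor n)"
proof -
  have "linear_monoidal_functor TrPD (MOY n) (quotient_functor TrPD (moy_ideal n))"
    using moy.quotient_functor_linear[of n] web.Os_append unfolding moy_quotient web.diag_cat_simps(1)
    by (metis range_eqI list.map(1))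
  then show ?thesis unfolding tangle_functor_def
    by (intro func_comp_linear[OF tangle.linear_tensor_cat_axioms web.linear_tensor_cat_axioms webs.dfunctor_linear])
      (simp_all add: tangle.diag_cat_simps)
qed

lemma tangle_functor_obj: "fobj (tangle_functor n) = edges1"
  by (auto simp: tangle_functor_def func_comp_def webs.dfunctor_obj quotient_functor_def
      tangle.diag_cat_simps web.diag_cat_simps)

lemma tangle_functor_lin_comb:
  assumes "\<And>c d. (c, d) \<in> set cs \<Longrightarrow> wf_diag tangle_kind d \<and> src tangle_kind d = a \<and> tgt tangle_kind d = b"
  shows "fmor (tangle_functor n) (lin_comb tangle_kind a b cs) =
    coset TrPD (moy_ideal n) (edges1 a, edges1 b, \<Sum>(c, d)\<leftarrow>cs. smult c (tval n d))"
proof -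
  have H: "lin_comb tangle_kind a b cs \<in> Hom tangle_diag_cat a b"
    by (rule tangle_lin_comb_Hom) (rule assms)
  have f: "webs.lin_val n (\<Sum>(c, d)\<leftarrow>cs. single (iclass tangle_kind d) c) = (\<Sum>(c, d)\<leftarrow>cs. smult c (tval n d))"
    using assms unfolding additive_sum_list[OF webs.additive_lin_val[OF additive_bilinear_ext(3)]]
    by (auto intro!: arg_cong[of _ _ sum_list] simp: webs.lin_val_single)
  have "fmor (webs.dfunctor n) (lin_comb tangle_kind a b cs) = (edges1 a, edges1 b, \<Sum>(c, d)\<leftarrow>cs. smult c (tval n d))"
    using H webs.dfunctor_apply[of a b _ n] f by (simp add: lin_comb_def)
  moreover from this have "(edges1 a, edges1 b, \<Sum>(c, d)\<leftarrow>cs. smult c (tval n d)) \<in> Mor TrPD"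
    using linear_functorD(2)[OF webs.dfunctor_linear[of n] _ _ H]
    by (intro web.MorI[of _ "edges1 a" "edges1 b"]) (simp add: tangle.diag_cat_simps webs.dfunctor_obj)
  ultimately show ?thesis
    using tangle.MorI[OF H] by (simp add: tangle_functor_def func_comp_def quotient_functor_def)
qed

lemma tangle_functor_lin_diag:
  "wf_diag tangle_kind d \<Longrightarrow> fmor (tangle_functor n) (lin_diag tangle_kind d) =
     coset TrPD (moy_ideal n) (edges1 (src tangle_kind d), edges1 (tgt tangle_kind d), tval n d)"
  unfolding lin_diag_def by (subst tangle_functor_lin_comb) (auto simp: smult_one)

lemma scl_zero_MOY:
  assumes "moy_eq n a b f g"
  shows "scl (MOY n) 0 (coset TrPD (moy_ideal n) (edges1 a, edges1 b, f + smult (- 1) g)) =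
    coset TrPD (moy_ideal n) (edges1 a, edges1 b, f + smult (- 1) g)"
proof -
  have fg: "web_lin a b f" "web_lin a b g" using assms by (simp_all add: moy_eq_def)
  then have "(edges1 a, edges1 b, f + smult (- 1) g) \<in> moy_ideal n"
    using assms moy.coset_eq_iff[OF TrPD_Hom TrPD_Hom, of a b f g n]
    by (simp add: moy_eq_def web.sub_def web.diag_cat_simps)
  from moy.scl_zero_ideal[OF this TrPD_Hom] show ?thesis
    using fg by (simp add: moy_quotient web_lin_intros)
qed

lemma reidemeister_killed:
  assumes "g \<in> reidemeister_generators"
  shows "scl (MOY n) 0 (fmor (tangle_functor n) g) = fmor (tangle_functor n) g"
proof -
  obtain d e where g: "g = lin_comb tangle_kind (src tangle_kind d) (tgt tangle_kind d) [(1, d), (-1, e)]"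
    and de: "(d, e) \<in> reidemeister" using assms unfolding reidemeister_generators_def by blast
  have t: "tangle_eq n d e" by (rule reidemeister_tangle_eq[OF de])
  have "fmor (tangle_functor n) g = coset TrPD (moy_ideal n) (edges1 (src tangle_kind d), edges1 (tgt tangle_kind d),
      tval n d + smult (- 1) (tval n e))"
    unfolding g by (subst tangle_functor_lin_comb) (use t in \<open>auto simp: tangle_eq_def smult_one\<close>)
  moreover have "moy_eq n (src tangle_kind d) (tgt tangle_kind d) (tval n d) (tval n e)"
    using t unfolding tangle_eq_def by blast
  ultimately show ?thesis using scl_zero_MOY by metis
qed

definition td_functor :: "nat \<Rightarrow> moy_functor" where
  "td_functor n = td.induced (tangle_functor n)"

lemma td_functor_linear: "linear_monoidal_functor TD (MOY n) (td_functor n)"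
  unfolding td_functor_def by (rule td.induced_functor[OF MOY_linear tangle_functor_linear reidemeister_killed])

lemma td_functor_class:
  "f \<in> Hom tangle_diag_cat a b \<Longrightarrow> fmor (td_functor n) (td_class f) = fmor (tangle_functor n) f"
  unfolding td_functor_def by (rule td.induced_coset[OF MOY_linear tangle_functor_linear reidemeister_killed])

lemma td_functor_obj: "fobj (td_functor n) = edges1"
  by (simp add: td_functor_def td.induced_def tangle_functor_obj)

lemma linear_functor_map:
  assumes F: "linear_monoidal_functor C D F" and O: "Obj C = UNIV" and l: "\<And>x. fobj F [x] = [l x]"
  shows "fobj F a = map l a"
proof (induction a)
  case (Cons x a)
  then show ?case using linear_functorD(8)[OF F, of "[x]" a] O l by simp
qed (use linear_functorD(7)[OF F] in simp)

text \<open>The braiding of sequences is assembled from that of letters by operations every functor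
  preserves, so only pairs of letters matter. The Hom statement accompanies the induction because
  functoriality applies to composable morphisms.\<close>

lemma braid_functor:
  assumes C: "linear_tensor_cat C" and F: "linear_monoidal_functor C D F" and O: "Obj C = UNIV"
    and l: "\<And>x. fobj F [x] = [l x]"
    and c: "\<And>x y. c x y \<in> Hom C [x, y] [y, x]" and c': "\<And>x y. fmor F (c x y) = c' (l x) (l y)"
  shows "braid C c a b \<in> Hom C (a @ b) (b @ a) \<and> fmor F (braid C c a b) = braid D c' (map l a) (map l b)"
proof -
  interpret C: linear_tensor_cat C by (rule C)
  note FD = linear_functorD[OF F, unfolded O, simplified]
  have map: "fobj F a = map l a" for a by (rule linear_functor_map[OF F O l])
  have id: "idm C a \<in> Hom C a a" for a using C.idm_Hom O by simp
  have fid: "fmor F (idm C a) = idm D (map l a)" for a using FD(3) map by simp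
  have ft: "fmor F (tns C f g) = tns D (fmor F f) (fmor F g)" if "f \<in> Hom C a b" "g \<in> Hom C a' b'" for f g a b a' b'
    using FD(9) C.MorI that by blast
  have letter: "braid_letter C c x b \<in> Hom C (x # b) (b @ [x]) \<and>
      fmor F (braid_letter C c x b) = braid_letter D c' (l x) (map l b)" for x b
  proof (induction b)
    case Nil
    then show ?case using id[of "[x]"] fid[of "[x]"] by simp
  next
    case (Cons y b)
    note b = Cons[THEN conjunct1]
    note 1 = C.tns_Hom[OF id[of "[y]"] b] and 2 = C.tns_Hom[OF c[of x y] id[of b]]
    show ?case
      using 1 2 C.cmp_Hom[of "tns C (c x y) (idm C b)" "x # y # b" "y # x # b" "tns C (idm C [y]) (braid_letter C c x b)" "y # b @ [x]"]
        FD(4)[of "tns C (c x y) (idm C b)" "x # y # b" "y # x # b" "tns C (idm C [y]) (braid_letter C c x b)" "y # b @ [x]"]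
        ft[OF id[of "[y]"] b] ft[OF c[of x y] id[of b]] Cons fid[of b] fid[of "[y]"] c'
      by simp
  qed
  show ?thesis
  proof (induction a)
    case Nil
    then show ?case using id fid by simp
  next
    case (Cons x a)
    note a = Cons[THEN conjunct1] and lx = letter[of x b, THEN conjunct1]
    note 1 = C.tns_Hom[OF lx id[of a]] and 2 = C.tns_Hom[OF id[of "[x]"] a]
    show ?case
      using 1 2 C.cmp_Hom[of "tns C (idm C [x]) (braid C c a b)" "x # a @ b" "x # b @ a"
          "tns C (braid_letter C c x b) (idm C a)" "b @ x # a"]
        FD(4)[of "tns C (idm C [x]) (braid C c a b)" "x # a @ b" "x # b @ a"
          "tns C (braid_letter C c x b) (idm C a)" "b @ x # a"]
        ft[OF lx id[of a]] ft[OF id[of "[x]"] a] letter[of x b] Cons fid[of a] fid[of "[x]"]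
      by simp
  qed
qed

lemma TD_Obj: "Obj TD = UNIV"
  by (simp add: td.quotient_simps tangle.diag_cat_simps)

lemma crossing_Hom: "td_class (lin_diag tangle_kind (X s x y)) \<in> Hom TD [x, y] [y, x]"
  using td.coset_Hom[OF tangle.lin_diag_Hom[of "X s x y"]] by simp

lemma td_functor_lin_diag:
  "wf_diag tangle_kind d \<Longrightarrow> fmor (td_functor n) (td_class (lin_diag tangle_kind d)) =
     coset TrPD (moy_ideal n) (edges1 (src tangle_kind d), edges1 (tgt tangle_kind d), tval n d)"
  using td_functor_class[OF tangle.lin_diag_Hom] tangle_functor_lin_diag by simp

lemma td_functor_braiding:
  "TD_braiding a b \<in> Hom TD (a @ b) (b @ a) \<and> fmor (td_functor n) (TD_braiding a b) = MOY_braiding n (edges1 a) (edges1 b)"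
  unfolding TD_braiding_def MOY_braiding_def
  by (rule braid_functor[OF td.quot.linear_tensor_cat_axioms td_functor_linear TD_Obj _ crossing_Hom])
    (simp_all add: td_functor_obj td_functor_lin_diag web_comb_eq tval_simps)

lemma edges1_dual: "dual_obj flip_edge (edges1 a) = edges1 (dual_obj flip a)"
  by (simp add: dual_obj_def rev_map comp_def)

lemma td_functor_dual:
  "fobj (td_functor n) (dualo TD a) = dualo (MOY n) (fobj (td_functor n) a)"
  "fmor (td_functor n) (ev TD a) = ev (MOY n) (fobj (td_functor n) a)"
  "fmor (td_functor n) (coev TD a) = coev (MOY n) (fobj (td_functor n) a)"
  using wf_caps[of tangle_kind a] wf_cups[of tangle_kind a] wf_caps[of web_kind "edges1 a"] wf_cups[of web_kind "edges1 a"]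
    webs.val_caps[of n a] webs.val_cups[of n a]
  by (simp_all add: td.quotient_simps moy.quotient_simps[where n = n, unfolded moy_quotient] tangle.diag_cat_simps
      web.diag_cat_simps td_functor_obj edges1_dual td_functor_lin_diag) (simp_all add: lin_diag_def lin_comb_def edges1_dual)

lemma td_functor_Z: "is_Z_MOY n (td_functor n)"
  unfolding is_Z_MOY_def rigid_braided_functor_def
  using td_functor_linear td_functor_dual td_functor_braiding by (simp add: td_functor_obj)

section \<open>Uniqueness of the functor\<close>

lemma td_lin_diag_Hom:
  "wf_diag tangle_kind d \<Longrightarrow> lin_diag tangle_kind d \<in> Hom tangle_diag_cat (src tangle_kind d) (tgt tangle_kind d)"
  using tangle.lin_diag_Hom[of d] by simp

lemma td_stack:
  "wf_diag tangle_kind (d \<cdot> e) \<Longrightarrow> cmp TD (td_class (lin_diag tangle_kind d)) (td_class (lin_diag tangle_kind e)) =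
     td_class (lin_diag tangle_kind (d \<cdot> e))"
  using td.quotient_cmp[OF td_lin_diag_Hom[of e], of "lin_diag tangle_kind d" "tgt tangle_kind d"] td_lin_diag_Hom[of d]
  by (simp add: tangle.lin_diag_stack)

lemma td_juxt:
  "wf_diag tangle_kind (d \<otimes> e) \<Longrightarrow> tns TD (td_class (lin_diag tangle_kind d)) (td_class (lin_diag tangle_kind e)) =
     td_class (lin_diag tangle_kind (d \<otimes> e))"
  using td.quotient_tns[OF td_lin_diag_Hom[of e] td_lin_diag_Hom[of d]] by (simp add: tangle.lin_diag_juxt)

text \<open>On single letters the recursion for \<open>braid\<close> only adds trivial strands
  around the crossing. Hence the braiding condition prescribes the image of every crossing with sign
  \<open>True\<close>.\<close>

lemma TD_braiding_letters: "TD_braiding [x] [y] = td_class (lin_diag tangle_kind (X True x y))"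
proof -
  have "TD_braiding [x] [y] = td_class (lin_diag tangle_kind
      ((((Strands [y] \<otimes> Strands [x]) \<cdot> (X True x y \<otimes> Strands [])) \<otimes> Strands []) \<cdot> (Strands [x] \<otimes> Strands [y])))"
    by (simp add: TD_braiding_def td.quotient_simps tangle.diag_cat_simps td_stack td_juxt)
  also have "lin_diag tangle_kind
      ((((Strands [y] \<otimes> Strands [x]) \<cdot> (X True x y \<otimes> Strands [])) \<otimes> Strands []) \<cdot> (Strands [x] \<otimes> Strands [y])) =
      lin_diag tangle_kind (X True x y)"
    by (rule tangle.lin_diag_isotopic, rule tangle.isotopic_by_moves[of _ _ "[]" "[]"]) simp_all
  finally show ?thesis .
qed

text \<open>Both functors are pulled back to the category of all diagrams, where caps, cups and
  vertices decide. Caps and cups are fixed by rigidity and the crossings with sign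
  \<open>True\<close> by the braiding.\<close>

lemma Z_unique:
  assumes Z: "is_Z_MOY n Z" and Z': "is_Z_MOY n Z'"
  shows "Z = Z'"
proof -
  let ?\<pi> = "quotient_functor tangle_diag_cat reidemeister_ideal"
  have O: "Obj tangle_diag_cat = UNIV" by (simp add: tangle.diag_cat_simps)
  have \<pi>: "linear_monoidal_functor tangle_diag_cat TD ?\<pi>"
    using td.quotient_functor_linear O by simp
  have \<pi>_apply: "fobj ?\<pi> a = a" "f \<in> Mor tangle_diag_cat \<Longrightarrow> fmor ?\<pi> f = td_class f" for a f
    by (simp_all add: quotient_functor_def O td_class_def)
  have D: "dualo (MOY n) = dual_obj flip_edge"
    using moy.quotient_simps(3)[of n] by (simp add: moy_quotient web.diag_cat_simps)
  have lin: "linear_monoidal_functor TD (MOY n) Y" and obj: "fobj Y a = edges1 a"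
    and comp: "linear_monoidal_functor tangle_diag_cat (MOY n) (func_comp tangle_diag_cat Y ?\<pi>)"
    and co: "fobj (func_comp tangle_diag_cat Y ?\<pi>) a = edges1 a"
    and cm: "f \<in> Mor tangle_diag_cat \<Longrightarrow> fmor (func_comp tangle_diag_cat Y ?\<pi>) f = fmor Y (td_class f)"
    and ev: "fmor Y (ev TD [x]) = ev (MOY n) (edges1 [x])" and coev: "fmor Y (coev TD [x]) = coev (MOY n) (edges1 [x])"
    and br: "fmor Y (TD_braiding [x] [y]) = MOY_braiding n (edges1 [x]) (edges1 [y])"
    if Y: "is_Z_MOY n Y" for Y a f x y
  proof -
    show lin: "linear_monoidal_functor TD (MOY n) Y"
      using Y by (simp add: is_Z_MOY_def rigid_braided_functor_def)
    have up: "fobj Y [Up] = [(Up, One)]" using Y by (simp add: is_Z_MOY_def)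
    \<comment> \<open>Only the image of \<open>Up\<close> is prescribed; that of \<open>Dn\<close>
      follows by duality.\<close>
    have "fobj Y (dualo TD [Up]) = dualo (MOY n) (fobj Y [Up])"
      using Y TD_Obj by (simp add: is_Z_MOY_def rigid_braided_functor_def)
    then have "fobj Y [Dn] = [(Dn, One)]"
      by (simp add: up D td.quotient_simps tangle.diag_cat_simps dual_obj_def)
    then have "fobj Y [x] = [(x, One)]" for x using up by (cases x) simp_all
    then show obj: "fobj Y a = edges1 a" for a by (rule linear_functor_map[OF lin TD_Obj])
    show "linear_monoidal_functor tangle_diag_cat (MOY n) (func_comp tangle_diag_cat Y ?\<pi>)"
      by (rule func_comp_linear[OF tangle.linear_tensor_cat_axioms td.quot.linear_tensor_cat_axioms \<pi> lin])
        (simp_all add: O)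
    show "fobj (func_comp tangle_diag_cat Y ?\<pi>) a = edges1 a"
      by (simp add: func_comp_def O \<pi>_apply obj)
    show "f \<in> Mor tangle_diag_cat \<Longrightarrow> fmor (func_comp tangle_diag_cat Y ?\<pi>) f = fmor Y (td_class f)"
      by (simp add: func_comp_def \<pi>_apply)
    show "fmor Y (ev TD [x]) = ev (MOY n) (edges1 [x])" "fmor Y (coev TD [x]) = coev (MOY n) (edges1 [x])"
      "fmor Y (TD_braiding [x] [y]) = MOY_braiding n (edges1 [x]) (edges1 [y])"
      using Y TD_Obj obj by (simp_all add: is_Z_MOY_def rigid_braided_functor_def)
  qed
  have cap: "ev TD [x] = td_class (lin_diag tangle_kind (Cap x))" for x
    using tangle.lin_diag_isotopic[OF tangle.isotopic_by_moves[of "caps flip [x]" "Cap x" "[]" "[]"]]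
    by (simp add: td.quotient_simps tangle.diag_cat_simps)
  have cup: "coev TD [x] = td_class (lin_diag tangle_kind (Cup x))" for x
    using tangle.lin_diag_isotopic[OF tangle.isotopic_by_moves[of "cups flip [x]" "Cup x" "[]" "[]"]]
    by (simp add: td.quotient_simps tangle.diag_cat_simps)
  let ?F = "func_comp tangle_diag_cat Z ?\<pi>" and ?F' = "func_comp tangle_diag_cat Z' ?\<pi>"
  have M: "wf_diag tangle_kind d \<Longrightarrow> lin_diag tangle_kind d \<in> Mor tangle_diag_cat" for d
    by (rule tangle.MorI[OF td_lin_diag_Hom])
  have objs: "fobj ?F a = fobj ?F' a" for a by (simp add: co[OF Z] co[OF Z'])
  have caps: "fmor ?F (lin_diag tangle_kind (Cap x)) = fmor ?F' (lin_diag tangle_kind (Cap x))"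
    and cups: "fmor ?F (lin_diag tangle_kind (Cup x)) = fmor ?F' (lin_diag tangle_kind (Cup x))" for x
    using ev[OF Z, of x] ev[OF Z', of x] coev[OF Z, of x] coev[OF Z', of x]
    by (simp_all add: cm[OF Z] cm[OF Z'] M cap cup)
  have crossing: "fmor ?F (lin_diag tangle_kind (X True x y)) = fmor ?F' (lin_diag tangle_kind (X True x y))" for x y
    using br[OF Z, of x y] br[OF Z', of x y] by (simp add: cm[OF Z] cm[OF Z'] M TD_braiding_letters)
  have vertices: "fmor ?F (lin_diag tangle_kind (Vert v)) = fmor ?F' (lin_diag tangle_kind (Vert v))" for v
  proof (cases v)
    case (Crossing s x y)
    show ?thesis
    proof (cases s)
      case True
      then show ?thesis using crossing by (simp add: Crossing)
    next
      case False
      \<comment> \<open>A quarter turn of the crossing of \<open>flip y, x\<close> with sign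
        \<open>True\<close> is the crossing of \<open>x, y\<close> with sign
        \<open>False\<close>.\<close>
      let ?d = "quarter_turn flip (flip y) x (X True (flip y) x)"
      have "isotopic tangle_kind ?d (X False x y)" using tangle_turns[of "flip y" x True] by simp
      then have "lin_diag tangle_kind (X False x y) = lin_diag tangle_kind ?d"
        using tangle.lin_diag_isotopic by simp
      moreover have "fmor ?F (lin_diag tangle_kind ?d) = fmor ?F' (lin_diag tangle_kind ?d)"
      proof (rule tangle.diag_functors_agree[OF comp[OF Z] comp[OF Z'] objs caps cups])
        show "wf_diag tangle_kind ?d" by (simp add: quarter_turn_def)
        fix v assume "v \<in> set2_diag ?d"
        then have "v = Crossing True (flip y) x" by (simp add: quarter_turn_def)
        then show "fmor ?F (lin_diag tangle_kind (Vert v)) = fmor ?F' (lin_diag tangle_kind (Vert v))"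
          using crossing by metis
      qed
      ultimately show ?thesis by (simp add: Crossing False)
    qed
  qed
  have agree: "fmor Z (td_class f) = fmor Z' (td_class f)" if f: "f \<in> Mor tangle_diag_cat" for f
    using tangle.diag_functors_eqI[OF MOY_linear comp[OF Z] comp[OF Z'] objs caps cups vertices f]
    by (simp add: cm[OF Z f] cm[OF Z' f])
  have "fmor Z g = fmor Z' g" for g
  proof (cases "g \<in> Mor TD")
    case True
    then obtain a b where "g \<in> Hom TD a b" unfolding td.quot.Mor_iff by blast
    then obtain f where "f \<in> Hom tangle_diag_cat a b" "g = td_class f" unfolding td.quotient_Hom by blast
    then show ?thesis using agree[OF tangle.MorI] by simp
  next
    case False
    moreover have "fmor Z \<in> extensional (Mor TD)" "fmor Z' \<in> extensional (Mor TD)"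
      using lin[OF Z] lin[OF Z'] by (simp_all add: linear_monoidal_functor_def)
    ultimately show ?thesis by (simp add: extensional_def)
  qed
  moreover have "fobj Z = fobj Z'" using obj[OF Z] obj[OF Z'] by auto
  ultimately show "Z = Z'" by (intro func.equality) auto
qed

lemma Z_MOY_eq: "Z_MOY n = td_functor n"
  unfolding Z_MOY_def by (rule the_equality, rule td_functor_Z) (rule Z_unique[OF _ td_functor_Z])

section \<open>The Jones relations and the factorization\<close>

lemma jones_killed:
  assumes "g \<in> jones_generators n"
  shows "scl (MOY n) 0 (fmor (td_functor n) g) = fmor (td_functor n) g"
  using assms unfolding jones_generators_def
proof (elim UnE CollectE exE conjE singletonE)
  let ?cs = "[(qpow (- int n), X True Up Up), (- qpow (int n), X False Up Up), (- (q_inv - q), Strands [Up, Up])]"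
  assume g: "g = td_class (lin_comb tangle_kind [Up, Up] [Up, Up] ?cs)"
  have up: "comb (sigma_up n s) = smult (sigma_ratio s * sigma_coeff n s) (V (strands1 [Up, Up])) +
      smult (- sigma_coeff n s) (V (S Up))" for s
    using comb_sigma_parallel[of n s Up] by simp
  \<comment> \<open>The terms in \<open>S\<close> carry the product of q^n and q^{-n} with both
    signs and cancel. What is left on the strands vanishes because that product is 1.\<close>
  have "(\<Sum>(c, d)\<leftarrow>?cs. smult c (tval n d)) =
      smult ((qpow (int n) * qpow (- int n) - 1) * (q_inv - q)) (V (strands1 [Up, Up]))"
    by (rule poly_mapping_eqI) (simp add: tval_simps up sigma_coeff_def sigma_ratio_def
        lookup_add lookup_smult algebra_simps)
  then have "(\<Sum>(c, d)\<leftarrow>?cs. smult c (tval n d)) = 0"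
    by (simp add: qpow_minus smult_zero)
  moreover have "fmor (td_functor n) g = coset TrPD (moy_ideal n)
      (edges1 [Up, Up], edges1 [Up, Up], \<Sum>(c, d)\<leftarrow>?cs. smult c (tval n d))"
    unfolding g td_functor_class[OF skein_Hom] by (rule tangle_functor_lin_comb) auto
  moreover have "web_lin [Up, Up] [Up, Up] 0" by (simp add: web_lin_def)
  ultimately show ?thesis
    using scl_zero_MOY[of n "[Up, Up]" "[Up, Up]" 0 0] moy_eq_refl[of "[Up, Up]" "[Up, Up]" 0 n]
    by (simp add: smult_zero)
next
  fix x
  let ?cs = "[(1, Cap x \<cdot> Cup x), (- qint (int n), Strands [])] :: (qring \<times> (ori, crossing) diag) list"
  assume g: "g = td_class (lin_comb tangle_kind [] [] ?cs)"
  have "fmor (td_functor n) g = coset TrPD (moy_ideal n) (edges1 [], edges1 [], \<Sum>(c, d)\<leftarrow>?cs. smult c (tval n d))"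
    unfolding g td_functor_class[OF unknot_Hom] by (rule tangle_functor_lin_comb) auto
  moreover have "(\<Sum>(c, d)\<leftarrow>?cs. smult c (tval n d)) =
      V (cap1 x \<cdot> cup1 x) + smult (- 1) (smult (qint (int n)) (V (strands1 [])))"
    by (simp add: tval_simps V_stack smult_one smult_neg)
  ultimately show ?thesis using scl_zero_MOY[OF circle[of n x]] by simp
qed

theorem proposition3p2p2:
  fixes n :: nat
  assumes "2 \<le> n"
  shows "(\<exists>!Z. is_Z_MOY n Z) \<and>
    (\<exists>F. rigid_braided_functor (Jones n) (Jones_braiding n) (MOY n) (MOY_braiding n) F \<and>
         Z_MOY n = func_comp TD F (quotient_functor TD (jones_ideal n)))"
proof (intro conjI exI)
  show "\<exists>!Z. is_Z_MOY n Z" using td_functor_Z Z_unique by blast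
  let ?F = "jones.induced n (td_functor n)"
  have a: "fmor ?F (coset TD (jones_ideal n) f) = fmor (td_functor n) f" if "f \<in> Hom TD a b" for f a b
    by (rule jones.induced_coset[OF MOY_linear td_functor_linear jones_killed that])
  have o: "fobj ?F = fobj (td_functor n)" by (simp add: jones.induced_def)
  \<comment> \<open>The typing under which the induced functor can be evaluated on the classes of
    \<open>ev\<close> and \<open>coev\<close>.\<close>
  have evs: "ev TD x \<in> Hom TD (x @ dual_obj flip x) []" "coev TD x \<in> Hom TD [] (x @ dual_obj flip x)" for x
    using td.coset_Hom[OF td_lin_diag_Hom[of "caps flip x"]] td.coset_Hom[OF td_lin_diag_Hom[of "cups flip x"]]
      wf_caps[of tangle_kind x] wf_cups[of tangle_kind x]
    by (simp_all add: td.quotient_simps tangle.diag_cat_simps)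
  have l: "linear_monoidal_functor (Jones n) (MOY n) ?F"
    by (rule jones.induced_functor[OF MOY_linear td_functor_linear jones_killed])
  show "rigid_braided_functor (Jones n) (Jones_braiding n) (MOY n) (MOY_braiding n) ?F"
    unfolding rigid_braided_functor_def
  proof (intro conjI ballI l)
    fix x y
    show "fobj ?F (dualo (Jones n) x) = dualo (MOY n) (fobj ?F x)"
      unfolding o jones.quotient_simps by (rule td_functor_dual)
    show "fmor ?F (ev (Jones n) x) = ev (MOY n) (fobj ?F x)"
      unfolding o jones.quotient_simps a[OF evs(1)] by (rule td_functor_dual)
    show "fmor ?F (coev (Jones n) x) = coev (MOY n) (fobj ?F x)"
      unfolding o jones.quotient_simps a[OF evs(2)] by (rule td_functor_dual)
    show "fmor ?F (Jones_braiding n x y) = MOY_braiding n (fobj ?F x) (fobj ?F y)"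
      unfolding Jones_braiding_def a[OF td_functor_braiding[THEN conjunct1]] o td_functor_obj
      by (rule td_functor_braiding[THEN conjunct2])
  qed
  show "Z_MOY n = func_comp TD ?F (quotient_functor TD (jones_ideal n))"
    unfolding Z_MOY_eq
  proof (intro func.equality)
    show "fobj (td_functor n) = fobj (func_comp TD ?F (quotient_functor TD (jones_ideal n)))"
      by (auto simp: func_comp_def quotient_functor_def TD_Obj o)
    \<comment> \<open>The composite is restricted to the morphisms of \<open>TD\<close>, so equality
      as functions requires the other side to be undefined outside them as well.\<close>
    have "fmor (td_functor n) \<in> extensional (Mor TD)"
      using td_functor_linear by (simp add: linear_monoidal_functor_def)
    then show "fmor (td_functor n) = fmor (func_comp TD ?F (quotient_functor TD (jones_ideal n)))"
      using a by (auto simp: func_comp_def quotient_functor_def td.quot.Mor_iff extensional_def restrict_def fun_eq_iff)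
  qed simp
qed

end
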